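(* Let $n\geq 3$, and let $F_n$ be the free group of rank $n$. Let $\mathcal{I}=\mathcal{I}_1$ be the Torelli subgroup of $\mathrm{Aut}(F_n)$ and $\mathcal{I}_k$ the $k$-th term of the Johnson filtration of $\mathrm{Aut}(F_n)$. Then for every integer $k\geq 1$ and every homological representation $\rho$ of $\mathrm{Aut}(F_n)$, $[\rho(\mathcal{I}):\rho(\mathcal{I}_k)]<\infty$.
   Context: Johnson filtration: let $L_1=[F_n,F_n]$ and $L_{i+1}=[F_n,L_i]$ for $i\geq 1$; these are characteristic subgroups of $F_n$. For $k\geq 1$, $\mathcal{I}_k$ is the kernel of the induced map $\mathrm{Aut}(F_n)\to\mathrm{Aut}(F_n/L_k)$. The Torelli subgroup is $\mathcal{I}=\mathcal{I}_1$. Homological representations: given a finite-index characteristic subgroup $K\leq F_n$, restriction to $K$ gives a homomorphism $\mathrm{Aut}(F_n)\to\mathrm{Aut}(K)$, which induces $\rho:\mathrm{Aut}(F_n)\to\mathrm{GL}(H_1(K,\mathbb{Z}))$. The homological representations of $\mathrm{Aut}(F_n)$ are the representations arising in this way. *)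

theory Defs
  imports "HOL-Algebra.Bij" "HOL-Algebra.Generated_Groups"
begin

section \<open>Free groups\<close>

text \<open>
  The letter \<open>(b, x)\<close> stands for the generator \<open>x\<close> if \<open>b\<close> is true and for its inverse otherwise.
  Elements of the free group on \<open>X\<close> are the reduced words in these letters, and the product of
  \<open>u\<close> and \<open>v\<close> is the reduced form of their concatenation.
\<close>

type_synonym 'a word = "(bool \<times> 'a) list"

definition inv_letter :: "bool \<times> 'a \<Rightarrow> bool \<times> 'a" where
  "inv_letter l = (\<not> fst l, snd l)"

definition reduced :: "'a word \<Rightarrow> bool" where
  "reduced w \<longleftrightarrow> successively (\<lambda>l m. m \<noteq> inv_letter l) w"

fun cancel_cons :: "bool \<times> 'a \<Rightarrow> 'a word \<Rightarrow> 'a word" where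
  "cancel_cons l [] = [l]"
| "cancel_cons l (m # w) = (if m = inv_letter l then w else l # m # w)"

definition free_group :: "'a set \<Rightarrow> 'a word monoid" where
  "free_group X =
    \<lparr>carrier = {w \<in> lists (UNIV \<times> X). reduced w},
     mult = (\<lambda>u v. foldr cancel_cons u v),
     one = []\<rparr>"

abbreviation free_group_rank :: "nat \<Rightarrow> nat word monoid" where
  "free_group_rank n \<equiv> free_group {..<n}"

lemma inv_letter_inv_letter [simp]: "inv_letter (inv_letter l) = l"
  by (simp add: inv_letter_def)

lemma inv_letter_in [simp]: "inv_letter l \<in> UNIV \<times> X \<longleftrightarrow> l \<in> UNIV \<times> X"
  by (cases l) (simp add: inv_letter_def)

lemma reduced_tl: "reduced (l # w) \<Longrightarrow> reduced w"
  by (auto simp: reduced_def successively_Cons)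

lemma reduced_Cons: "reduced (l # w) \<Longrightarrow> cancel_cons l w = l # w"
  by (cases w) (auto simp: reduced_def)

lemma reduced_cancel_cons: "reduced w \<Longrightarrow> reduced (cancel_cons l w)"
  by (cases w) (auto simp: reduced_def successively_Cons)

lemma reduced_mult: "reduced v \<Longrightarrow> reduced (foldr cancel_cons u v)"
  by (induction u) (auto simp: reduced_cancel_cons)

lemma cancel_cons_in: "l \<in> UNIV \<times> X \<Longrightarrow> w \<in> lists (UNIV \<times> X) \<Longrightarrow> cancel_cons l w \<in> lists (UNIV \<times> X)"
  by (cases w) auto

lemma mult_in:
  assumes "u \<in> lists (UNIV \<times> X)" "v \<in> lists (UNIV \<times> X)"
  shows "foldr cancel_cons u v \<in> lists (UNIV \<times> X)"
  using assms(1)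
proof induction
  case Nil
  then show ?case using assms(2) by simp
next
  case (Cons l u)
  then show ?case using cancel_cons_in[of l X] by simp
qed

lemma cancel_cons_inv: "reduced w \<Longrightarrow> cancel_cons l (cancel_cons (inv_letter l) w) = w"
  by (cases w) (auto simp: reduced_Cons)

lemma mult_cancel_cons:
  assumes "reduced v"
  shows "foldr cancel_cons (cancel_cons l u) v = cancel_cons l (foldr cancel_cons u v)"
proof (cases u)
  case (Cons m u')
  then show ?thesis
    using cancel_cons_inv[OF reduced_mult[OF assms], of l u'] by auto
qed simp

lemma mult_assoc_word:
  assumes "reduced w"
  shows "foldr cancel_cons (foldr cancel_cons u v) w = foldr cancel_cons u (foldr cancel_cons v w)"
  by (induction u) (auto simp: mult_cancel_cons[OF assms])

lemma mult_Nil_right: "reduced u \<Longrightarrow> foldr cancel_cons u [] = u"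
proof (induction u)
  case (Cons l u)
  then show ?case using reduced_tl[OF Cons.prems] reduced_Cons[OF Cons.prems] by simp
qed simp

lemma reduced_inverse:
  assumes "reduced u"
  shows "reduced (rev (map inv_letter u))"
proof -
  have "(m \<noteq> inv_letter l) = (inv_letter l \<noteq> inv_letter (inv_letter m))" for l m :: "bool \<times> 'a"
    by auto
  with assms show ?thesis
    unfolding reduced_def successively_rev successively_map by simp
qed

lemma mult_inverse: "foldr cancel_cons (rev (map inv_letter u)) u = []"
  by (induction u) (auto)

theorem group_free_group: "group (free_group X)"
proof (rule groupI)
  fix x assume x: "x \<in> carrier (free_group X)"
  have "rev (map inv_letter x) \<in> carrier (free_group X)"
    using x reduced_inverse[of x] by (force simp: free_group_def inv_letter_def)
  then show "\<exists>y\<in>carrier (free_group X). y \<otimes>\<^bsub>free_group X\<^esub> x = \<one>\<^bsub>free_group X\<^esub>"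
    by (rule bexI[rotated]) (simp add: free_group_def mult_inverse)
next
  fix x y assume "x \<in> carrier (free_group X)" "y \<in> carrier (free_group X)"
  then show "x \<otimes>\<^bsub>free_group X\<^esub> y \<in> carrier (free_group X)"
    using mult_in[of x X y] by (simp add: free_group_def reduced_mult)
qed (auto simp: free_group_def mult_assoc_word reduced_def[of "[]"])


text \<open>The universal property of the free group on \<open>X\<close>.\<close>

definition eval_word :: "('b, 'c) monoid_scheme \<Rightarrow> ('a \<Rightarrow> 'b) \<Rightarrow> 'a word \<Rightarrow> 'b" where
  "eval_word G f w =
    foldr (\<lambda>l g. (if fst l then f (snd l) else inv\<^bsub>G\<^esub> f (snd l)) \<otimes>\<^bsub>G\<^esub> g) w \<one>\<^bsub>G\<^esub>"

lemma (in group) eval_word_closed: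
  assumes "f \<in> X \<rightarrow> carrier G" "w \<in> lists (UNIV \<times> X)"
  shows "eval_word G f w \<in> carrier G"
  using assms(2) by induction (use assms(1) in \<open>auto simp: eval_word_def Pi_iff\<close>)

lemma (in group) eval_word_cancel_cons:
  assumes f: "f \<in> X \<rightarrow> carrier G" and l: "l \<in> UNIV \<times> X" and w: "w \<in> lists (UNIV \<times> X)"
  shows "eval_word G f (cancel_cons l w) =
    (if fst l then f (snd l) else inv f (snd l)) \<otimes> eval_word G f w"
proof (cases w)
  case (Cons m w')
  have "eval_word G f w' \<in> carrier G" using eval_word_closed[OF f, of w'] w Cons by simp
  moreover have "f (snd l) \<in> carrier G" using f l by auto
  ultimately show ?thesis
    using Cons by (auto simp: eval_word_def inv_letter_def m_assoc[symmetric])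
qed (simp add: eval_word_def)

theorem (in group) free_group_universal:
  assumes f: "f \<in> X \<rightarrow> carrier G"
  shows "eval_word G f \<in> hom (free_group X) G"
    and "x \<in> X \<Longrightarrow> eval_word G f [(True, x)] = f x"
proof -
  have "eval_word G f (foldr cancel_cons u v) = eval_word G f u \<otimes> eval_word G f v"
    if "u \<in> lists (UNIV \<times> X)" and v: "v \<in> lists (UNIV \<times> X)" for u v
    using that(1)
  proof induction
    case Nil
    then show ?case using eval_word_closed[OF f v] by (simp add: eval_word_def)
  next
    case (Cons l u)
    have "f (snd l) \<in> carrier G" using f Cons by auto
    then show ?case
      using Cons.IH eval_word_cancel_cons[OF f Cons.hyps(1) mult_in[OF Cons.hyps(2) v]]
        eval_word_closed[OF f Cons.hyps(2)] eval_word_closed[OF f v]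
      by (simp add: eval_word_def m_assoc)
  qed
  then show "eval_word G f \<in> hom (free_group X) G"
    using eval_word_closed[OF f] by (simp add: hom_def free_group_def)
  show "x \<in> X \<Longrightarrow> eval_word G f [(True, x)] = f x"
    using f by (auto simp: eval_word_def Pi_iff)
qed

theorem free_group_generated:
  "generate (free_group X) ((\<lambda>x. [(True, x)]) ` X) = carrier (free_group X)"
proof
  interpret F: group "free_group X" by (rule group_free_group)
  let ?S = "(\<lambda>x. [(True, x)]) ` X"
  have S: "?S \<subseteq> carrier (free_group X)"
    by (auto simp: free_group_def reduced_def)
  show "generate (free_group X) ?S \<subseteq> carrier (free_group X)"
    using F.generate_incl[OF S] .
  have letter: "[l] \<in> generate (free_group X) ?S" if l: "l \<in> UNIV \<times> X" for l
  proof (cases "fst l")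
    case True
    then show ?thesis using that by (intro generate.incl) (cases l, auto)
  next
    case False
    then obtain x where x: "l = (False, x)" "x \<in> X" using l by (cases l) auto
    have "inv\<^bsub>free_group X\<^esub> [(True, x)] = [(False, x)]"
      using x by (intro F.inv_equality) (auto simp: free_group_def reduced_def inv_letter_def)
    then show ?thesis using x generate.inv[of "[(True, x)]" ?S "free_group X"] by auto
  qed
  have "w \<in> generate (free_group X) ?S" if "w \<in> lists (UNIV \<times> X)" "reduced w" for w
    using that
  proof induction
    case Nil
    then show ?case using generate.one[of "free_group X" ?S] by (simp add: free_group_def)
  next
    case (Cons l w)
    have "[l] \<otimes>\<^bsub>free_group X\<^esub> w \<in> generate (free_group X) ?S"
      using Cons letter reduced_tl[OF Cons.prems] by (intro generate.eng) auto
    then show ?case using reduced_Cons[OF Cons.prems] by (simp add: free_group_def)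
  qed
  then show "carrier (free_group X) \<subseteq> generate (free_group X) ?S"
    by (auto simp: free_group_def)
qed


section \<open>Characteristic subgroups and induced automorphisms\<close>

definition characteristic :: "'a set \<Rightarrow> ('a, 'b) monoid_scheme \<Rightarrow> bool" where
  "characteristic N G \<longleftrightarrow> subgroup N G \<and> (\<forall>\<phi>\<in>auto G. \<phi> ` N = N)"

text \<open>
  For \<open>N\<close> normal in \<open>G\<close> and preserved by the automorphism \<open>\<phi>\<close>, this is the automorphism
  \<open>gN \<mapsto> \<phi>(g)N\<close> of \<open>G/N\<close>: the elements of \<^term>\<open>carrier (G Mod N)\<close> are the cosets themselves.
\<close>
definition induced_aut :: "('a, 'b) monoid_scheme \<Rightarrow> 'a set \<Rightarrow> ('a \<Rightarrow> 'a) \<Rightarrow> 'a set \<Rightarrow> 'a set" where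
  "induced_aut G N \<phi> = (\<lambda>C\<in>carrier (G Mod N). \<phi> ` C)"


section \<open>The Johnson filtration\<close>

definition commutator_subgroup :: "('a, 'b) monoid_scheme \<Rightarrow> 'a set \<Rightarrow> 'a set \<Rightarrow> 'a set" where
  "commutator_subgroup G H K =
    generate G (\<Union>h\<in>H. \<Union>k\<in>K. {h \<otimes>\<^bsub>G\<^esub> k \<otimes>\<^bsub>G\<^esub> inv\<^bsub>G\<^esub> h \<otimes>\<^bsub>G\<^esub> inv\<^bsub>G\<^esub> k})"

text \<open>The numbering is such that \<open>lower_central G 1\<close> is \<open>[G, G]\<close>.\<close>
primrec lower_central :: "('a, 'b) monoid_scheme \<Rightarrow> nat \<Rightarrow> 'a set" where
  "lower_central G 0 = carrier G"
| "lower_central G (Suc i) = commutator_subgroup G (carrier G) (lower_central G i)"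

definition johnson :: "('a, 'b) monoid_scheme \<Rightarrow> nat \<Rightarrow> ('a \<Rightarrow> 'a) set" where
  "johnson G k =
    kernel (AutoGroup G) (AutoGroup (G Mod lower_central G k)) (induced_aut G (lower_central G k))"

definition torelli :: "('a, 'b) monoid_scheme \<Rightarrow> ('a \<Rightarrow> 'a) set" where
  "torelli G = johnson G 1"


section \<open>Homological representations\<close>

text \<open>
  \<open>H1 K\<close> is the first integral homology of the group \<open>K\<close>, that is, its abelianization \<open>K/[K, K]\<close>.
  Its \<open>\<int>\<close>-linear automorphisms are its automorphisms as an abelian group.
\<close>
definition H1 :: "('a, 'b) monoid_scheme \<Rightarrow> 'a set monoid" where
  "H1 K = K Mod derived K (carrier K)"

abbreviation GL_H1 :: "('a, 'b) monoid_scheme \<Rightarrow> ('a set \<Rightarrow> 'a set) monoid" where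
  "GL_H1 K \<equiv> AutoGroup (H1 K)"

definition homological_rep ::
    "('a, 'b) monoid_scheme \<Rightarrow> 'a set \<Rightarrow> ('a \<Rightarrow> 'a) \<Rightarrow> 'a set \<Rightarrow> 'a set" where
  "homological_rep G K \<phi> =
    induced_aut (G\<lparr>carrier := K\<rparr>) (derived (G\<lparr>carrier := K\<rparr>) K) (restrict \<phi> K)"


section \<open>Well-definedness\<close>

lemma autoD:
  assumes "\<phi> \<in> auto G"
  shows "\<phi> \<in> hom G G" "inj_on \<phi> (carrier G)" "\<phi> ` carrier G = carrier G"
    "\<phi> \<in> extensional (carrier G)"
  using assms by (auto simp: auto_def Bij_def bij_betw_def)

lemma (in group) characteristic_imp_normal:
  assumes "characteristic N G"
  shows "N \<lhd> G"
proof -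
  have sub: "subgroup N G" using assms by (simp add: characteristic_def)
  show ?thesis
  proof (rule normal_invI[OF sub])
    fix x h assume x: "x \<in> carrier G" and h: "h \<in> N"
    let ?f = "\<lambda>y\<in>carrier G. x \<otimes> y \<otimes> inv x"
    have inv_l: "inv x \<otimes> (x \<otimes> z) = z" "x \<otimes> (inv x \<otimes> z) = z" if "z \<in> carrier G" for z
      using x that by (simp_all add: m_assoc[symmetric])
    have hom: "?f \<in> hom G G"
      using x by (auto simp: hom_def m_assoc inv_l)
    have bij: "bij_betw ?f (carrier G) (carrier G)"
      by (rule bij_betw_byWitness[where f'="\<lambda>y. inv x \<otimes> y \<otimes> x"])
         (use x in \<open>auto simp: m_assoc inv_l\<close>)
    have "?f \<in> auto G" using hom bij by (auto simp: auto_def Bij_def)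
    then have "?f ` N = N" using assms unfolding characteristic_def by blast
    moreover have "?f h = x \<otimes> h \<otimes> inv x" using subgroup.mem_carrier[OF sub h] by simp
    ultimately show "x \<otimes> h \<otimes> inv x \<in> N" using h by (metis image_eqI)
  qed
qed

lemma (in group) commutator_subgroup_image:
  assumes \<phi>: "\<phi> \<in> hom G G" and "H \<subseteq> carrier G" "K \<subseteq> carrier G"
  shows "\<phi> ` commutator_subgroup G H K = commutator_subgroup G (\<phi> ` H) (\<phi> ` K)"
proof -
  interpret \<phi>: group_hom G G \<phi> using \<phi> by unfold_locales
  let ?c = "\<lambda>H K. \<Union>h\<in>H. \<Union>k\<in>K. {h \<otimes> k \<otimes> inv h \<otimes> inv k}"
  have mem: "h \<in> carrier G" "k \<in> carrier G" if "h \<in> H" "k \<in> K" for h k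
    using assms that by auto
  have sub: "?c H K \<subseteq> carrier G" using mem by auto
  have eq: "\<phi> (h \<otimes> k \<otimes> inv h \<otimes> inv k) = \<phi> h \<otimes> \<phi> k \<otimes> inv \<phi> h \<otimes> inv \<phi> k"
    if "h \<in> H" "k \<in> K" for h k
    using mem[OF that] by simp
  have "\<phi> ` ?c H K = ?c (\<phi> ` H) (\<phi> ` K)"
    using eq by (simp add: image_UN)
  then show ?thesis
    unfolding commutator_subgroup_def using \<phi>.generate_img[OF sub] by simp
qed

lemma derived_eq_commutator_subgroup: "derived G H = commutator_subgroup G H H"
  by (simp add: derived_def commutator_subgroup_def)

lemma (in group) subgroup_commutator_subgroup:
  assumes "H \<subseteq> carrier G" "K \<subseteq> carrier G"
  shows "subgroup (commutator_subgroup G H K) G"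
  unfolding commutator_subgroup_def using assms by (intro generate_is_subgroup) (auto simp: subset_iff)

lemma (in group) characteristic_lower_central: "characteristic (lower_central G i) G"
proof (induction i)
  case 0
  then show ?case by (auto simp: characteristic_def subgroup_self autoD(3))
next
  case (Suc i)
  have sub: "lower_central G i \<subseteq> carrier G"
    using Suc by (simp add: characteristic_def subgroup.subset)
  show ?case
    using Suc sub
    by (simp add: characteristic_def subgroup_commutator_subgroup commutator_subgroup_image autoD)
qed

lemma (in group) characteristic_derived: "characteristic (derived G (carrier G)) G"
  using characteristic_lower_central[of 1] by (simp add: derived_eq_commutator_subgroup)

lemma (in normal) induced_aut_coset:
  assumes \<phi>: "\<phi> \<in> auto G" "\<phi> ` H = H" and a: "a \<in> carrier G"
  shows "induced_aut G H \<phi> (H #> a) = H #> \<phi> a"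
proof -
  have "\<phi> ` (H #> a) = (\<phi> ` H) #> \<phi> a"
    using hom_mult[OF autoD(1)[OF \<phi>(1)]] a subset by (auto simp: r_coset_def image_UN)
  moreover have "H #> a \<in> carrier (G Mod H)" using a by (auto simp: FactGroup_def RCOSETS_def)
  ultimately show ?thesis using \<phi>(2) by (simp add: induced_aut_def)
qed

lemma (in normal) induced_aut_in_auto:
  assumes \<phi>: "\<phi> \<in> auto G" "\<phi> ` H = H"
  shows "induced_aut G H \<phi> \<in> auto (G Mod H)"
proof -
  note ind = induced_aut_coset[OF \<phi>]
  have cl: "\<phi> a \<in> carrier G" if "a \<in> carrier G" for a
    using that autoD(3)[OF \<phi>(1)] by blast
  have car: "carrier (G Mod H) = (\<lambda>a. H #> a) ` carrier G"
    by (auto simp: FactGroup_def RCOSETS_def)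
  have hom: "induced_aut G H \<phi> \<in> hom (G Mod H) (G Mod H)"
    using cl hom_mult[OF autoD(1)[OF \<phi>(1)]]
    by (auto simp: hom_def car ind) (simp_all add: FactGroup_def rcos_sum ind)
  have inj: "inj_on (induced_aut G H \<phi>) (carrier (G Mod H))"
  proof (rule inj_onI)
    fix C D
    assume CD: "C \<in> carrier (G Mod H)" "D \<in> carrier (G Mod H)"
      "induced_aut G H \<phi> C = induced_aut G H \<phi> D"
    have "C \<subseteq> carrier G" "D \<subseteq> carrier G"
      using CD r_coset_subset_G[OF subset] by (auto simp: car)
    then show "C = D"
      using CD autoD(2)[OF \<phi>(1)] by (auto simp: induced_aut_def inj_on_image_eq_iff)
  qed
  have "induced_aut G H \<phi> ` carrier (G Mod H) = (\<lambda>a. H #> a) ` (\<phi> ` carrier G)"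
    by (simp add: car image_image ind)
  then have "induced_aut G H \<phi> ` carrier (G Mod H) = carrier (G Mod H)"
    using autoD(3)[OF \<phi>(1)] by (simp add: car)
  with hom inj show ?thesis
    by (auto simp: auto_def Bij_def bij_betw_def induced_aut_def)
qed

lemma carrier_AutoGroup: "carrier (AutoGroup G) = auto G"
  by (simp add: AutoGroup_def)

lemma mult_AutoGroup:
  "\<phi> \<in> auto G \<Longrightarrow> \<psi> \<in> auto G \<Longrightarrow> \<phi> \<otimes>\<^bsub>AutoGroup G\<^esub> \<psi> = compose (carrier G) \<phi> \<psi>"
  by (simp add: AutoGroup_def BijGroup_def auto_def)

lemma (in group) auto_closed:
  "\<phi> \<in> auto G \<Longrightarrow> \<psi> \<in> auto G \<Longrightarrow> compose (carrier G) \<phi> \<psi> \<in> auto G"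
  using monoid.m_closed[OF group.is_monoid[OF AutoGroup], of \<phi> \<psi>]
  by (simp add: carrier_AutoGroup mult_AutoGroup)

lemma (in normal) induced_aut_compose:
  assumes \<phi>: "\<phi> \<in> auto G" "\<phi> ` H = H" and \<psi>: "\<psi> \<in> auto G" "\<psi> ` H = H"
  shows "induced_aut G H (compose (carrier G) \<phi> \<psi>) =
    induced_aut G H \<phi> \<otimes>\<^bsub>AutoGroup (G Mod H)\<^esub> induced_aut G H \<psi>"
proof -
  have "compose (carrier G) \<phi> \<psi> ` C = induced_aut G H \<phi> (induced_aut G H \<psi> C)"
    if C: "C \<in> carrier (G Mod H)" for C
  proof -
    have "C \<subseteq> carrier G"
      using C r_coset_subset_G[OF subset] by (auto simp: FactGroup_def RCOSETS_def)
    then have "compose (carrier G) \<phi> \<psi> ` C = \<phi> ` \<psi> ` C"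
      by (auto simp: compose_def image_image intro!: image_cong)
    moreover have "induced_aut G H \<psi> C \<in> carrier (G Mod H)"
      using C autoD(3)[OF induced_aut_in_auto[OF \<psi>]] by blast
    ultimately show ?thesis using C by (simp add: induced_aut_def)
  qed
  then show ?thesis
    using induced_aut_in_auto[OF \<phi>] induced_aut_in_auto[OF \<psi>]
    by (auto simp: mult_AutoGroup compose_def induced_aut_def[of G H "restrict _ _"]
        intro!: restrict_ext)
qed

theorem (in group) induced_aut_hom:
  assumes "characteristic N G"
  shows "induced_aut G N \<in> hom (AutoGroup G) (AutoGroup (G Mod N))"
proof -
  interpret normal N G using characteristic_imp_normal[OF assms] .
  have "\<phi> ` N = N" if "\<phi> \<in> auto G" for \<phi> using assms that by (simp add: characteristic_def)
  then show ?thesis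
    by (auto simp: hom_def carrier_AutoGroup mult_AutoGroup induced_aut_in_auto induced_aut_compose)
qed

lemma (in group) restrict_hom:
  assumes "characteristic K G"
  shows "(\<lambda>\<phi>. restrict \<phi> K) \<in> hom (AutoGroup G) (AutoGroup (G\<lparr>carrier := K\<rparr>))"
proof -
  have sub: "K \<subseteq> carrier G" using assms by (simp add: characteristic_def subgroup.subset)
  have K: "\<phi> ` K = K" if "\<phi> \<in> auto G" for \<phi> using assms that by (simp add: characteristic_def)
  have r: "restrict \<phi> K \<in> auto (G\<lparr>carrier := K\<rparr>)" if "\<phi> \<in> auto G" for \<phi>
  proof -
    have "\<phi> x \<in> K" if "x \<in> K" for x using K[OF \<open>\<phi> \<in> auto G\<close>] that by blast
    moreover have "\<phi> (x \<otimes> y) = \<phi> x \<otimes> \<phi> y" if "x \<in> K" "y \<in> K" for x y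
      using hom_mult[OF autoD(1)[OF \<open>\<phi> \<in> auto G\<close>]] that sub by blast
    moreover have "x \<otimes> y \<in> K" if "x \<in> K" "y \<in> K" for x y
      using assms that by (simp add: characteristic_def subgroup.m_closed)
    moreover have "inj_on \<phi> K" using autoD(2)[OF that] sub inj_on_subset by blast
    ultimately show ?thesis
      using K[OF that] by (auto simp: auto_def hom_def Bij_def bij_betw_def)
  qed
  have "restrict (compose (carrier G) \<phi> \<psi>) K = compose K (restrict \<phi> K) (restrict \<psi> K)"
    if "\<phi> \<in> auto G" "\<psi> \<in> auto G" for \<phi> \<psi>
    using K[OF that(2)] sub by (auto simp: compose_def fun_eq_iff restrict_def)
  with r show ?thesis
    by (auto simp: hom_def carrier_AutoGroup mult_AutoGroup)
qed

theorem (in group) homological_rep_hom: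
  assumes "characteristic K G"
  shows "homological_rep G K \<in> hom (AutoGroup G) (GL_H1 (G\<lparr>carrier := K\<rparr>))"
proof -
  interpret K: group "G\<lparr>carrier := K\<rparr>"
    using assms by (simp add: characteristic_def subgroup.subgroup_is_group)
  have "homological_rep G K =
      induced_aut (G\<lparr>carrier := K\<rparr>) (derived (G\<lparr>carrier := K\<rparr>) K) \<circ> (\<lambda>\<phi>. restrict \<phi> K)"
    by (auto simp: homological_rep_def)
  then show ?thesis
    using Group.hom_compose[OF restrict_hom[OF assms] K.induced_aut_hom[OF K.characteristic_derived]]
    by (simp add: H1_def)
qed

end

(* The quotient rho(I)/rho(I_k) is nilpotent, since [I, I_j] is contained in I_{j+1}, and each quotient
   I_j/I_{j+1} embeds into a finite power of the finitely generated abelian group L_j/L_{j+1}.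
   So it is finite as soon as it is torsion, and for this it suffices that its abelianization is torsion.
   The torsion classes in I form a normal subgroup T of Aut(F_n), and Aut(F_n)/T is compared with GL_n(Z):
   T contains enough elements for the transvections to satisfy the Steinberg relations modulo T.
   Silvester's descent on integer vectors (a short proof of the presentation of GL_n(Z)) then gives
   Magnus' theorem in the form I = T, given that Aut(F_n) is generated by transvections and signed
   permutations (Nielsen reduction).

   T contains x_i -> u x_i v for u, v in the commutator subgroup of F' = <x_j | j /= i>:  if g is the order
   of F_n/K, then [q, r]^(g^2) is congruent to [q^g, r^g], an element of [K, K], modulo higher commutators,
   so a power of u is congruent modulo [K, K] to an element of L_k, and replacing u by an element
   congruent modulo [K, K] does not change the action on H_1(K).  T contains x_i -> x_j x_i x_j^-1 since
   modulo T this does not depend on i, while the product over all i is an inner automorphism,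
   a power of which is conjugation by an element of K and acts trivially on H_1(K). *)

theory Submission
  imports Defs "HOL-Algebra.Multiplicative_Group"
begin

section \<open>Commutators and the lower central series\<close>

text \<open>The argument takes place in Aut(F_n): with \<open>M\<close> the preimage of rho(I_k) in
  I, the quotient rho(I)/rho(I_k) becomes I/\<open>M\<close>, and membership in \<open>M\<close> is
  only ever obtained from I_k and from automorphisms that are trivial on K modulo [K, K]. Torsion of
  the abelianization suffices because, modulo the next term of the lower central series, [a^m, r] is
  the m-th power of [a, r]. The obstacle is that transvections of Aut(F_n) violate the relations of
  GL_n(Z): those at x_i and at its inverse letter are not inverse to each other but differ by a
  partial conjugation, and two with the same target commute only up to a substitution by a
  commutator. These are the elements that have to be put into T. T is normal in all of Aut(F_n), so
  bases may be changed on the way. Magnus' theorem then goes by induction on the rank. The descent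
  shows that modulo T an automorphism whose last matrix row is a unit vector is x_m -> x_m u
  composed with one of smaller rank; for an element of I, u lies in the commutator subgroup and the
  other factor is again in I.\<close>

declare mult_FactGroup [simp del] one_FactGroup [simp del]

definition gcomm :: "('a, 'b) monoid_scheme \<Rightarrow> 'a \<Rightarrow> 'a \<Rightarrow> 'a" where
  "gcomm G x y = x \<otimes>\<^bsub>G\<^esub> y \<otimes>\<^bsub>G\<^esub> inv\<^bsub>G\<^esub> x \<otimes>\<^bsub>G\<^esub> inv\<^bsub>G\<^esub> y"

context group
begin

lemma cancel_left [simp]:
  assumes "x \<in> carrier G" "z \<in> carrier G"
  shows "inv x \<otimes> (x \<otimes> z) = z" "x \<otimes> (inv x \<otimes> z) = z"
  using assms by (simp_all add: m_assoc[symmetric])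

lemma gcomm_closed [simp]:
  "x \<in> carrier G \<Longrightarrow> y \<in> carrier G \<Longrightarrow> gcomm G x y \<in> carrier G"
  by (simp add: gcomm_def)

lemma inv_gcomm: "x \<in> carrier G \<Longrightarrow> y \<in> carrier G \<Longrightarrow> inv (gcomm G x y) = gcomm G y x"
  by (simp add: gcomm_def m_assoc inv_mult_group)

text \<open>The expansion formulas keep the defect from multiplicativity as an explicit double
  commutator factor, so that it can simply be dropped modulo a deep enough term of the lower central
  series.\<close>

lemma gcomm_mult_left:
  assumes "a \<in> carrier G" "b \<in> carrier G" "r \<in> carrier G"
  shows "gcomm G (a \<otimes> b) r = gcomm G a (gcomm G b r) \<otimes> gcomm G b r \<otimes> gcomm G a r"
  using assms by (simp add: gcomm_def m_assoc inv_mult_group)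

lemma gcomm_inv_left:
  assumes "a \<in> carrier G" "r \<in> carrier G"
  shows "gcomm G (inv a) r = gcomm G (inv a) (inv (gcomm G a r)) \<otimes> inv (gcomm G a r)"
  using assms by (simp add: gcomm_def m_assoc inv_mult_group)

lemma gcomm_mult_right:
  assumes "a \<in> carrier G" "r \<in> carrier G" "s \<in> carrier G"
  shows "gcomm G a (r \<otimes> s) = gcomm G a r \<otimes> gcomm G r (gcomm G a s) \<otimes> gcomm G a s"
  using assms by (simp add: gcomm_def m_assoc inv_mult_group)

lemma gcomm_inv_right:
  assumes "a \<in> carrier G" "r \<in> carrier G"
  shows "gcomm G a (inv r) = gcomm G (inv r) (inv (gcomm G a r)) \<otimes> inv (gcomm G a r)"
  using assms by (simp add: gcomm_def m_assoc inv_mult_group)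

lemma lower_central_normal: "lower_central G i \<lhd> G"
  using characteristic_imp_normal[OF characteristic_lower_central] .

lemma lower_central_subgroup: "subgroup (lower_central G i) G"
  using lower_central_normal normal_imp_subgroup by blast

lemma lower_central_closed: "r \<in> lower_central G i \<Longrightarrow> r \<in> carrier G"
  using lower_central_subgroup subgroup.mem_carrier by metis

lemma lower_central_Suc_eq:
  "lower_central G (Suc i) = generate G {gcomm G a r | a r. a \<in> carrier G \<and> r \<in> lower_central G i}"
  unfolding lower_central.simps commutator_subgroup_def gcomm_def
  by (rule arg_cong[where f="generate G"]) blast

declare lower_central.simps(2) [simp del]

lemma gcomm_lower_central:
  "a \<in> carrier G \<Longrightarrow> r \<in> lower_central G i \<Longrightarrow> gcomm G a r \<in> lower_central G (Suc i)"
  unfolding lower_central_Suc_eq by (rule generate.incl) blast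

lemma gcomm_lower_central':
  assumes "a \<in> carrier G" "r \<in> lower_central G i"
  shows "gcomm G r a \<in> lower_central G (Suc i)"
  using gcomm_lower_central[OF assms] inv_gcomm[of a r] assms lower_central_closed
    subgroup.m_inv_closed[OF lower_central_subgroup] by metis

lemma lower_central_Suc_least:
  assumes "subgroup H G" "\<And>a r. a \<in> carrier G \<Longrightarrow> r \<in> lower_central G i \<Longrightarrow> gcomm G a r \<in> H"
  shows "lower_central G (Suc i) \<subseteq> H"
  unfolding lower_central_Suc_eq by (rule generate_subgroup_incl) (use assms in auto)

lemma lower_central_Suc_subset: "lower_central G (Suc i) \<subseteq> lower_central G i"
proof (rule lower_central_Suc_least[OF lower_central_subgroup])
  fix a r assume a: "a \<in> carrier G" and r: "r \<in> lower_central G i"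
  interpret L: normal "lower_central G i" G by (rule lower_central_normal)
  show "gcomm G a r \<in> lower_central G i"
    unfolding gcomm_def using L.inv_op_closed2[OF a r] r by simp
qed

lemma lower_central_antimono: "i \<le> j \<Longrightarrow> lower_central G j \<subseteq> lower_central G i"
  using lower_central_Suc_subset by (rule lift_Suc_antimono_le)

text \<open>The formulas for [ab, r] and [a^-1, r] deviate from multiplicativity by one double
  commutator, which is in level i+2 and hence in \<open>H\<close>. The deviation is a separate
  factor of the product, so closure of \<open>H\<close> under products and inverses is
  enough.\<close>

lemma subgroup_gcomm_left:
  assumes H: "subgroup H G" and sub: "lower_central G (Suc (Suc i)) \<subseteq> H"
    and r: "r \<in> lower_central G i"
  shows "subgroup {a \<in> carrier G. gcomm G a r \<in> H} G"
proof -
  interpret H: subgroup H G by fact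
  note rc = lower_central_closed[OF r]
  show ?thesis
  proof (rule subgroupI)
    have "gcomm G \<one> r = \<one>" using rc by (simp add: gcomm_def)
    then show "{a \<in> carrier G. gcomm G a r \<in> H} \<noteq> {}" by auto
  next
    fix a assume a: "a \<in> {a \<in> carrier G. gcomm G a r \<in> H}"
    have "inv (gcomm G a r) \<in> lower_central G (Suc i)"
      using a r by (auto intro!: subgroup.m_inv_closed[OF lower_central_subgroup] gcomm_lower_central)
    then have "gcomm G (inv a) (inv (gcomm G a r)) \<in> H"
      using a sub gcomm_lower_central[of "inv a" _ "Suc i"] by blast
    then show "inv a \<in> {a \<in> carrier G. gcomm G a r \<in> H}"
      using a gcomm_inv_left[of a r] rc by simp
  next
    fix a b assume ab: "a \<in> {a \<in> carrier G. gcomm G a r \<in> H}" "b \<in> {a \<in> carrier G. gcomm G a r \<in> H}"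
    have "gcomm G a (gcomm G b r) \<in> H"
      using ab r sub gcomm_lower_central[of a _ "Suc i"] gcomm_lower_central[of b r i] by blast
    then show "a \<otimes> b \<in> {a \<in> carrier G. gcomm G a r \<in> H}"
      using ab gcomm_mult_left[of a b r] rc by simp
  qed auto
qed

lemma subgroup_gcomm_right:
  assumes H: "subgroup H G" and sub: "lower_central G (Suc (Suc i)) \<subseteq> H"
    and a: "a \<in> carrier G"
  shows "subgroup {r \<in> lower_central G i. gcomm G a r \<in> H} G"
proof -
  interpret H: subgroup H G by fact
  interpret L: subgroup "lower_central G i" G by (rule lower_central_subgroup)
  show ?thesis
  proof (rule subgroupI)
    have "gcomm G a \<one> = \<one>" using a by (simp add: gcomm_def)
    then show "{r \<in> lower_central G i. gcomm G a r \<in> H} \<noteq> {}"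
      using L.one_closed H.one_closed by (metis (mono_tags, lifting) empty_iff mem_Collect_eq)
  next
    fix r assume r: "r \<in> {r \<in> lower_central G i. gcomm G a r \<in> H}"
    then have "inv (gcomm G a r) \<in> lower_central G (Suc i)"
      using a by (auto intro!: subgroup.m_inv_closed[OF lower_central_subgroup] gcomm_lower_central)
    then have "gcomm G (inv r) (inv (gcomm G a r)) \<in> H"
      using r sub gcomm_lower_central[of "inv r" _ "Suc i"] L.mem_carrier by blast
    then show "inv r \<in> {r \<in> lower_central G i. gcomm G a r \<in> H}"
      using r a gcomm_inv_right[of a r] by simp
  next
    fix r s assume rs: "r \<in> {r \<in> lower_central G i. gcomm G a r \<in> H}"
      "s \<in> {r \<in> lower_central G i. gcomm G a r \<in> H}"
    then have "gcomm G r (gcomm G a s) \<in> H"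
      using a sub gcomm_lower_central[of r _ "Suc i"] gcomm_lower_central[of a s i] L.mem_carrier
      by blast
    then show "r \<otimes> s \<in> {r \<in> lower_central G i. gcomm G a r \<in> H}"
      using rs a gcomm_mult_right[of a r s] by simp
  qed (auto intro: L.mem_carrier)
qed

text \<open>Modulo level i+2 the commutator is additive in each argument, so commutators of elements
  of \<open>X\<close> with generators of level i generate level i+1. The passage from generators to
  all elements is made in the right argument first, then in the left one.\<close>

lemma lower_central_fg:
  assumes fin: "finite X" and X: "X \<subseteq> carrier G" "generate G X = carrier G"
  shows "\<exists>S. finite S \<and> S \<subseteq> lower_central G i \<and>
    lower_central G i \<subseteq> generate G (S \<union> lower_central G (Suc i))"
proof (induction i)
  case 0
  have "generate G X \<subseteq> generate G (X \<union> lower_central G (Suc 0))"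
    by (rule mono_generate) auto
  then show ?case using fin X by (intro exI[of _ X]) simp
next
  case (Suc i)
  then obtain S where S: "finite S" "S \<subseteq> lower_central G i"
    "lower_central G i \<subseteq> generate G (S \<union> lower_central G (Suc i))" by blast
  define S' where "S' = (\<lambda>(x, s). gcomm G x s) ` (X \<times> S)"
  define H where "H = generate G (S' \<union> lower_central G (Suc (Suc i)))"
  have S': "finite S'" "S' \<subseteq> lower_central G (Suc i)"
    unfolding S'_def using fin S(1) X(1) S(2) gcomm_lower_central by (auto, blast)
  have "S' \<union> lower_central G (Suc (Suc i)) \<subseteq> carrier G"
    using S'(2) lower_central_closed by blast
  then have H: "subgroup H G" unfolding H_def by (rule generate_is_subgroup)
  have sub: "lower_central G (Suc (Suc i)) \<subseteq> H" and S'H: "S' \<subseteq> H"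
    unfolding H_def using generate.incl[of _ "S' \<union> lower_central G (Suc (Suc i))" G] by blast+
  have gens: "gcomm G x r \<in> H" if x: "x \<in> X" and r: "r \<in> lower_central G i" for x r
  proof -
    have xc: "x \<in> carrier G" using x X by blast
    have "generate G (S \<union> lower_central G (Suc i)) \<subseteq> {r \<in> lower_central G i. gcomm G x r \<in> H}"
    proof (rule generate_subgroup_incl[OF _ subgroup_gcomm_right[OF H sub xc]], safe)
      fix s assume "s \<in> S"
      then show "s \<in> lower_central G i" "gcomm G x s \<in> H"
        using S(2) S'H x unfolding S'_def by auto
    next
      fix s assume "s \<in> lower_central G (Suc i)"
      then show "s \<in> lower_central G i" "gcomm G x s \<in> H"
        using lower_central_Suc_subset gcomm_lower_central[OF xc, of s "Suc i"] sub by auto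
    qed
    then show ?thesis using r S(3) by blast
  qed
  have "lower_central G (Suc i) \<subseteq> H"
  proof (rule lower_central_Suc_least[OF H])
    fix a r assume a: "a \<in> carrier G" and r: "r \<in> lower_central G i"
    have "generate G X \<subseteq> {a \<in> carrier G. gcomm G a r \<in> H}"
      by (rule generate_subgroup_incl[OF _ subgroup_gcomm_left[OF H sub r]]) (use X gens r in auto)
    then show "gcomm G a r \<in> H" using a X by blast
  qed
  then show ?case using S' unfolding H_def by blast
qed

section \<open>Commutators as bilinear maps on the graded quotients\<close>

lemma coset_eq_iff:
  assumes "N \<lhd> G" "x \<in> carrier G" "y \<in> carrier G"
  shows "N #> x = N #> y \<longleftrightarrow> x \<otimes> inv y \<in> N"
proof -
  interpret N: normal N G by fact
  have "x \<in> N #> y \<longleftrightarrow> x \<otimes> inv y \<in> N"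
    using N.rcos_module[OF is_group assms(3,2)] .
  moreover have "N #> x = N #> y \<longleftrightarrow> x \<in> N #> y"
    using repr_independence[OF _ assms(3) N.is_subgroup] rcos_self[OF assms(2) N.is_subgroup] by metis
  ultimately show ?thesis by simp
qed

lemma coset_one_iff:
  assumes "N \<lhd> G" "x \<in> carrier G"
  shows "N #> x = \<one>\<^bsub>G Mod N\<^esub> \<longleftrightarrow> x \<in> N"
  using coset_eq_iff[OF assms one_closed] assms
  by (simp add: FactGroup_def normal_imp_subgroup subgroup.subset)

lemma coset_group_hom:
  assumes "N \<lhd> G"
  shows "group_hom G (G Mod N) (\<lambda>x. N #> x)"
  using assms normal.factorgroup_is_group normal.r_coset_hom_Mod
  by (auto intro!: group_hom.intro group_hom_axioms.intro is_group)

lemma coset_commute: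
  assumes "N \<lhd> G" "x \<in> carrier G" "y \<in> carrier G" "gcomm G x y \<in> N"
  shows "(N #> x) \<otimes>\<^bsub>G Mod N\<^esub> (N #> y) = (N #> y) \<otimes>\<^bsub>G Mod N\<^esub> (N #> x)"
proof -
  interpret h: group_hom G "G Mod N" "\<lambda>x. N #> x" by (rule coset_group_hom) fact
  have "N #> (x \<otimes> y) = N #> (y \<otimes> x)"
    using assms by (subst coset_eq_iff) (simp_all add: gcomm_def m_assoc inv_mult_group)
  then show ?thesis using assms by simp
qed

text \<open>Expanding [ab, r] yields the factors in the wrong order, [b, r] before [a, r]. Both lie
  in level i+1, which is central modulo level i+2, so they may be exchanged.\<close>

lemma gcomm_left_hom:
  assumes r: "r \<in> lower_central G i"
  shows "(\<lambda>a. lower_central G (Suc (Suc i)) #> gcomm G a r) \<in> hom G (G Mod lower_central G (Suc (Suc i)))"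
    (is "?f \<in> _")
proof -
  let ?N = "lower_central G (Suc (Suc i))"
  interpret h: group_hom G "G Mod ?N" "\<lambda>x. ?N #> x" by (rule coset_group_hom[OF lower_central_normal])
  have rc: "r \<in> carrier G" using r lower_central_closed by blast
  have "?f (a \<otimes> b) = ?f a \<otimes>\<^bsub>G Mod ?N\<^esub> ?f b" if ab: "a \<in> carrier G" "b \<in> carrier G" for a b
  proof -
    have b: "gcomm G b r \<in> lower_central G (Suc i)" using gcomm_lower_central ab r by blast
    have "gcomm G a (gcomm G b r) \<in> ?N" using gcomm_lower_central[OF ab(1) b] .
    then have "?N #> gcomm G a (gcomm G b r) = \<one>\<^bsub>G Mod ?N\<^esub>"
      using coset_one_iff[OF lower_central_normal] ab rc by simp
    then have "?f (a \<otimes> b) = ?f b \<otimes>\<^bsub>G Mod ?N\<^esub> ?f a"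
      using gcomm_mult_left[OF ab rc] ab rc by simp
    also have "\<dots> = ?f a \<otimes>\<^bsub>G Mod ?N\<^esub> ?f b"
      using ab rc gcomm_lower_central[OF _ b, of "gcomm G a r"]
      by (intro coset_commute[OF lower_central_normal, symmetric]) auto
    finally show ?thesis .
  qed
  then show ?thesis using rc by (auto simp: hom_def simp del: h.hom_mult)
qed

lemma gcomm_right_hom:
  assumes a: "a \<in> carrier G"
  shows "(\<lambda>r. lower_central G (Suc (Suc i)) #> gcomm G a r)
    \<in> hom (G\<lparr>carrier := lower_central G i\<rparr>) (G Mod lower_central G (Suc (Suc i)))"
    (is "?f \<in> _")
proof -
  let ?N = "lower_central G (Suc (Suc i))"
  interpret h: group_hom G "G Mod ?N" "\<lambda>x. ?N #> x" by (rule coset_group_hom[OF lower_central_normal])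
  have "?f (r \<otimes> s) = ?f r \<otimes>\<^bsub>G Mod ?N\<^esub> ?f s"
    if rs: "r \<in> lower_central G i" "s \<in> lower_central G i" for r s
  proof -
    have c: "r \<in> carrier G" "s \<in> carrier G" using rs lower_central_closed by auto
    have "gcomm G r (gcomm G a s) \<in> ?N"
      using gcomm_lower_central[OF c(1) gcomm_lower_central[OF a rs(2)]] .
    then have "?N #> gcomm G r (gcomm G a s) = \<one>\<^bsub>G Mod ?N\<^esub>"
      using coset_one_iff[OF lower_central_normal] a c by simp
    then show ?thesis
      using gcomm_mult_right[OF a c] a c by simp
  qed
  then show ?thesis using a lower_central_closed by (auto simp: hom_def)
qed

text \<open>The homomorphism sending a to the class of [a, r] has values in the central image of
  level i+1, so it kills commutators. This case of the three subgroups lemma is all that is needed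
  later.\<close>

lemma gcomm_commutator_lower_central:
  assumes a: "a \<in> lower_central G (Suc 0)" and r: "r \<in> lower_central G i"
  shows "gcomm G a r \<in> lower_central G (Suc (Suc i))"
proof -
  let ?N = "lower_central G (Suc (Suc i))"
  let ?f = "\<lambda>a. ?N #> gcomm G a r"
  interpret h: group_hom G "G Mod ?N" "\<lambda>x. ?N #> x" by (rule coset_group_hom[OF lower_central_normal])
  interpret f: group_hom G "G Mod ?N" ?f
    using gcomm_left_hom[OF r] by unfold_locales
  have rc: "r \<in> carrier G" using r lower_central_closed by blast
  have "lower_central G (Suc 0) \<subseteq> kernel G (G Mod ?N) ?f"
  proof (rule lower_central_Suc_least[OF f.subgroup_kernel])
    fix b c assume "b \<in> carrier G" "c \<in> lower_central G 0"
    then have bc: "b \<in> carrier G" "c \<in> carrier G" by auto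
    have comm: "?f b \<otimes>\<^bsub>G Mod ?N\<^esub> ?f c = ?f c \<otimes>\<^bsub>G Mod ?N\<^esub> ?f b"
      using bc rc gcomm_lower_central[OF _ gcomm_lower_central[OF bc(2) r], of "gcomm G b r"]
      by (intro coset_commute[OF lower_central_normal]) auto
    have "?f (gcomm G b c) = ?f b \<otimes>\<^bsub>G Mod ?N\<^esub> ?f c \<otimes>\<^bsub>G Mod ?N\<^esub> inv\<^bsub>G Mod ?N\<^esub> ?f b \<otimes>\<^bsub>G Mod ?N\<^esub> inv\<^bsub>G Mod ?N\<^esub> ?f c"
      unfolding gcomm_def[of G b c] using bc by (simp only: f.hom_mult f.hom_inv m_closed inv_closed)
    also have "\<dots> = \<one>\<^bsub>G Mod ?N\<^esub>"
      unfolding comm using f.hom_closed[OF bc(1)] f.hom_closed[OF bc(2)] by (simp add: h.H.m_assoc)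
    finally show "gcomm G b c \<in> kernel G (G Mod ?N) ?f"
      using bc by (simp add: kernel_def)
  qed
  then have "?f a = \<one>\<^bsub>G Mod ?N\<^esub>" using a by (auto simp: kernel_def)
  then show ?thesis
    using coset_one_iff[OF lower_central_normal, of "gcomm G a r"] a rc lower_central_closed by auto
qed

text \<open>Since x and y commute modulo \<open>N\<close>, the product of their two exponents serves
  for xy. It is applied to the graded quotients and to the abelianization of
  I/\<open>M\<close>.\<close>

lemma subgroup_torsion_mod:
  assumes N: "N \<lhd> G" and S: "subgroup S G"
    and comm: "\<And>x y. x \<in> S \<Longrightarrow> y \<in> S \<Longrightarrow> gcomm G x y \<in> N"
  shows "subgroup {x \<in> S. \<exists>m>0::nat. x [^] m \<in> N} G"
proof -
  interpret S: subgroup S G by fact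
  interpret N: normal N G by fact
  interpret h: group_hom G "G Mod N" "\<lambda>x. N #> x" by (rule coset_group_hom) fact
  show ?thesis
  proof (rule subgroupI)
    show "{x \<in> S. \<exists>m>0::nat. x [^] m \<in> N} \<subseteq> carrier G" by auto
    have "\<one> \<in> {x \<in> S. \<exists>m>0::nat. x [^] m \<in> N}" by (auto intro: exI[of _ 1])
    then show "{x \<in> S. \<exists>m>0::nat. x [^] m \<in> N} \<noteq> {}" by blast
  next
    fix x assume "x \<in> {x \<in> S. \<exists>m>0::nat. x [^] m \<in> N}"
    then obtain m :: nat where x: "x \<in> S" "m > 0" "x [^] m \<in> N" by blast
    then have "inv x [^] m \<in> N" using nat_pow_inv[of x m] by simp
    then show "inv x \<in> {x \<in> S. \<exists>m>0::nat. x [^] m \<in> N}" using x by blast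
  next
    fix x y assume "x \<in> {x \<in> S. \<exists>m>0::nat. x [^] m \<in> N}" "y \<in> {x \<in> S. \<exists>m>0::nat. x [^] m \<in> N}"
    then obtain m l :: nat where x: "x \<in> S" "m > 0" "x [^] m \<in> N"
      and y: "y \<in> S" "l > 0" "y [^] l \<in> N" by blast
    have c: "x \<in> carrier G" "y \<in> carrier G" using x y by auto
    have 1: "(N #> x) [^]\<^bsub>G Mod N\<^esub> m = \<one>\<^bsub>G Mod N\<^esub>" "(N #> y) [^]\<^bsub>G Mod N\<^esub> l = \<one>\<^bsub>G Mod N\<^esub>"
      using x y c coset_one_iff[OF N] by (simp_all add: h.hom_nat_pow[symmetric])
    have "N #> (x \<otimes> y) [^] (m * l) = (N #> x) [^]\<^bsub>G Mod N\<^esub> (m * l) \<otimes>\<^bsub>G Mod N\<^esub> (N #> y) [^]\<^bsub>G Mod N\<^esub> (l * m)"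
      using h.H.pow_mult_distrib[OF coset_commute[OF N c comm[OF x(1) y(1)]], of "m * l"] c
      by (simp add: h.hom_nat_pow mult.commute)
    also have "\<dots> = \<one>\<^bsub>G Mod N\<^esub>"
      using c 1 by (simp add: h.H.nat_pow_pow[symmetric])
    finally have "(x \<otimes> y) [^] (m * l) \<in> N" using coset_one_iff[OF N] c by simp
    then show "x \<otimes> y \<in> {x \<in> S. \<exists>m>0::nat. x [^] m \<in> N}"
      using x y by (auto intro!: exI[of _ "m * l"])
  qed
qed

text \<open>Bilinearity turns \<open>tors\<close> into [a, r]^(ml) in level i+2, and torsion
  elements of an abelian quotient form a subgroup, so the generators [a, r] decide. There are two
  applications: to the image of a smaller free group modulo [K, K], with m and l the order of F/K,
  and to I/\<open>M\<close>, with l = 1.\<close>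

lemma lower_central_torsion_step:
  assumes tors: "\<And>a r. a \<in> carrier G \<Longrightarrow> r \<in> lower_central G i \<Longrightarrow>
      \<exists>m>0::nat. \<exists>l>0::nat. gcomm G (a [^] m) (r [^] l) \<in> lower_central G (Suc (Suc i))"
    and z: "z \<in> lower_central G (Suc i)"
  shows "\<exists>m>0::nat. z [^] m \<in> lower_central G (Suc (Suc i))"
proof -
  let ?N = "lower_central G (Suc (Suc i))"
  interpret h: group_hom G "G Mod ?N" "\<lambda>x. ?N #> x" by (rule coset_group_hom[OF lower_central_normal])
  have "subgroup {x \<in> lower_central G (Suc i). \<exists>m>0::nat. x [^] m \<in> ?N} G"
    using gcomm_lower_central lower_central_closed
    by (intro subgroup_torsion_mod lower_central_normal lower_central_subgroup) blast
  then have "lower_central G (Suc i) \<subseteq> {x \<in> lower_central G (Suc i). \<exists>m>0::nat. x [^] m \<in> ?N}"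
  proof (rule lower_central_Suc_least)
    fix a r assume a: "a \<in> carrier G" and r: "r \<in> lower_central G i"
    have rc: "r \<in> carrier G" using r lower_central_closed by blast
    obtain m l :: nat where ml: "m > 0" "l > 0" "gcomm G (a [^] m) (r [^] l) \<in> ?N"
      using tors[OF a r] by blast
    interpret L: subgroup "lower_central G i" G by (rule lower_central_subgroup)
    interpret L': group "G\<lparr>carrier := lower_central G i\<rparr>"
      by (rule L.subgroup_is_group[OF is_group])
    interpret f: group_hom G "G Mod ?N" "\<lambda>a. ?N #> gcomm G a r"
      using gcomm_left_hom[OF r] by unfold_locales
    interpret g: group_hom "G\<lparr>carrier := lower_central G i\<rparr>" "G Mod ?N" "\<lambda>r. ?N #> gcomm G (a [^] m) r"
      using gcomm_right_hom[of "a [^] m" i] a by unfold_locales auto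
    have "?N #> gcomm G (a [^] m) (r [^] l) = (?N #> gcomm G (a [^] m) r) [^]\<^bsub>G Mod ?N\<^esub> l"
      using g.hom_nat_pow[of r l] r by (simp add: nat_pow_consistent[symmetric])
    also have "\<dots> = (?N #> gcomm G a r) [^]\<^bsub>G Mod ?N\<^esub> (m * l)"
      using f.hom_nat_pow[OF a, of m] f.hom_closed[OF a] by (simp add: h.H.nat_pow_pow)
    also have "\<dots> = ?N #> gcomm G a r [^] (m * l)"
      using a rc by (simp add: h.hom_nat_pow)
    finally have "gcomm G a r [^] (m * l) \<in> ?N"
      using ml(3) a rc coset_one_iff[OF lower_central_normal]
      by (metis gcomm_closed nat_pow_closed lower_central_closed r)
    then show "gcomm G a r \<in> {x \<in> lower_central G (Suc i). \<exists>m>0::nat. x [^] m \<in> ?N}"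
      using gcomm_lower_central[OF a r] ml by (auto intro!: exI[of _ "m * l"])
  qed
  then show ?thesis using z by blast
qed

end

lemma (in group_hom) hom_gcomm:
  "x \<in> carrier G \<Longrightarrow> y \<in> carrier G \<Longrightarrow> h (gcomm G x y) = gcomm H (h x) (h y)"
  by (simp add: gcomm_def)

lemma (in group_hom) lower_central_image_subset:
  "h ` lower_central G i \<subseteq> lower_central H i"
proof (induction i)
  case (Suc i)
  have sub: "{gcomm G a r |a r. a \<in> carrier G \<and> r \<in> lower_central G i} \<subseteq> carrier G"
    using G.lower_central_closed by auto
  have "h ` {gcomm G a r |a r. a \<in> carrier G \<and> r \<in> lower_central G i}
      \<subseteq> {gcomm H a r |a r. a \<in> carrier H \<and> r \<in> lower_central H i}"
  proof safe
    fix a r assume ar: "a \<in> carrier G" "r \<in> lower_central G i"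
    then have "h r \<in> lower_central H i" "r \<in> carrier G" using Suc G.lower_central_closed by auto
    then show "\<exists>b s. h (gcomm G a r) = gcomm H b s \<and> b \<in> carrier H \<and> s \<in> lower_central H i"
      using ar(1) hom_gcomm hom_closed by blast
  qed
  then show ?case
    unfolding G.lower_central_Suc_eq H.lower_central_Suc_eq generate_img[OF sub, symmetric]
    by (rule H.mono_generate)
qed auto

lemma (in group_hom) lower_central_image:
  assumes surj: "h ` carrier G = carrier H"
  shows "h ` lower_central G i = lower_central H i"
proof (induction i)
  case 0
  then show ?case using surj by simp
next
  case (Suc i)
  have "lower_central H (Suc i) \<subseteq> h ` lower_central G (Suc i)"
  proof (rule H.lower_central_Suc_least)
    show "subgroup (h ` lower_central G (Suc i)) H"
      using G.lower_central_subgroup by (rule subgroup_img_is_subgroup)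
    fix a r assume "a \<in> carrier H" "r \<in> lower_central H i"
    then obtain b s where bs: "b \<in> carrier G" "a = h b" "s \<in> lower_central G i" "r = h s"
      using surj Suc by blast
    then have "gcomm H a r = h (gcomm G b s)" using hom_gcomm G.lower_central_closed by auto
    then show "gcomm H a r \<in> h ` lower_central G (Suc i)"
      using G.gcomm_lower_central[OF bs(1,3)] by blast
  qed
  then show ?case using lower_central_image_subset by blast
qed

section \<open>Finite index from torsion in finitely generated abelian groups\<close>

lemma (in comm_group) generate_insert:
  assumes S: "S \<subseteq> carrier G" and s: "s \<in> carrier G" and c: "c \<in> generate G (insert s S)"
  shows "\<exists>a::int. \<exists>y\<in>generate G S. c = s [^] a \<otimes> y"
proof -
  interpret S: subgroup "generate G S" G using generate_is_subgroup[OF S] .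
  have "subgroup {s [^] a \<otimes> y |(a::int) y. y \<in> generate G S} G"
  proof (rule subgroupI)
    show "{s [^] a \<otimes> y |(a::int) y. y \<in> generate G S} \<subseteq> carrier G" using s by auto
    show "{s [^] a \<otimes> y |(a::int) y. y \<in> generate G S} \<noteq> {}" using S.one_closed by blast
  next
    fix x assume "x \<in> {s [^] a \<otimes> y |(a::int) y. y \<in> generate G S}"
    then obtain a :: int and y where x: "x = s [^] a \<otimes> y" "y \<in> generate G S" by blast
    then have "inv x = s [^] (- a) \<otimes> inv y"
      using s by (simp add: inv_mult int_pow_neg)
    then show "inv x \<in> {s [^] a \<otimes> y |(a::int) y. y \<in> generate G S}" using x by blast
  next
    fix x x' assume "x \<in> {s [^] a \<otimes> y |(a::int) y. y \<in> generate G S}"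
      "x' \<in> {s [^] a \<otimes> y |(a::int) y. y \<in> generate G S}"
    then obtain a a' :: int and y y' where x: "x = s [^] a \<otimes> y" "y \<in> generate G S"
      "x' = s [^] a' \<otimes> y'" "y' \<in> generate G S" by blast
    have "x \<otimes> x' = s [^] (a + a') \<otimes> (y \<otimes> y')"
      using x s by (simp add: int_pow_mult m_ac)
    then show "x \<otimes> x' \<in> {s [^] a \<otimes> y |(a::int) y. y \<in> generate G S}" using x by blast
  qed
  then have "generate G (insert s S) \<subseteq> {s [^] a \<otimes> y |(a::int) y. y \<in> generate G S}"
  proof (rule generate_subgroup_incl[rotated], safe)
    show "\<exists>(a::int) y. s = s [^] a \<otimes> y \<and> y \<in> generate G S"
      using s S.one_closed by (intro exI[of _ 1] exI[of _ \<one>]) (simp add: int_pow_1)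
  next
    fix x assume "x \<in> S"
    then show "\<exists>(a::int) y. x = s [^] a \<otimes> y \<and> y \<in> generate G S"
      using S generate.incl[of x S G] by (intro exI[of _ 0] exI[of _ x]) auto
  qed
  then show ?thesis using c by blast
qed

text \<open>This is the finiteness of finitely generated torsion abelian groups, with
  \<open>C\<close> merely contained in a finitely generated group; finite generation of subgroups is
  absorbed into the induction. Removing a generator s leaves the intersection of \<open>C\<close>
  with the span of the others, and over it \<open>C\<close> needs at most one further generator
  \<open>c1\<close>.\<close>

lemma (in comm_group) finite_cosets_torsion:
  assumes "finite S" "S \<subseteq> carrier G" "subgroup C G" "C \<subseteq> generate G S" "subgroup D G" "D \<subseteq> C"
    "\<And>c. c \<in> C \<Longrightarrow> \<exists>m>0::nat. c [^] m \<in> D"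
  shows "\<exists>R. finite R \<and> R \<subseteq> C \<and> (\<forall>c\<in>C. \<exists>d\<in>D. \<exists>r\<in>R. c = d \<otimes> r)"
  using assms
proof (induction S arbitrary: C D rule: finite_induct)
  case empty
  then have "C \<subseteq> {\<one>}" using generate_empty by blast
  then have "\<forall>c\<in>C. \<exists>d\<in>D. \<exists>r\<in>{\<one>}. c = d \<otimes> r"
    using subgroup.one_closed[OF empty(4)] by (auto intro!: bexI[of _ \<one>])
  moreover have "{\<one>} \<subseteq> C" using subgroup.one_closed[OF empty(2)] by simp
  ultimately show ?case by (intro exI[of _ "{\<one>}"]) simp
next
  case (insert s S)
  interpret C: subgroup C G by fact
  interpret D: subgroup D G by fact
  have s: "s \<in> carrier G" and S: "S \<subseteq> carrier G" using insert.prems(1) by auto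
  interpret S: subgroup "generate G S" G using generate_is_subgroup[OF S] .
  have C0: "subgroup (C \<inter> generate G S) G" and D0: "subgroup (D \<inter> generate G S) G"
    using subgroups_Inter_pair C.subgroup_axioms D.subgroup_axioms S.subgroup_axioms by blast+
  have tors0: "\<exists>m>0::nat. c [^] m \<in> D \<inter> generate G S" if c: "c \<in> C \<inter> generate G S" for c
  proof -
    obtain m :: nat where "m > 0" "c [^] m \<in> D" using insert.prems(6)[of c] c by blast
    moreover have "c [^] m \<in> generate G S" using c by (induction m) auto
    ultimately show ?thesis by blast
  qed
  obtain R where R: "finite R" "R \<subseteq> C \<inter> generate G S"
    "\<And>c. c \<in> C \<inter> generate G S \<Longrightarrow> \<exists>d\<in>D \<inter> generate G S. \<exists>r\<in>R. c = d \<otimes> r"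
    using insert.IH[OF S C0 _ D0 _ tors0] insert.prems(5) by (metis Int_lower2 Int_mono subset_refl)
  \<comment> \<open>The exponents of s occurring in \<open>C\<close> form a subgroup of the
    integers; k below is its positive generator, if it is not zero.\<close>
  define P where "P a \<longleftrightarrow> (\<exists>y\<in>generate G S. s [^] (a::int) \<otimes> y \<in> C)" for a
  have dec: "\<exists>a::int. P a \<and> (\<exists>y\<in>generate G S. c = s [^] a \<otimes> y)" if "c \<in> C" for c
    using generate_insert[OF S s, of c] insert.prems(3) that unfolding P_def by blast
  show ?case
  proof (cases "\<exists>a>0. P a")
    case False
    have "C \<subseteq> generate G S"
    proof
      fix c assume c: "c \<in> C"
      then obtain a y where a: "P a" and y: "y \<in> generate G S" "c = s [^] a \<otimes> y" using dec by blast
      have "inv c = s [^] (- a) \<otimes> inv y" using y s by (simp add: inv_mult int_pow_neg)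
      then have "P (- a)" unfolding P_def using y(1) c by (metis C.m_inv_closed S.m_inv_closed)
      then have "a = 0" using a False by (metis linorder_neqE_linordered_idom neg_0_less_iff_less)
      then show "c \<in> generate G S" using y s by simp
    qed
    then have "C \<inter> generate G S = C" by blast
    then show ?thesis using R by (intro exI[of _ R]) blast
  next
    case True
    define k where "k = (LEAST k. k > 0 \<and> P (int k))"
    have ex: "\<exists>k. k > 0 \<and> P (int k)" using True by (metis pos_int_cases of_nat_0_less_iff)
    have k: "k > 0" "P (int k)" using LeastI_ex[OF ex] unfolding k_def by auto
    have least: "j = 0" if "j < k" "P (int j)" for j
      using not_less_Least[of j "\<lambda>k. k > 0 \<and> P (int k)"] that unfolding k_def by auto
    obtain y1 where y1: "y1 \<in> generate G S" "s [^] int k \<otimes> y1 \<in> C" using k unfolding P_def by blast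
    define c1 where "c1 = s [^] int k \<otimes> y1"
    have c1: "c1 \<in> C" "c1 \<in> carrier G" using y1 unfolding c1_def by auto
    obtain m :: nat where m: "m > 0" "c1 [^] m \<in> D" using insert.prems(6)[OF c1(1)] by blast
    have powC: "c1 [^] (i::int) \<in> C" for i using subgroup_int_pow_closed[OF C.subgroup_axioms c1(1)] .
    have powS: "y1 [^] (i::int) \<in> generate G S" for i
      using subgroup_int_pow_closed[OF S.subgroup_axioms y1(1)] .
    \<comment> \<open>Some power c1^m is in \<open>D\<close>, so only the powers of
      \<open>c1\<close> below m are needed on top of the representatives \<open>R\<close> of the
      smaller case.\<close>
    define R' where "R' = (\<lambda>(r, i). r \<otimes> c1 [^] int i) ` (R \<times> {..<m})"
    have "\<exists>d\<in>D. \<exists>r\<in>R'. c = d \<otimes> r" if c: "c \<in> C" for c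
    proof -
      obtain a y where a: "P a" and y: "y \<in> generate G S" "c = s [^] a \<otimes> y" using dec[OF c] by blast
      define q where "q = a div int k"
      have cc: "c \<in> carrier G" "y \<in> carrier G" "y1 \<in> carrier G" using c y y1 by auto
      have "c \<otimes> c1 [^] (- q) = s [^] (a mod int k) \<otimes> (y \<otimes> y1 [^] (- q))"
      proof -
        have "c1 [^] (- q) = s [^] (int k * (- q)) \<otimes> y1 [^] (- q)"
          unfolding c1_def using s cc by (simp add: int_pow_distrib int_pow_pow)
        moreover have "s [^] a \<otimes> s [^] (int k * (- q)) = s [^] (a mod int k)"
        proof -
          have "s [^] a \<otimes> s [^] (int k * (- q)) = s [^] (a + int k * (- q))"
            by (rule int_pow_mult[OF s, symmetric])
          also have "a + int k * (- q) = a mod int k"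
            unfolding q_def by (simp add: minus_mult_div_eq_mod)
          finally show ?thesis .
        qed
        ultimately show ?thesis using s cc y(2)
          by (simp add: m_ac)
      qed
      moreover have mem: "c \<otimes> c1 [^] (- q) \<in> C" using c powC by blast
      moreover have yS: "y \<otimes> y1 [^] (- q) \<in> generate G S" using y powS by blast
      ultimately have "P (a mod int k)" unfolding P_def by metis
      then have "P (int (nat (a mod int k)))" using k by simp
      moreover have "nat (a mod int k) < k" using k by (simp add: nat_less_iff)
      ultimately have "nat (a mod int k) = 0" using least by blast
      then have "a mod int k = 0" using k by (metis nat_0_iff of_nat_0_less_iff pos_mod_sign order_antisym)
      then have "c \<otimes> c1 [^] (- q) \<in> C \<inter> generate G S"
        using \<open>c \<otimes> c1 [^] (- q) = _\<close> mem yS s cc by simp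
      then obtain d r where dr: "d \<in> D" "r \<in> R" "c \<otimes> c1 [^] (- q) = d \<otimes> r" using R(3) by blast
      have drc: "d \<in> carrier G" "r \<in> carrier G" using dr R(2) by auto
      define i where "i = nat (q mod int m)"
      have i: "i < m" "int i = q mod int m" unfolding i_def using m by (simp_all add: nat_less_iff)
      have "c = (c \<otimes> c1 [^] (- q)) \<otimes> c1 [^] q"
        using cc c1 by (simp add: m_assoc int_pow_mult[symmetric] int_pow_neg)
      also have "c1 [^] q = (c1 [^] m) [^] (q div int m) \<otimes> c1 [^] int i"
      proof -
        have "(c1 [^] m) [^] (q div int m) \<otimes> c1 [^] int i = c1 [^] (int m * (q div int m) + int i)"
          using c1 by (simp add: int_pow_mult int_pow_pow int_pow_int[symmetric] del: int_pow_int)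
        then show ?thesis using i by simp
      qed
      finally have "c = (d \<otimes> (c1 [^] m) [^] (q div int m)) \<otimes> (r \<otimes> c1 [^] int i)"
        using dr drc c1 m by (simp add: m_ac del: int_pow_int)
      moreover have "d \<otimes> (c1 [^] m) [^] (q div int m) \<in> D"
        using dr subgroup_int_pow_closed[OF D.subgroup_axioms m(2)] by blast
      moreover have "r \<otimes> c1 [^] int i \<in> R'" using dr i unfolding R'_def by (auto intro!: rev_image_eqI[of "(r, i)"])
      ultimately show ?thesis by blast
    qed
    moreover have "finite R'" "R' \<subseteq> C" unfolding R'_def using R(1,2) powC by auto
    ultimately show ?thesis by blast
  qed
qed

text \<open>One stage of a filtration with abelian quotients, whose next stage is the kernel of f.
  Representatives for f(M \<inter> H) in f(H) are lifted to \<open>H\<close>, and z in the kernel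
  takes up the ambiguity of the lifts.\<close>

lemma (in group) finite_cosets_torsion_hom:
  assumes H: "subgroup H G" and M: "subgroup M G" and B: "comm_group B"
    and f: "f \<in> hom (G\<lparr>carrier := H\<rparr>) B"
    and S: "finite S" "S \<subseteq> carrier B" "f ` H \<subseteq> generate B S"
    and tors: "\<And>h. h \<in> H \<Longrightarrow> \<exists>m>0::nat. h [^] m \<in> M"
  shows "\<exists>R. finite R \<and> R \<subseteq> H \<and>
    (\<forall>h\<in>H. \<exists>\<mu>\<in>M \<inter> H. \<exists>z\<in>H. \<exists>r\<in>R. f z = \<one>\<^bsub>B\<^esub> \<and> h = \<mu> \<otimes> z \<otimes> r)"
proof -
  interpret H: subgroup H G by fact
  interpret M: subgroup M G by fact
  interpret B: comm_group B by fact
  interpret H': group "G\<lparr>carrier := H\<rparr>" by (rule H.subgroup_is_group[OF is_group])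
  interpret f: group_hom "G\<lparr>carrier := H\<rparr>" B f using f by unfold_locales
  have C: "subgroup (f ` H) B" using f.subgroup_img_is_subgroup[OF H'.subgroup_self] by simp
  have "subgroup (M \<inter> H) G" by (rule subgroups_Inter_pair[OF M H])
  then have "subgroup (M \<inter> H) (G\<lparr>carrier := H\<rparr>)"
    by (rule subgroup_incl) (use H in auto)
  then have D: "subgroup (f ` (M \<inter> H)) B" by (rule f.subgroup_img_is_subgroup)
  have "\<exists>m>0::nat. c [^]\<^bsub>B\<^esub> m \<in> f ` (M \<inter> H)" if c: "c \<in> f ` H" for c
  proof -
    obtain h where h: "h \<in> H" "c = f h" using c by blast
    obtain m :: nat where m: "m > 0" "h [^] m \<in> M" using tors[OF h(1)] by blast
    have "h [^] m \<in> H" using h(1) by (induction m) auto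
    moreover have "f (h [^] m) = c [^]\<^bsub>B\<^esub> m"
      using f.hom_nat_pow[of h m] h by (simp add: nat_pow_consistent[symmetric])
    ultimately show ?thesis using m by (metis IntI image_eqI)
  qed
  then have "\<exists>R. finite R \<and> R \<subseteq> f ` H \<and> (\<forall>c\<in>f ` H. \<exists>d\<in>f ` (M \<inter> H). \<exists>r\<in>R. c = d \<otimes>\<^bsub>B\<^esub> r)"
    by (intro B.finite_cosets_torsion[OF S(1,2) C S(3) D] image_mono) auto
  then obtain R where R: "finite R" "R \<subseteq> f ` H"
    "\<And>c. c \<in> f ` H \<Longrightarrow> \<exists>d\<in>f ` (M \<inter> H). \<exists>r\<in>R. c = d \<otimes>\<^bsub>B\<^esub> r"
    by (elim exE conjE) (rule that, auto)
  obtain R' where R': "R' \<subseteq> H" "finite R'" "R = f ` R'" using finite_subset_image[OF R(1,2)] by blast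
  have "\<exists>\<mu>\<in>M \<inter> H. \<exists>z\<in>H. \<exists>r\<in>R'. f z = \<one>\<^bsub>B\<^esub> \<and> h = \<mu> \<otimes> z \<otimes> r" if h: "h \<in> H" for h
  proof -
    obtain \<mu> r where \<mu>: "\<mu> \<in> M" "\<mu> \<in> H" "r \<in> R'" "f h = f \<mu> \<otimes>\<^bsub>B\<^esub> f r"
    proof -
      obtain d r where dr: "d \<in> f ` (M \<inter> H)" "r \<in> R" "f h = d \<otimes>\<^bsub>B\<^esub> r"
        using R(3)[OF imageI[OF h]] by blast
      obtain \<mu> where \<mu>: "\<mu> \<in> M" "\<mu> \<in> H" "d = f \<mu>" using dr(1) by (elim imageE IntE)
      obtain r' where "r' \<in> R'" "r = f r'" using dr(2) R'(3) by blast
      then show thesis using that[OF \<mu>(1,2)] \<mu>(3) dr(3) by simp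
    qed
    have r: "r \<in> H" using \<mu> R' by blast
    define z where "z = inv \<mu> \<otimes> h \<otimes> inv r"
    have z: "z \<in> H" unfolding z_def using h \<mu> r by auto
    have eq: "h = \<mu> \<otimes> z \<otimes> r" unfolding z_def using h \<mu> r by (simp add: m_assoc)
    then have "f h = f \<mu> \<otimes>\<^bsub>B\<^esub> f z \<otimes>\<^bsub>B\<^esub> f r"
      using f.hom_mult z \<mu> r by simp
    moreover have "f \<mu> \<in> carrier B" "f z \<in> carrier B" "f r \<in> carrier B"
      using z \<mu> r f.hom_closed by auto
    ultimately have "f z = \<one>\<^bsub>B\<^esub>"
      using \<mu>(4) by (simp add: B.m_assoc)
    then show ?thesis using eq z \<mu> by blast
  qed
  then show ?thesis using R' by blast
qed

section \<open>Automorphisms of free groups\<close>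

abbreviation inv_word :: "'a word \<Rightarrow> 'a word" where
  "inv_word w \<equiv> rev (map inv_letter w)"

lemma snd_inv_letter [simp]: "snd (inv_letter l) = snd l"
  by (simp add: inv_letter_def)

lemma inv_letter_neq [simp]: "inv_letter l \<noteq> l" "l \<noteq> inv_letter l"
  by (cases l; simp add: inv_letter_def)+

lemma inv_letter_eq_iff [simp]: "inv_letter l = inv_letter m \<longleftrightarrow> l = m"
  by (metis inv_letter_inv_letter)

lemma snd_letter_eq: "snd a = snd b \<Longrightarrow> a = b \<or> a = inv_letter b"
  by (cases a; cases b) (auto simp: inv_letter_def)

lemma inv_word_inv_word [simp]: "inv_word (inv_word w) = w"
  by (simp add: rev_map comp_def)

lemma carrier_free_group: "w \<in> carrier (free_group X) \<longleftrightarrow> reduced w \<and> snd ` set w \<subseteq> X"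
  by (auto simp: free_group_def subset_iff mem_Times_iff)

lemma mult_free_group: "u \<otimes>\<^bsub>free_group X\<^esub> v = foldr cancel_cons u v"
  by (simp add: free_group_def)

lemma one_free_group: "\<one>\<^bsub>free_group X\<^esub> = []"
  by (simp add: free_group_def)

lemma free_group_carrier_mono: "Y \<subseteq> X \<Longrightarrow> carrier (free_group Y) \<subseteq> carrier (free_group X)"
  unfolding subset_iff carrier_free_group by blast

lemma free_group_eq: "free_group Y = (free_group X)\<lparr>carrier := carrier (free_group Y)\<rparr>"
  by (simp add: free_group_def)

lemma subgroup_free_group: "Y \<subseteq> X \<Longrightarrow> subgroup (carrier (free_group Y)) (free_group X)"
  using free_group_eq[of Y X] group_free_group free_group_carrier_mono
    group.group_incl_imp_subgroup[of "free_group X" "carrier (free_group Y)"] by metis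

lemma letter_carrier [simp]: "[l] \<in> carrier (free_group X) \<longleftrightarrow> snd l \<in> X"
  by (auto simp: carrier_free_group reduced_def)

lemma inv_free_group:
  assumes "w \<in> carrier (free_group X)"
  shows "inv\<^bsub>free_group X\<^esub> w = inv_word w"
proof -
  interpret group "free_group X" by (rule group_free_group)
  have "inv_word w \<in> carrier (free_group X)"
    using assms reduced_inverse by (auto simp: carrier_free_group)
  moreover have "inv_word w \<otimes>\<^bsub>free_group X\<^esub> w = \<one>\<^bsub>free_group X\<^esub>"
    by (simp add: mult_free_group one_free_group mult_inverse)
  ultimately show ?thesis using assms by (intro inv_equality)
qed

lemma inv_letter_word: "snd l \<in> X \<Longrightarrow> [inv_letter l] = inv\<^bsub>free_group X\<^esub> [l]"
  by (simp add: inv_free_group)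

lemma reduced_append:
  "reduced (u @ v) \<longleftrightarrow> reduced u \<and> reduced v \<and> (u = [] \<or> v = [] \<or> hd v \<noteq> inv_letter (last u))"
  by (auto simp: reduced_def successively_append_iff)

lemma mult_reduced_append: "reduced (u @ v) \<Longrightarrow> foldr cancel_cons u v = u @ v"
proof (induction u)
  case (Cons l u)
  then show ?case using reduced_tl[of l "u @ v"] reduced_Cons[of l "u @ v"] by simp
qed simp

lemma Cons_mult:
  "reduced (l # w) \<Longrightarrow> l # w = [l] \<otimes>\<^bsub>free_group X\<^esub> w"
  using mult_reduced_append[of "[l]" w] by (simp add: mult_free_group)

lemma free_group_induct [consumes 1, case_names one Cons]:
  assumes "w \<in> carrier (free_group X)"
    and "P \<one>\<^bsub>free_group X\<^esub>"
    and "\<And>l w. snd l \<in> X \<Longrightarrow> w \<in> carrier (free_group X) \<Longrightarrow> P w \<Longrightarrow> P ([l] \<otimes>\<^bsub>free_group X\<^esub> w)"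
  shows "P w"
  using assms(1)
proof (induction w)
  case Nil
  then show ?case using assms(2) by (simp add: one_free_group)
next
  case (Cons l w)
  then have "snd l \<in> X" "w \<in> carrier (free_group X)" "reduced (l # w)"
    using reduced_tl[of l w] by (auto simp: carrier_free_group)
  then show ?case using assms(3) Cons Cons_mult by metis
qed

lemma group_hom_free_group:
  "group G \<Longrightarrow> \<phi> \<in> hom (free_group X) G \<Longrightarrow> group_hom (free_group X) G \<phi>"
  by (simp add: group_hom.intro group_hom_axioms.intro group_free_group)

lemma free_group_hom_letter_cases:
  assumes G: "group G" and \<phi>: "\<phi> \<in> hom (free_group X) G" and \<psi>: "\<psi> \<in> hom (free_group X) G"
    and l: "snd l \<in> X" "\<phi> [l] = \<psi> [l]" and k: "snd k = snd l"
  shows "\<phi> [k] = \<psi> [k]"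
proof -
  interpret \<phi>: group_hom "free_group X" G \<phi> using group_hom_free_group[OF G \<phi>] .
  interpret \<psi>: group_hom "free_group X" G \<psi> using group_hom_free_group[OF G \<psi>] .
  show ?thesis using snd_letter_eq[OF k] l by (auto simp: inv_letter_word)
qed

text \<open>The existential leaves the sign of the letter to the application: a transvection is
  easiest to evaluate at the very letter that it changes, which may be an inverse generator.\<close>

lemma free_group_hom_eqI:
  assumes G: "group G" and \<phi>: "\<phi> \<in> hom (free_group X) G" and \<psi>: "\<psi> \<in> hom (free_group X) G"
    and eq: "\<And>i. i \<in> X \<Longrightarrow> \<exists>l. snd l = i \<and> \<phi> [l] = \<psi> [l]"
    and w: "w \<in> carrier (free_group X)"
  shows "\<phi> w = \<psi> w"
proof -
  interpret \<phi>: group_hom "free_group X" G \<phi> using group_hom_free_group[OF G \<phi>] .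
  interpret \<psi>: group_hom "free_group X" G \<psi> using group_hom_free_group[OF G \<psi>] .
  show ?thesis
    using w
  proof (induction rule: free_group_induct)
    case (Cons l w)
    have "\<phi> [l] = \<psi> [l]"
      using eq[OF Cons(1)] free_group_hom_letter_cases[OF G \<phi> \<psi>] Cons(1) by metis
    then show ?case using Cons by simp
  qed simp
qed

text \<open>The letters of u are multiplied on from its right end. Cancellation can continue only
  while no letter of u has been kept; once \<open>a\<close> is nonempty, reducedness of u stops
  it.\<close>

lemma cancel_decomp:
  assumes "reduced u" "reduced v"
  shows "\<exists>a c b. u = a @ c \<and> v = inv_word c @ b \<and> foldr cancel_cons u v = a @ b"
  using assms(1)
proof (induction u)
  case Nil
  then show ?case by simp
next
  case (Cons l u)
  obtain a c b where acb: "u = a @ c" "v = inv_word c @ b" "foldr cancel_cons u v = a @ b"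
    using Cons reduced_tl by blast
  show ?case
  proof (cases a)
    case Nil
    show ?thesis
    proof (cases "b \<noteq> [] \<and> hd b = inv_letter l")
      case True
      then obtain b' where "b = inv_letter l # b'" by (cases b) auto
      then show ?thesis using acb Nil by (intro exI[of _ "[]"] exI[of _ "l # c"] exI[of _ b']) simp
    next
      case False
      then have "cancel_cons l b = l # b" by (cases b) auto
      then show ?thesis using acb Nil by (intro exI[of _ "[l]"] exI[of _ c] exI[of _ b]) simp
    qed
  next
    case (Cons m a')
    then have "m \<noteq> inv_letter l" using \<open>reduced (l # u)\<close> acb by (auto simp: reduced_def)
    then show ?thesis using acb Cons by (intro exI[of _ "l # a"] exI[of _ c] exI[of _ b]) simp
  qed
qed

text \<open>If half of u cancelled against u, mirror positions would carry mutually inverse letters.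
  In the middle of the word this makes a letter its own inverse (odd length) or two neighbours
  inverse to each other (even length).\<close>

lemma self_cancel:
  assumes u: "reduced u" "u \<noteq> []" "u = a @ c" "u = inv_word c @ b"
  shows "2 * length c < length u"
proof (rule ccontr)
  assume "\<not> 2 * length c < length u"
  then have len: "length u \<le> 2 * length c" by simp
  have nth: "u ! i = inv_letter (u ! (length u - 1 - i))" if i: "i < length c" for i
  proof -
    have "u ! i = inv_letter (c ! (length c - 1 - i))"
      using u(4) i by (simp add: nth_append rev_nth)
    moreover have "u ! (length u - 1 - i) = c ! (length c - 1 - i)"
    proof -
      have "length u - 1 - i = length a + (length c - 1 - i)" using u(3) i by simp
      then show ?thesis using u(3) by (simp only: nth_append_length_plus)
    qed
    ultimately show ?thesis by simp
  qed
  show False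
  proof (cases "odd (length u)")
    case True
    then obtain k where k: "length u = 2 * k + 1" by (auto elim: oddE)
    then have "u ! k = inv_letter (u ! k)" using nth[of k] len by simp
    then show False by simp
  next
    case False
    then obtain k where "length u = 2 * k" by (auto elim: evenE)
    with u(2) obtain j where j: "length u = 2 * Suc j" by (cases k) auto
    then have "u ! j = inv_letter (u ! Suc j)" using nth[of j] len by simp
    moreover have "u ! Suc j \<noteq> inv_letter (u ! j)"
      using u(1) j unfolding reduced_def by (auto simp: successively_conv_nth)
    ultimately show False by simp
  qed
qed

locale free_group_aut =
  fixes n :: nat
begin

abbreviation F :: "nat word monoid" where "F \<equiv> free_group_rank n"
abbreviation A :: "(nat word \<Rightarrow> nat word) monoid" where "A \<equiv> AutoGroup F"
abbreviation gen :: "nat \<Rightarrow> nat word" where "gen i \<equiv> [(True, i)]"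
abbreviation Fix :: "nat \<Rightarrow> nat word set" where "Fix i \<equiv> carrier (free_group ({..<n} - {i}))"

sublocale F: group F by (rule group_free_group)
sublocale A: group A by (rule F.AutoGroup)

lemma auto_hom: "\<phi> \<in> auto F \<Longrightarrow> \<phi> \<in> hom F F"
  using autoD by blast

lemma auto_group_hom: "\<phi> \<in> auto F \<Longrightarrow> group_hom F F \<phi>"
  using auto_hom group_hom_free_group F.is_group by blast

lemma auto_apply_closed: "\<phi> \<in> auto F \<Longrightarrow> w \<in> carrier F \<Longrightarrow> \<phi> w \<in> carrier F"
  by (rule group_hom.hom_closed[OF auto_group_hom])

lemma auto_mult: "\<phi> \<in> auto F \<Longrightarrow> u \<in> carrier F \<Longrightarrow> v \<in> carrier F \<Longrightarrow> \<phi> (u \<otimes>\<^bsub>F\<^esub> v) = \<phi> u \<otimes>\<^bsub>F\<^esub> \<phi> v"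
  by (rule group_hom.hom_mult[OF auto_group_hom])

lemma auto_inv: "\<phi> \<in> auto F \<Longrightarrow> u \<in> carrier F \<Longrightarrow> \<phi> (inv\<^bsub>F\<^esub> u) = inv\<^bsub>F\<^esub> \<phi> u"
  by (rule group_hom.hom_inv[OF auto_group_hom])

lemma auto_one: "\<phi> \<in> auto F \<Longrightarrow> \<phi> \<one>\<^bsub>F\<^esub> = \<one>\<^bsub>F\<^esub>"
  by (rule group_hom.hom_one[OF auto_group_hom])

lemmas auto_simps = auto_apply_closed auto_mult auto_inv auto_one

lemma letter_inverse [simp]: "snd l < n \<Longrightarrow> [inv_letter l] = inv\<^bsub>F\<^esub> [l]"
  by (rule inv_letter_word) simp

lemma carrier_A [simp]: "carrier A = auto F"
  by (rule carrier_AutoGroup)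

lemma A_apply [simp]:
  "\<phi> \<in> auto F \<Longrightarrow> \<psi> \<in> auto F \<Longrightarrow> w \<in> carrier F \<Longrightarrow> (\<phi> \<otimes>\<^bsub>A\<^esub> \<psi>) w = \<phi> (\<psi> w)"
  by (simp add: mult_AutoGroup compose_def)

lemma A_closed [simp]:
  "\<phi> \<in> auto F \<Longrightarrow> \<psi> \<in> auto F \<Longrightarrow> \<phi> \<otimes>\<^bsub>A\<^esub> \<psi> \<in> auto F"
  "\<phi> \<in> auto F \<Longrightarrow> inv\<^bsub>A\<^esub> \<phi> \<in> auto F" "\<one>\<^bsub>A\<^esub> \<in> auto F"
  by (fact A.m_closed[unfolded carrier_A], fact A.inv_closed[unfolded carrier_A],
    fact A.one_closed[unfolded carrier_A])

lemma A_one_apply [simp]: "w \<in> carrier F \<Longrightarrow> \<one>\<^bsub>A\<^esub> w = w"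
  by (simp add: AutoGroup_def BijGroup_def)

lemma A_inv_apply:
  assumes "\<phi> \<in> auto F" "w \<in> carrier F"
  shows "(inv\<^bsub>A\<^esub> \<phi>) (\<phi> w) = w" "\<phi> ((inv\<^bsub>A\<^esub> \<phi>) w) = w"
proof -
  have "(inv\<^bsub>A\<^esub> \<phi> \<otimes>\<^bsub>A\<^esub> \<phi>) w = w" "(\<phi> \<otimes>\<^bsub>A\<^esub> inv\<^bsub>A\<^esub> \<phi>) w = w"
    using assms(1) A_one_apply[OF assms(2)] by (simp_all only: A.l_inv A.r_inv carrier_A)
  then show "(inv\<^bsub>A\<^esub> \<phi>) (\<phi> w) = w" "\<phi> ((inv\<^bsub>A\<^esub> \<phi>) w) = w"
    by (simp_all only: A_apply[OF assms(1) A_closed(2)[OF assms(1)] assms(2)]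
      A_apply[OF A_closed(2)[OF assms(1)] assms(1,2)])
qed

lemma auto_eqI:
  assumes "\<phi> \<in> auto F" "\<psi> \<in> auto F" "\<And>i. i < n \<Longrightarrow> \<exists>l. snd l = i \<and> \<phi> [l] = \<psi> [l]"
  shows "\<phi> = \<psi>"
proof
  fix w
  show "\<phi> w = \<psi> w"
  proof (cases "w \<in> carrier F")
    case True
    show ?thesis
      by (rule free_group_hom_eqI[OF F.is_group auto_hom[OF assms(1)] auto_hom[OF assms(2)] _ True])
        (use assms(3) in auto)
  next
    case False
    then show ?thesis using autoD(4)[OF assms(1)] autoD(4)[OF assms(2)] by (simp add: extensional_def)
  qed
qed

text \<open>Restricted to the carrier because \<open>auto\<close> consists of extensional
  maps.\<close>

definition subst :: "(nat \<Rightarrow> nat word) \<Rightarrow> nat word \<Rightarrow> nat word" where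
  "subst f = (\<lambda>w\<in>carrier F. eval_word F f w)"

lemma subst_hom:
  assumes "\<And>i. i < n \<Longrightarrow> f i \<in> carrier F"
  shows "subst f \<in> hom F F"
proof -
  have "eval_word F f \<in> hom F F" using assms by (intro F.free_group_universal) auto
  then show ?thesis by (auto simp: subst_def hom_def)
qed

lemma subst_gen:
  assumes "\<And>i. i < n \<Longrightarrow> f i \<in> carrier F" "i < n"
  shows "subst f (gen i) = f i"
  using F.free_group_universal(2)[of f "{..<n}" i] assms by (simp add: subst_def Pi_iff)

lemma auto_substI:
  assumes f: "\<And>i. i < n \<Longrightarrow> f i \<in> carrier F" and g: "\<And>i. i < n \<Longrightarrow> g i \<in> carrier F"
    and fg: "\<And>i. i < n \<Longrightarrow> subst f (g i) = gen i" and gf: "\<And>i. i < n \<Longrightarrow> subst g (f i) = gen i"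
  shows "subst f \<in> auto F"
proof -
  have id: "(\<lambda>w. w) \<in> hom F F" by (simp add: hom_def)
  have comp: "subst f \<circ> subst g \<in> hom F F" "subst g \<circ> subst f \<in> hom F F"
    using subst_hom[of f] subst_hom[of g] f g Group.hom_compose by blast+
  have gens1: "\<exists>l. snd l = i \<and> (subst f \<circ> subst g) [l] = [l]" if "i \<in> {..<n}" for i
    using that subst_gen[of g i] g fg by (intro exI[of _ "(True, i)"]) simp
  have gens2: "\<exists>l. snd l = i \<and> (subst g \<circ> subst f) [l] = [l]" if "i \<in> {..<n}" for i
    using that subst_gen[of f i] f gf by (intro exI[of _ "(True, i)"]) simp
  have 1: "subst f (subst g w) = w" if "w \<in> carrier F" for w
    using free_group_hom_eqI[OF F.is_group comp(1) id gens1 that] by simp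
  have 2: "subst g (subst f w) = w" if "w \<in> carrier F" for w
    using free_group_hom_eqI[OF F.is_group comp(2) id gens2 that] by simp
  have cl: "subst f w \<in> carrier F" "subst g w \<in> carrier F" if "w \<in> carrier F" for w
    using hom_in_carrier[OF subst_hom that] f g by auto
  have "bij_betw (subst f) (carrier F) (carrier F)"
    using 1 2 cl by (intro bij_betw_byWitness[where f' = "subst g"]) auto
  then show ?thesis
    using subst_hom[of f] f by (auto simp: auto_def Bij_def subst_def)
qed

lemma hom_fixes:
  assumes \<phi>: "\<phi> \<in> hom F F" and Y: "Y \<subseteq> {..<n}" and fix_gen: "\<And>i. i \<in> Y \<Longrightarrow> \<phi> (gen i) = gen i"
    and w: "w \<in> carrier (free_group Y)"
  shows "\<phi> w = w"
proof -
  have sub: "carrier (free_group Y) \<subseteq> carrier F" using Y by (rule free_group_carrier_mono)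
  have "\<phi> \<in> hom (free_group Y) F" "(\<lambda>w. w) \<in> hom (free_group Y) F"
    using \<phi> sub by (auto simp: hom_def Pi_iff subset_iff mult_free_group)
  moreover have "\<exists>l. snd l = i \<and> \<phi> [l] = [l]" if "i \<in> Y" for i
    using fix_gen[OF that] by (intro exI[of _ "(True, i)"]) simp
  ultimately show ?thesis
    using free_group_hom_eqI[OF F.is_group _ _ _ w] by blast
qed

lemma Fix_closed [simp]: "w \<in> Fix i \<Longrightarrow> w \<in> carrier F"
  using free_group_carrier_mono[of "{..<n} - {i}" "{..<n}"] by auto

lemma Fix_subgroup: "subgroup (Fix i) F"
  by (rule subgroup_free_group) auto

lemma Fix_simps [simp]:
  "u \<in> Fix i \<Longrightarrow> v \<in> Fix i \<Longrightarrow> u \<otimes>\<^bsub>F\<^esub> v \<in> Fix i" "u \<in> Fix i \<Longrightarrow> inv\<^bsub>F\<^esub> u \<in> Fix i" "\<one>\<^bsub>F\<^esub> \<in> Fix i"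
  using subgroup.m_closed[OF Fix_subgroup] subgroup.m_inv_closed[OF Fix_subgroup]
    subgroup.one_closed[OF Fix_subgroup] by auto

text \<open>For u and v in \<open>Fix i\<close> both words are fixed by the substitution, so for one
  i these automorphisms multiply as in the product of the opposite group of \<open>Fix i\<close>
  with \<open>Fix i\<close>. One-sided transvections, partial conjugations and the substitutions by
  commutators all have this shape.\<close>

definition sub :: "nat \<Rightarrow> nat word \<Rightarrow> nat word \<Rightarrow> nat word \<Rightarrow> nat word" where
  "sub i u v = subst (\<lambda>j. if j = i then u \<otimes>\<^bsub>F\<^esub> gen i \<otimes>\<^bsub>F\<^esub> v else gen j)"

context
  fixes i :: nat
  assumes i [simp]: "i < n"
begin

lemma sub_hom: "u \<in> carrier F \<Longrightarrow> v \<in> carrier F \<Longrightarrow> sub i u v \<in> hom F F"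
  unfolding sub_def by (rule subst_hom) simp

lemma sub_gen: "u \<in> carrier F \<Longrightarrow> v \<in> carrier F \<Longrightarrow> sub i u v (gen i) = u \<otimes>\<^bsub>F\<^esub> gen i \<otimes>\<^bsub>F\<^esub> v"
  unfolding sub_def by (subst subst_gen) auto

lemma sub_gen_other: "u \<in> carrier F \<Longrightarrow> v \<in> carrier F \<Longrightarrow> j < n \<Longrightarrow> j \<noteq> i \<Longrightarrow> sub i u v (gen j) = gen j"
  unfolding sub_def by (subst subst_gen) auto

lemma sub_Fix:
  assumes "u \<in> carrier F" "v \<in> carrier F" "w \<in> Fix i"
  shows "sub i u v w = w"
  by (rule hom_fixes[OF sub_hom _ _ assms(3)]) (use assms sub_gen_other in auto)

lemma sub_auto [simp]:
  assumes "u \<in> Fix i" "v \<in> Fix i"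
  shows "sub i u v \<in> auto F"
proof -
  have c: "u \<in> carrier F" "v \<in> carrier F" using assms by auto
  have *: "sub i u v (if j = i then inv\<^bsub>F\<^esub> u \<otimes>\<^bsub>F\<^esub> gen i \<otimes>\<^bsub>F\<^esub> inv\<^bsub>F\<^esub> v else gen j) = gen j"
    if j: "j < n" and uv: "u \<in> Fix i" "v \<in> Fix i" for j u v
  proof -
    interpret h: group_hom F F "sub i u v" using group_hom_free_group[OF F.is_group sub_hom] uv by simp
    show ?thesis
      using uv sub_gen[of u v] sub_gen_other[of u v j] sub_Fix[of u v] j by (auto simp: F.m_assoc)
  qed
  show ?thesis
    unfolding sub_def
  proof (rule auto_substI[where g = "\<lambda>j. if j = i then inv\<^bsub>F\<^esub> u \<otimes>\<^bsub>F\<^esub> gen i \<otimes>\<^bsub>F\<^esub> inv\<^bsub>F\<^esub> v else gen j"])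
    fix j assume j: "j < n"
    show "subst (\<lambda>j. if j = i then u \<otimes>\<^bsub>F\<^esub> gen i \<otimes>\<^bsub>F\<^esub> v else gen j)
        (if j = i then inv\<^bsub>F\<^esub> u \<otimes>\<^bsub>F\<^esub> gen i \<otimes>\<^bsub>F\<^esub> inv\<^bsub>F\<^esub> v else gen j) = gen j"
      using *[OF j assms] unfolding sub_def .
    show "subst (\<lambda>j. if j = i then inv\<^bsub>F\<^esub> u \<otimes>\<^bsub>F\<^esub> gen i \<otimes>\<^bsub>F\<^esub> inv\<^bsub>F\<^esub> v else gen j)
        (if j = i then u \<otimes>\<^bsub>F\<^esub> gen i \<otimes>\<^bsub>F\<^esub> v else gen j) = gen j"
      using *[OF j, of "inv\<^bsub>F\<^esub> u" "inv\<^bsub>F\<^esub> v"] assms c unfolding sub_def by (auto cong: if_cong)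
  qed (use c in auto)
qed

lemma sub_letter_other [simp]: "u \<in> Fix i \<Longrightarrow> v \<in> Fix i \<Longrightarrow> snd l < n \<Longrightarrow> snd l \<noteq> i \<Longrightarrow> sub i u v [l] = [l]"
  by (rule sub_Fix) auto

lemma sub_gen' [simp]: "u \<in> Fix i \<Longrightarrow> v \<in> Fix i \<Longrightarrow> sub i u v (gen i) = u \<otimes>\<^bsub>F\<^esub> gen i \<otimes>\<^bsub>F\<^esub> v"
  by (rule sub_gen) auto

lemma sub_Fix' [simp]: "u \<in> Fix i \<Longrightarrow> v \<in> Fix i \<Longrightarrow> w \<in> Fix i \<Longrightarrow> sub i u v w = w"
  by (rule sub_Fix) auto

lemma sub_simps [simp]:
  assumes "u \<in> Fix i" "v \<in> Fix i"
  shows "x \<in> carrier F \<Longrightarrow> sub i u v x \<in> carrier F"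
    "x \<in> carrier F \<Longrightarrow> y \<in> carrier F \<Longrightarrow> sub i u v (x \<otimes>\<^bsub>F\<^esub> y) = sub i u v x \<otimes>\<^bsub>F\<^esub> sub i u v y"
    "x \<in> carrier F \<Longrightarrow> sub i u v (inv\<^bsub>F\<^esub> x) = inv\<^bsub>F\<^esub> sub i u v x"
  using auto_simps[OF sub_auto[OF assms]] by auto

lemma auto_eq_subI:
  assumes "\<phi> \<in> auto F" "u \<in> Fix i" "v \<in> Fix i" "\<phi> (gen i) = u \<otimes>\<^bsub>F\<^esub> gen i \<otimes>\<^bsub>F\<^esub> v"
    and "\<And>j. j < n \<Longrightarrow> j \<noteq> i \<Longrightarrow> \<phi> (gen j) = gen j"
  shows "\<phi> = sub i u v"
proof (rule auto_eqI)
  fix j assume j: "j < n"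
  show "\<exists>l. snd l = j \<and> \<phi> [l] = sub i u v [l]"
    using assms j by (intro exI[of _ "(True, j)"]) (cases "j = i"; simp)
qed (use assms in auto)

lemma sub_comp:
  assumes "u \<in> Fix i" "v \<in> Fix i" "u' \<in> Fix i" "v' \<in> Fix i"
  shows "sub i u v \<otimes>\<^bsub>A\<^esub> sub i u' v' = sub i (u' \<otimes>\<^bsub>F\<^esub> u) (v \<otimes>\<^bsub>F\<^esub> v')"
  by (rule auto_eq_subI) (use assms in \<open>simp_all add: F.m_assoc\<close>)

lemma sub_one: "sub i \<one>\<^bsub>F\<^esub> \<one>\<^bsub>F\<^esub> = \<one>\<^bsub>A\<^esub>"
  by (rule auto_eq_subI[symmetric]) auto

lemma sub_inv:
  assumes "u \<in> Fix i" "v \<in> Fix i"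
  shows "inv\<^bsub>A\<^esub> (sub i u v) = sub i (inv\<^bsub>F\<^esub> u) (inv\<^bsub>F\<^esub> v)"
  using assms sub_one by (intro A.inv_equality) (simp_all add: sub_comp)

lemma sub_pow:
  assumes "u \<in> Fix i" "v \<in> Fix i"
  shows "sub i u v [^]\<^bsub>A\<^esub> (m::nat) = sub i (u [^]\<^bsub>F\<^esub> m) (v [^]\<^bsub>F\<^esub> m)"
proof -
  have p: "w [^]\<^bsub>F\<^esub> m \<in> Fix i" if "w \<in> Fix i" for w and m :: nat
    using that by (induction m) auto
  show ?thesis
  proof (induction m)
    case (Suc m)
    then show ?case using assms p F.nat_pow_Suc2[of u m] by (simp add: sub_comp del: F.nat_pow_Suc)
  qed (simp add: sub_one)
qed

end

text \<open>In terms of letters this is l -> l m for either sign of l. At an inverse letter it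
  becomes left multiplication of the generator by the inverse of m, so one notation covers the
  transvections on both sides.\<close>

definition transv :: "bool \<times> nat \<Rightarrow> bool \<times> nat \<Rightarrow> nat word \<Rightarrow> nat word" where
  "transv l m = (if fst l then sub (snd l) \<one>\<^bsub>F\<^esub> [m] else sub (snd l) [inv_letter m] \<one>\<^bsub>F\<^esub>)"

lemma transv_auto [simp]: "snd l < n \<Longrightarrow> snd m < n \<Longrightarrow> snd l \<noteq> snd m \<Longrightarrow> transv l m \<in> auto F"
  by (simp add: transv_def del: letter_inverse)

lemma transv_letter [simp]:
  assumes "snd l < n" "snd m < n" "snd l \<noteq> snd m"
  shows "transv l m [l] = [l] \<otimes>\<^bsub>F\<^esub> [m]"
proof (cases l)
  case (Pair b i)
  show ?thesis
  proof (cases b)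
    case True
    then show ?thesis using Pair assms by (simp add: transv_def)
  next
    case False
    then have l: "[l] = inv\<^bsub>F\<^esub> (gen i)" using Pair assms letter_inverse[of "(True, i)"] by (simp add: inv_letter_def)
    have m: "[inv_letter m] \<in> Fix i" using Pair assms by (simp del: letter_inverse)
    have "transv l m = sub i [inv_letter m] \<one>\<^bsub>F\<^esub>" using False Pair by (simp add: transv_def)
    then show ?thesis unfolding l using m Pair assms by (simp add: F.inv_mult_group)
  qed
qed

lemma transv_letter_other [simp]:
  assumes "snd l < n" "snd m < n" "snd l \<noteq> snd m" "snd k < n" "snd k \<noteq> snd l"
  shows "transv l m [k] = [k]"
  using assms by (simp add: transv_def del: letter_inverse)

lemma transv_simps [simp]:
  assumes "snd l < n" "snd m < n" "snd l \<noteq> snd m"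
  shows "x \<in> carrier F \<Longrightarrow> transv l m x \<in> carrier F"
    "x \<in> carrier F \<Longrightarrow> y \<in> carrier F \<Longrightarrow> transv l m (x \<otimes>\<^bsub>F\<^esub> y) = transv l m x \<otimes>\<^bsub>F\<^esub> transv l m y"
    "x \<in> carrier F \<Longrightarrow> transv l m (inv\<^bsub>F\<^esub> x) = inv\<^bsub>F\<^esub> transv l m x"
  using auto_simps[OF transv_auto[OF assms]] by auto

definition monomials :: "(nat word \<Rightarrow> nat word) set" where
  "monomials = {\<phi> \<in> auto F. \<forall>l. snd l < n \<longrightarrow> (\<exists>k. snd k < n \<and> \<phi> [l] = [k])}"

lemma monomials_auto [simp]: "\<phi> \<in> monomials \<Longrightarrow> \<phi> \<in> auto F"
  by (simp add: monomials_def)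

definition act :: "(nat word \<Rightarrow> nat word) \<Rightarrow> bool \<times> nat \<Rightarrow> bool \<times> nat" where
  "act \<phi> l = hd (\<phi> [l])"

lemma act:
  assumes "\<phi> \<in> monomials" "snd l < n"
  shows "\<phi> [l] = [act \<phi> l]" "snd (act \<phi> l) < n"
proof -
  obtain k where "snd k < n" "\<phi> [l] = [k]" using assms unfolding monomials_def by blast
  then show "\<phi> [l] = [act \<phi> l]" "snd (act \<phi> l) < n" unfolding act_def by simp_all
qed

lemma act_surj:
  assumes \<phi>: "\<phi> \<in> monomials" and l: "snd l < n"
  shows "\<exists>k. snd k < n \<and> act \<phi> k = l"
proof -
  let ?L = "(UNIV :: bool set) \<times> {..<n}"
  have "inj_on (act \<phi>) ?L"
  proof (rule inj_onI)
    fix a b assume ab: "a \<in> ?L" "b \<in> ?L" "act \<phi> a = act \<phi> b"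
    then have ab': "snd a < n" "snd b < n" by auto
    then have "\<phi> [a] = \<phi> [b]" using act(1)[OF \<phi>] ab by simp
    then have "[a] = [b]" using autoD(2)[OF monomials_auto[OF \<phi>]] ab' by (metis inj_onD letter_carrier lessThan_iff)
    then show "a = b" by simp
  qed
  moreover have "act \<phi> ` ?L \<subseteq> ?L"
  proof
    fix k assume "k \<in> act \<phi> ` ?L"
    then obtain l where "k = act \<phi> l" "snd l < n" by auto
    then show "k \<in> ?L" using act(2)[OF \<phi>] by (simp add: mem_Times_iff)
  qed
  ultimately have "act \<phi> ` ?L = ?L" by (intro endo_inj_surj) auto
  moreover have "l \<in> ?L" using l by (simp add: mem_Times_iff)
  ultimately obtain k where "k \<in> ?L" "act \<phi> k = l" by (metis imageE)
  then show ?thesis by (metis SigmaE lessThan_iff snd_conv)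
qed

lemma monomials_subgroup: "subgroup monomials A"
proof (rule A.subgroupI)
  have "\<exists>k. snd k < n \<and> \<one>\<^bsub>A\<^esub> [l] = [k]" if "snd l < n" for l
    using that A_one_apply[of "[l]"] by (intro exI[of _ l]) simp
  then have "\<one>\<^bsub>A\<^esub> \<in> monomials" unfolding monomials_def using A_closed(3) by blast
  then show "monomials \<noteq> {}" by blast
next
  fix \<phi> assume \<phi>: "\<phi> \<in> monomials"
  have "\<exists>k. snd k < n \<and> (inv\<^bsub>A\<^esub> \<phi>) [l] = [k]" if l: "snd l < n" for l
  proof -
    obtain k where k: "snd k < n" "act \<phi> k = l" using act_surj[OF \<phi> l] by blast
    then have "(inv\<^bsub>A\<^esub> \<phi>) [l] = [k]"
      using act(1)[OF \<phi> k(1)] A_inv_apply(1)[of \<phi> "[k]"] \<phi> by simp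
    then show ?thesis using k by blast
  qed
  then show "inv\<^bsub>A\<^esub> \<phi> \<in> monomials"
    using A_closed(2)[OF monomials_auto[OF \<phi>]] unfolding monomials_def by blast
next
  fix \<phi> \<psi> assume \<phi>\<psi>: "\<phi> \<in> monomials" "\<psi> \<in> monomials"
  have "\<exists>k. snd k < n \<and> (\<phi> \<otimes>\<^bsub>A\<^esub> \<psi>) [l] = [k]" if l: "snd l < n" for l
    using act[OF \<phi>\<psi>(2) l] act[OF \<phi>\<psi>(1), of "act \<psi> l"] \<phi>\<psi> l
    by (intro exI[of _ "act \<phi> (act \<psi> l)"]) simp
  then show "\<phi> \<otimes>\<^bsub>A\<^esub> \<psi> \<in> monomials"
    using A_closed(1)[OF \<phi>\<psi>[THEN monomials_auto]] unfolding monomials_def by blast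
next
  show "monomials \<subseteq> carrier A" using monomials_auto by auto
qed

lemma act_inv_letter:
  assumes "\<phi> \<in> monomials" "snd l < n"
  shows "act \<phi> (inv_letter l) = inv_letter (act \<phi> l)"
proof -
  have "[act \<phi> (inv_letter l)] = \<phi> [inv_letter l]" using act(1)[OF assms(1), of "inv_letter l"] assms by simp
  also have "\<dots> = inv\<^bsub>F\<^esub> [act \<phi> l]" using act[OF assms] assms by (simp add: auto_inv)
  also have "\<dots> = [inv_letter (act \<phi> l)]" using act[OF assms] by simp
  finally show ?thesis by simp
qed

lemma act_inj:
  assumes "\<phi> \<in> monomials" "snd l < n" "snd m < n" "act \<phi> l = act \<phi> m"
  shows "l = m"
proof -
  have "\<phi> [l] = \<phi> [m]" using act(1)[OF assms(1)] assms by simp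
  then have "[l] = [m]" using autoD(2)[OF monomials_auto[OF assms(1)]] assms by (metis inj_onD letter_carrier lessThan_iff)
  then show ?thesis by simp
qed

lemma act_snd:
  assumes "\<phi> \<in> monomials" "snd l < n" "snd m < n"
  shows "snd (act \<phi> l) = snd (act \<phi> m) \<longleftrightarrow> snd l = snd m"
proof
  assume "snd (act \<phi> l) = snd (act \<phi> m)"
  then have "act \<phi> l = act \<phi> m \<or> act \<phi> l = act \<phi> (inv_letter m)"
    using snd_letter_eq act_inv_letter[OF assms(1,3)] by metis
  then show "snd l = snd m" using act_inj[OF assms(1,2)] assms(3) by (metis snd_inv_letter)
next
  assume "snd l = snd m"
  then have "l = m \<or> l = inv_letter m" by (rule snd_letter_eq)
  then show "snd (act \<phi> l) = snd (act \<phi> m)" using act_inv_letter[OF assms(1,3)] by auto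
qed

end

section \<open>Nielsen reduction\<close>

text \<open>Letters are coded as digits below 2n. For B = 2n and words of one length, the order of
  these numerals is the lexicographic order of words.\<close>

fun word_num :: "nat \<Rightarrow> (bool \<times> nat) list \<Rightarrow> nat" where
  "word_num B [] = 0"
| "word_num B (l # w) = (2 * snd l + of_bool (fst l)) * B ^ length w + word_num B w"

lemma word_num_append: "word_num B (u @ v) = word_num B u * B ^ length v + word_num B v"
  by (induction u) (auto simp: algebra_simps power_add)

lemma word_num_less:
  assumes "snd ` set w \<subseteq> {..<n}"
  shows "word_num (2 * n) w < (2 * n) ^ length w"
  using assms
proof (induction w)
  case (Cons l w)
  then have l: "2 * snd l + of_bool (fst l) < 2 * n" by (cases "fst l") auto
  have "word_num (2 * n) (l # w) < (2 * snd l + of_bool (fst l)) * (2 * n) ^ length w + (2 * n) ^ length w"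
    using Cons by simp
  also have "\<dots> = Suc (2 * snd l + of_bool (fst l)) * (2 * n) ^ length w" by simp
  also have "\<dots> \<le> (2 * n) * (2 * n) ^ length w" using l by (intro mult_right_mono) auto
  finally show ?case by simp
qed simp

lemma word_num_inj:
  assumes "length u = length v" "snd ` set u \<subseteq> {..<n}" "snd ` set v \<subseteq> {..<n}"
    and "word_num (2 * n) u = word_num (2 * n) v"
  shows "u = v"
  using assms
proof (induction u v rule: list_induct2)
  case (Cons l u m v)
  let ?B = "(2 * n) ^ length u"
  have lt: "word_num (2 * n) u < ?B" "word_num (2 * n) v < ?B"
    using word_num_less[of u n] word_num_less[of v n] Cons.hyps Cons.prems by auto
  have eq: "(2 * snd l + of_bool (fst l)) * ?B + word_num (2 * n) u = (2 * snd m + of_bool (fst m)) * ?B + word_num (2 * n) v"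
    using Cons.prems Cons.hyps by simp
  then have c: "2 * snd l + of_bool (fst l) = (2 * snd m + of_bool (fst m) :: nat)"
  proof -
    have "a = b" if "r < B" "s < B" "a * B + r = b * B + s" for a b r s B :: nat
      using arg_cong[OF that(3), of "\<lambda>x. x div B"] that(1,2) by simp
    then show ?thesis using lt eq by blast
  qed
  then have "l = m" by (cases l; cases m; cases "fst l"; cases "fst m"; simp; presburger)
  moreover have "word_num (2 * n) u = word_num (2 * n) v" using eq c by simp
  ultimately show ?case using Cons by simp
qed simp

text \<open>Breaks ties between Nielsen moves that preserve the total length.\<close>

definition half_val :: "nat \<Rightarrow> (bool \<times> nat) list \<Rightarrow> nat" where
  "half_val B w = word_num B (take (length w div 2) w) + word_num B (take (length w div 2) (inv_word w))"

lemma half_val_inv_word [simp]: "half_val B (inv_word w) = half_val B w"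
  unfolding half_val_def inv_word_inv_word by simp

text \<open>The prefix is no longer than the rest, so it lies within the first half of the word,
  while the first half of the inverse word only sees letters of b. Exchanging the prefix thus
  changes the leading digits of one summand and nothing else.\<close>

lemma half_val_less:
  assumes "length p = length q" "length q \<le> length b" "word_num B p < word_num B q" "B > 0"
  shows "half_val B (p @ b) < half_val B (q @ b)"
proof -
  let ?h = "(length q + length b) div 2"
  have h: "length q \<le> ?h" "?h \<le> length b" using assms(2) by auto
  have 1: "take ?h (inv_word (r @ b)) = take ?h (inv_word b)" for r
    using h by simp
  have 2: "word_num B (take ?h (r @ b)) = word_num B r * B ^ (?h - length q) + word_num B (take (?h - length q) b)"
    if "length r = length q" for r
    using that h by (simp add: word_num_append)
  have "half_val B (r @ b) = word_num B r * B ^ (?h - length q) + word_num B (take (?h - length q) b) +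
      word_num B (take ?h (inv_word b))" if "length r = length q" for r
    unfolding half_val_def length_append that 1 using 2[OF that] by simp
  then show ?thesis using assms by simp
qed

text \<open>The number of letters that each factor loses; for reduced words the division is exact
  because both factors lose equally many.\<close>

definition canc :: "'a word \<Rightarrow> 'a word \<Rightarrow> nat" where
  "canc u v = (length u + length v - length (foldr cancel_cons u v)) div 2"

lemma canc_decomp:
  assumes "reduced u" "reduced v"
  obtains a c b where "u = a @ c" "v = inv_word c @ b" "foldr cancel_cons u v = a @ b" "length c = canc u v"
proof -
  obtain a c b where "u = a @ c" "v = inv_word c @ b" "foldr cancel_cons u v = a @ b"
    using cancel_decomp[OF assms] by blast
  moreover from this have "length c = canc u v" by (simp add: canc_def)
  ultimately show thesis using that by blast
qed

lemma length_mult_canc: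
  assumes "reduced u" "reduced v"
  shows "length (foldr cancel_cons u v) + 2 * canc u v = length u + length v"
proof -
  obtain a c b where "u = a @ c" "v = inv_word c @ b" "foldr cancel_cons u v = a @ b" "length c = canc u v"
    using canc_decomp[OF assms] .
  then show ?thesis by simp
qed

lemma canc_self:
  assumes "reduced u" "u \<noteq> []"
  shows "2 * canc u u < length u"
proof -
  obtain a c b where "u = a @ c" "u = inv_word c @ b" "length c = canc u u"
    using canc_decomp[OF assms(1,1)] .
  then show ?thesis using self_cancel[OF assms] by metis
qed

context free_group_aut
begin

text \<open>Compared lexicographically, so that \<open>half_val\<close> matters only at equal total
  length.\<close>

definition complexity :: "(nat word \<Rightarrow> nat word) \<Rightarrow> nat \<times> nat" where
  "complexity \<phi> = (\<Sum>i<n. length (\<phi> (gen i)), \<Sum>i<n. half_val (2 * n) (\<phi> (gen i)))"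

lemma auto_reduced: "\<phi> \<in> auto F \<Longrightarrow> w \<in> carrier F \<Longrightarrow> reduced (\<phi> w)"
  using auto_apply_closed carrier_free_group by blast

lemma auto_nontrivial:
  assumes "\<phi> \<in> auto F" "w \<in> carrier F" "w \<noteq> []"
  shows "\<phi> w \<noteq> []"
proof
  assume "\<phi> w = []"
  then have "\<phi> w = \<phi> \<one>\<^bsub>F\<^esub>" using auto_one[OF assms(1)] by (simp add: one_free_group)
  then have "w = \<one>\<^bsub>F\<^esub>" using autoD(2)[OF assms(1)] assms(2) by (simp add: inj_on_eq_iff)
  then show False using assms(3) by (simp add: one_free_group)
qed

lemma auto_inv_letter:
  assumes "\<phi> \<in> auto F" "snd l < n"
  shows "\<phi> [inv_letter l] = inv_word (\<phi> [l])"
  using assms auto_inv[of \<phi> "[l]"] inv_free_group[of "\<phi> [l]" "{..<n}"] auto_apply_closed[of \<phi> "[l]"] by simp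

text \<open>Only the basis image at the index of l changes. Since l may be an inverse letter while
  the sums run over generators, f has to be invariant under inversion. Both sides are sums so that
  no natural number is subtracted.\<close>

lemma sum_transv_less:
  assumes \<phi>: "\<phi> \<in> auto F" and lm: "snd l < n" "snd m < n" "snd l \<noteq> snd m"
    and f: "\<And>w. f (inv_word w) = f w"
  shows "(\<Sum>i<n. f ((\<phi> \<otimes>\<^bsub>A\<^esub> transv l m) (gen i))) + f (\<phi> [l]) =
    (\<Sum>i<n. f (\<phi> (gen i))) + (f (\<phi> [l] \<otimes>\<^bsub>F\<^esub> \<phi> [m]) :: nat)"
proof -
  have letter: "f (\<psi> (gen (snd l))) = f (\<psi> [l])" if "\<psi> \<in> auto F" for \<psi>
    using auto_inv_letter[OF that lm(1)] f snd_letter_eq[of "(True, snd l)" l] by auto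
  have T: "transv l m \<in> auto F" using lm by simp
  have PT: "\<phi> \<otimes>\<^bsub>A\<^esub> transv l m \<in> auto F" using \<phi> T by simp
  have "(\<phi> \<otimes>\<^bsub>A\<^esub> transv l m) [l] = \<phi> [l] \<otimes>\<^bsub>F\<^esub> \<phi> [m]"
    using \<phi> T lm by (simp add: auto_mult)
  then have 1: "f ((\<phi> \<otimes>\<^bsub>A\<^esub> transv l m) (gen (snd l))) = f (\<phi> [l] \<otimes>\<^bsub>F\<^esub> \<phi> [m])"
    using letter[OF PT] by simp
  have 2: "(\<Sum>i\<in>{..<n} - {snd l}. f ((\<phi> \<otimes>\<^bsub>A\<^esub> transv l m) (gen i))) =
      (\<Sum>i\<in>{..<n} - {snd l}. f (\<phi> (gen i)))"
  proof (rule sum.cong)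
    fix i assume "i \<in> {..<n} - {snd l}"
    then show "f ((\<phi> \<otimes>\<^bsub>A\<^esub> transv l m) (gen i)) = f (\<phi> (gen i))"
      using \<phi> T lm by simp
  qed simp
  show ?thesis
    using lm(1) 1 2 letter[OF \<phi>]
      sum.remove[of "{..<n}" "snd l" "\<lambda>i. f ((\<phi> \<otimes>\<^bsub>A\<^esub> transv l m) (gen i))"]
      sum.remove[of "{..<n}" "snd l" "\<lambda>i. f (\<phi> (gen i))"] by simp
qed

lemma canc_inv_word:
  assumes "u \<in> carrier F" "v \<in> carrier F"
  shows "canc (inv_word v) (inv_word u) = canc u v"
proof -
  have "foldr cancel_cons (inv_word v) (inv_word u) = inv_word (foldr cancel_cons u v)"
    using F.inv_mult_group[OF assms] inv_free_group[OF assms(1)] inv_free_group[OF assms(2)]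
      inv_free_group[OF F.m_closed[OF assms]] by (simp add: mult_free_group)
  then show ?thesis by (simp add: canc_def add.commute)
qed

text \<open>The cancellation bounds say that some letter of each \<open>\<phi> [l]\<close> survives in every reduced product.\<close>

lemma length_ge_if_small_cancellation:
  assumes \<phi>: "\<phi> \<in> auto F"
    and two: "\<And>l m. snd l < n \<Longrightarrow> snd m < n \<Longrightarrow> m \<noteq> inv_letter l \<Longrightarrow> canc (\<phi> [l]) (\<phi> [m]) < length (\<phi> [l])"
    and three: "\<And>l m k. snd l < n \<Longrightarrow> snd m < n \<Longrightarrow> snd k < n \<Longrightarrow> m \<noteq> inv_letter l \<Longrightarrow> k \<noteq> inv_letter m \<Longrightarrow>
      canc (\<phi> [l]) (\<phi> [m]) + canc (\<phi> [m]) (\<phi> [k]) < length (\<phi> [m])"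
    and w: "l # w \<in> carrier F"
  shows "\<exists>s Q a. \<phi> (l # w) = s @ Q \<and> \<phi> [l] = s @ a \<and> s \<noteq> [] \<and> length Q \<ge> length w \<and>
    length a = (if w = [] then 0 else canc (\<phi> [l]) (\<phi> [hd w]))"
  using w
proof (induction w arbitrary: l)
  case Nil
  then have "\<phi> [l] \<noteq> []" using auto_nontrivial[OF \<phi>] by blast
  then show ?case by (intro exI[of _ "\<phi> [l]"] exI[of _ "[]"]) simp
next
  case (Cons m w)
  have red: "reduced (l # m # w)" and lmw: "snd l < n" "snd m < n" "snd ` set w \<subseteq> {..<n}"
    using Cons.prems by (auto simp: carrier_free_group)
  have mw: "m # w \<in> carrier F" using reduced_tl[OF red] lmw by (auto simp: carrier_free_group)
  have ml: "m \<noteq> inv_letter l" using red by (simp add: reduced_def)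
  obtain s Q a where IH: "\<phi> (m # w) = s @ Q" "\<phi> [m] = s @ a" "s \<noteq> []" "length Q \<ge> length w"
    "length a = (if w = [] then 0 else canc (\<phi> [m]) (\<phi> [hd w]))"
    using Cons.IH[OF mw] by blast
  have c: "[l] \<in> carrier F" "[m] \<in> carrier F" using lmw by auto
  obtain s0 c b where scb: "\<phi> [l] = s0 @ c" "\<phi> [m] = inv_word c @ b" "foldr cancel_cons (\<phi> [l]) (\<phi> [m]) = s0 @ b"
    "length c = canc (\<phi> [l]) (\<phi> [m])"
    using canc_decomp[OF auto_reduced[OF \<phi> c(1)] auto_reduced[OF \<phi> c(2)]] .
  \<comment> \<open>Here c and a measure what \<phi> [m] loses on its left and on its right. If m is
    the last letter nothing is lost on the right, and \<open>two\<close> for the inverse letters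
    bounds the loss on the left.\<close>
  have "length c + length a < length (\<phi> [m])"
  proof (cases w)
    case Nil
    have "canc (\<phi> [inv_letter m]) (\<phi> [inv_letter l]) < length (\<phi> [inv_letter m])"
      using ml lmw by (intro two) auto
    then show ?thesis
      using Nil IH(5) scb(4) canc_inv_word[of "\<phi> [l]" "\<phi> [m]"] auto_inv_letter[OF \<phi>] lmw c
        auto_apply_closed[OF \<phi>] by simp
  next
    case (Cons k w')
    have "k \<noteq> inv_letter m" "snd k < n" using red lmw Cons by (auto simp: reduced_def)
    then show ?thesis using three[OF lmw(1,2), of k] ml IH(5) scb(4) Cons by simp
  qed
  then have "length (inv_word c) < length s" using IH(2) by simp
  \<comment> \<open>The part s' of \<phi> [m] survives both cancellations. Being nonempty it
    separates them, so \<phi> [l] cancels against the whole tail exactly as against \<phi>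
    [m].\<close>
  then obtain s' where s': "s = inv_word c @ s'" "s' \<noteq> []" "b = s' @ a"
  proof -
    assume lt: "length (inv_word c) < length s"
    have "inv_word c @ b = s @ a" using scb(2) IH(2) by simp
    then obtain us where "inv_word c @ us = s \<and> b = us @ a \<or> inv_word c = s @ us \<and> us @ b = a"
      by (metis append_eq_append_conv2)
    moreover have "inv_word c \<noteq> s @ us"
    proof
      assume "inv_word c = s @ us"
      then have "length (inv_word c) = length (s @ us)" by (rule arg_cong)
      then show False using lt by simp
    qed
    ultimately have "s = inv_word c @ us" "b = us @ a" by auto
    then show thesis using that[of us] lt by auto
  qed
  have s0: "s0 \<noteq> []" using two[OF lmw(1,2) ml] scb by auto
  have r1: "reduced (s0 @ s' @ a)"
    using F.m_closed[OF auto_apply_closed[OF \<phi> c(1)] auto_apply_closed[OF \<phi> c(2)]] scb(3) s'(3)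
    by (simp add: carrier_free_group mult_free_group)
  have r2: "reduced (s' @ Q)"
    using auto_reduced[OF \<phi> mw] IH(1) s'(1) by (simp add: reduced_append)
  have r: "reduced (s0 @ s' @ Q)"
    using r1 r2 s'(2) by (simp add: reduced_append)
  have "\<phi> (l # m # w) = \<phi> [l] \<otimes>\<^bsub>F\<^esub> \<phi> (m # w)"
    using Cons_mult[OF red, of "{..<n}"] auto_mult[OF \<phi> c(1) mw] by simp
  also have "\<dots> = foldr cancel_cons s0 (foldr cancel_cons c (foldr cancel_cons (inv_word c) (s' @ Q)))"
  proof -
    have "reduced (inv_word c @ s' @ Q)" using auto_reduced[OF \<phi> mw] IH(1) s'(1) by simp
    then have "foldr cancel_cons (inv_word c) (s' @ Q) = inv_word c @ s' @ Q" by (rule mult_reduced_append)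
    then show ?thesis by (simp add: mult_free_group scb(1) IH(1) s'(1))
  qed
  also have "foldr cancel_cons c (foldr cancel_cons (inv_word c) (s' @ Q)) = s' @ Q"
  proof -
    have "foldr cancel_cons (foldr cancel_cons c (inv_word c)) (s' @ Q) = s' @ Q"
      using mult_inverse[of "inv_word c"] by simp
    then show ?thesis using mult_assoc_word[OF r2] by metis
  qed
  also have "foldr cancel_cons s0 (s' @ Q) = s0 @ s' @ Q" using r by (rule mult_reduced_append)
  finally have "\<phi> (l # m # w) = s0 @ (s' @ Q)" .
  moreover have "length (s' @ Q) \<ge> length (m # w)" using IH(4) s'(2) by (cases s') auto
  ultimately show ?case
    using scb(1,4) s0 by (intro exI[of _ s0] exI[of _ "s' @ Q"] exI[of _ c]) simp
qed

text \<open>Minimality of length bounds the cancellation between two images by half of either. A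
  middle image can then vanish in a triple product only if it is P Q^-1 with halves of equal length,
  its left neighbour ending in P^-1 and its right neighbour beginning with Q. Multiplying a
  neighbour by it exchanges P and Q there at equal length, and as P and Q differ, one of the two
  moves lowers \<open>half_val\<close>. So the cancellation bounds hold, and they force preimages of
  letters to be letters.\<close>

lemma monomial_if_irreducible:
  assumes \<phi>: "\<phi> \<in> auto F"
    and irr: "\<And>l m. snd l < n \<Longrightarrow> snd m < n \<Longrightarrow> snd l \<noteq> snd m \<Longrightarrow>
      (complexity (\<phi> \<otimes>\<^bsub>A\<^esub> transv l m), complexity \<phi>) \<notin> less_than <*lex*> less_than"
  shows "\<phi> \<in> monomials"
proof -
  note red = auto_reduced[OF \<phi>] and cl = auto_apply_closed[OF \<phi>]
  have lenF: "length (u \<otimes>\<^bsub>F\<^esub> v) + 2 * canc u v = length u + length v"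
    if "u \<in> carrier F" "v \<in> carrier F" for u v
    using length_mult_canc[of u v] that by (simp add: mult_free_group carrier_free_group)
  have len: "length (\<phi> [l]) \<le> length (\<phi> [l] \<otimes>\<^bsub>F\<^esub> \<phi> [m])"
    if lm: "snd l < n" "snd m < n" "snd l \<noteq> snd m" for l m
    using irr[OF lm] sum_transv_less[OF \<phi> lm, of length] unfolding complexity_def by auto
  have val: "half_val (2 * n) (\<phi> [l]) \<le> half_val (2 * n) (\<phi> [l] \<otimes>\<^bsub>F\<^esub> \<phi> [m])"
    if lm: "snd l < n" "snd m < n" "snd l \<noteq> snd m" "length (\<phi> [l]) = length (\<phi> [l] \<otimes>\<^bsub>F\<^esub> \<phi> [m])" for l m
    using irr[OF lm(1-3)] sum_transv_less[OF \<phi> lm(1-3), of length]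
      sum_transv_less[OF \<phi> lm(1-3), of "half_val (2 * n)"] lm(4) unfolding complexity_def by auto
  have ne: "\<phi> [l] \<noteq> []" if "snd l < n" for l using auto_nontrivial[OF \<phi>, of "[l]"] that by simp
  have c1: "2 * canc (\<phi> [l]) (\<phi> [m]) \<le> length (\<phi> [m])" if lm: "snd l < n" "snd m < n" "m \<noteq> inv_letter l" for l m
  proof (cases "snd l = snd m")
    case True
    then have "l = m" using lm(3) snd_letter_eq[of m l] by auto
    then show ?thesis using canc_self[OF red ne, of m] lm by simp
  next
    case False
    then show ?thesis using len[OF lm(1,2) False] lenF[of "\<phi> [l]" "\<phi> [m]"] cl lm by simp
  qed
  have inv_canc: "canc (\<phi> [inv_letter m]) (\<phi> [inv_letter l]) = canc (\<phi> [l]) (\<phi> [m])"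
    if lm: "snd l < n" "snd m < n" for l m
    using canc_inv_word[of "\<phi> [l]" "\<phi> [m]"] auto_inv_letter[OF \<phi>] lm cl by simp
  have c2: "2 * canc (\<phi> [l]) (\<phi> [m]) \<le> length (\<phi> [l])" if lm: "snd l < n" "snd m < n" "m \<noteq> inv_letter l" for l m
    using c1[of "inv_letter m" "inv_letter l"] inv_canc[OF lm(1,2)] auto_inv_letter[OF \<phi>] lm by auto
  have two: "canc (\<phi> [l]) (\<phi> [m]) < length (\<phi> [l])" if lm: "snd l < n" "snd m < n" "m \<noteq> inv_letter l" for l m
    using c2[OF lm] ne[OF lm(1)] by (cases "\<phi> [l]") auto
  have three: "canc (\<phi> [l]) (\<phi> [m]) + canc (\<phi> [m]) (\<phi> [k]) < length (\<phi> [m])"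
    if lmk: "snd l < n" "snd m < n" "snd k < n" "m \<noteq> inv_letter l" "k \<noteq> inv_letter m" for l m k
  proof (rule ccontr)
    assume "\<not> ?thesis"
    then have half: "2 * canc (\<phi> [l]) (\<phi> [m]) = length (\<phi> [m])" "2 * canc (\<phi> [m]) (\<phi> [k]) = length (\<phi> [m])"
      using c1[OF lmk(1,2,4)] c2[OF lmk(2,3,5)] by auto
    have "l \<noteq> m" "k \<noteq> m" using half canc_self[OF red ne, of m] lmk by auto
    then have ne2: "snd l \<noteq> snd m" "snd m \<noteq> snd k"
      using lmk snd_letter_eq[of m l] snd_letter_eq[of k m] by auto
    have lc: "[l] \<in> carrier F" "[m] \<in> carrier F" "[k] \<in> carrier F" using lmk by auto
    obtain a p b0 where p: "\<phi> [l] = a @ p" "\<phi> [m] = inv_word p @ b0" "foldr cancel_cons (\<phi> [l]) (\<phi> [m]) = a @ b0"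
      "length p = canc (\<phi> [l]) (\<phi> [m])"
      using canc_decomp[OF red[OF lc(1)] red[OF lc(2)]] .
    obtain a0 q b where q: "\<phi> [m] = a0 @ q" "\<phi> [k] = inv_word q @ b" "foldr cancel_cons (\<phi> [m]) (\<phi> [k]) = a0 @ b"
      "length q = canc (\<phi> [m]) (\<phi> [k])"
      using canc_decomp[OF red[OF lc(2)] red[OF lc(3)]] .
    have "length (inv_word p) = length a0" 
    proof -
      have "length (\<phi> [m]) = length a0 + length q" using q(1) by simp
      then show ?thesis using half p(4) q(4) by simp
    qed
    then have mid: "a0 = inv_word p" "b0 = q"
      using append_eq_append_conv[of a0 "inv_word p" q b0] trans[OF q(1)[symmetric] p(2)] by metis+
    define P Q where "P = inv_word p" and "Q = inv_word q"
    have mPQ: "\<phi> [m] = P @ inv_word Q"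
      unfolding P_def Q_def inv_word_inv_word mid(1)[symmetric] by (rule q(1))
    have lenPQ: "length P = length Q" unfolding P_def Q_def length_rev length_map
      using half p(4) q(4) by linarith
    have setPQ: "snd ` set P \<subseteq> {..<n}" "snd ` set Q \<subseteq> {..<n}"
      using cl[OF lc(2)] unfolding mPQ by (simp_all add: carrier_free_group image_Un image_image)
    have "P \<noteq> Q"
    proof
      assume "P = Q"
      then have "\<phi> [m] = foldr cancel_cons P (inv_word P)"
        using mPQ mult_reduced_append[of P "inv_word P"] red[OF lc(2)] by simp
      then have "\<phi> [m] = []" using mult_inverse[of "inv_word P"] by simp
      then show False using ne lmk by blast
    qed
    then have "word_num (2 * n) P < word_num (2 * n) Q \<or> word_num (2 * n) Q < word_num (2 * n) P"
      using word_num_inj[OF lenPQ setPQ] by linarith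
    then show False
    proof
      assume less: "word_num (2 * n) P < word_num (2 * n) Q"
      have kQ: "\<phi> [k] = Q @ b" unfolding Q_def using q by simp
      have mk: "\<phi> [m] \<otimes>\<^bsub>F\<^esub> \<phi> [k] = P @ b" unfolding P_def using q mid by (simp add: mult_free_group)
      have le: "length Q \<le> length b" using c1[OF lmk(2,3,5)] kQ q(4) unfolding Q_def by simp
      \<comment> \<open>Transvections multiply on the right, so the move on the left of \<phi> [k]
        is made on the image of the inverse letter.\<close>
      have "\<phi> [inv_letter k] \<otimes>\<^bsub>F\<^esub> \<phi> [inv_letter m] = inv_word (\<phi> [m] \<otimes>\<^bsub>F\<^esub> \<phi> [k])"
        using F.inv_mult_group[OF cl[OF lc(2)] cl[OF lc(3)]] auto_inv[OF \<phi> lc(2)] auto_inv[OF \<phi> lc(3)]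
          inv_free_group[OF F.m_closed[OF cl[OF lc(2)] cl[OF lc(3)]]] lmk by simp
      then have eq: "\<phi> [inv_letter k] \<otimes>\<^bsub>F\<^esub> \<phi> [inv_letter m] = inv_word (P @ b)" "\<phi> [inv_letter k] = inv_word (Q @ b)"
        using mk kQ auto_inv_letter[OF \<phi> lmk(3)] by simp_all
      have "half_val (2 * n) (inv_word (Q @ b)) \<le> half_val (2 * n) (inv_word (P @ b))"
        using val[of "inv_letter k" "inv_letter m", unfolded eq(1), unfolded eq(2)] lmk ne2 lenPQ by simp
      then have "half_val (2 * n) (Q @ b) \<le> half_val (2 * n) (P @ b)"
        unfolding half_val_inv_word .
      then show False using half_val_less[OF lenPQ le less] lmk by simp
    next
      assume less: "word_num (2 * n) Q < word_num (2 * n) P"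
      have lP: "\<phi> [l] = inv_word (P @ inv_word a)" unfolding P_def using p by simp
      have lm: "\<phi> [l] \<otimes>\<^bsub>F\<^esub> \<phi> [m] = inv_word (Q @ inv_word a)"
        unfolding Q_def using p mid by (simp add: mult_free_group)
      have le: "length P \<le> length (inv_word a)" using c2[OF lmk(1,2,4)] p unfolding P_def by simp
      have "half_val (2 * n) (inv_word (P @ inv_word a)) \<le> half_val (2 * n) (inv_word (Q @ inv_word a))"
        using val[of l m, unfolded lm, unfolded lP] lmk ne2 lenPQ by simp
      then have "half_val (2 * n) (P @ inv_word a) \<le> half_val (2 * n) (Q @ inv_word a)"
        unfolding half_val_inv_word .
      then show False using half_val_less[OF lenPQ[symmetric] le less] lmk by simp
    qed
  qed
  have "\<exists>k. snd k < n \<and> (inv\<^bsub>A\<^esub> \<phi>) [l] = [k]" if l: "snd l < n" for l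
  proof -
    have lc: "[l] \<in> carrier F" using l by simp
    define w where "w = (inv\<^bsub>A\<^esub> \<phi>) [l]"
    have w: "w \<in> carrier F" "\<phi> w = [l]"
      unfolding w_def using A_inv_apply(2)[OF \<phi> lc] auto_apply_closed[OF A_closed(2)[OF \<phi>] lc] by auto
    then have "w \<noteq> []" using auto_one[OF \<phi>] by (auto simp: one_free_group)
    then obtain k w' where kw: "w = k # w'" by (cases w) auto
    \<comment> \<open>The word \<phi> w is a single letter and s is nonempty, so Q is empty; but Q
      is at least as long as w without its first letter.\<close>
    obtain s Q where "\<phi> w = s @ Q" "s \<noteq> []" "length w' \<le> length Q"
      using length_ge_if_small_cancellation[OF \<phi> two three w(1)[unfolded kw]] kw by blast
    then have "length w' = 0" using arg_cong[OF w(2), of length] by (cases s) auto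
    then show ?thesis using w(1) kw unfolding w_def by (intro exI[of _ k]) simp
  qed
  then have "inv\<^bsub>A\<^esub> \<phi> \<in> monomials" using A_closed(2)[OF \<phi>] unfolding monomials_def by blast
  then have "inv\<^bsub>A\<^esub> (inv\<^bsub>A\<^esub> \<phi>) \<in> monomials" using subgroup.m_inv_closed[OF monomials_subgroup] by blast
  then show ?thesis using A.inv_inv \<phi> by simp
qed

theorem auto_generated:
  assumes "\<phi> \<in> auto F"
  shows "\<phi> \<in> generate A ({transv l m |l m. snd l < n \<and> snd m < n \<and> snd l \<noteq> snd m} \<union> monomials)"
proof -
  let ?S = "{transv l m |l m. snd l < n \<and> snd m < n \<and> snd l \<noteq> snd m} \<union> monomials"
  have wf: "wf (inv_image (less_than <*lex*> less_than) complexity)"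
    by (rule wf_inv_image, rule wf_lex_prod, rule wf_less_than, rule wf_less_than)
  show ?thesis
    using assms
  proof (induction \<phi> rule: wf_induct_rule[OF wf])
    case (1 \<phi>)
    show ?case
    proof (cases "\<phi> \<in> monomials")
      case True
      then show ?thesis by (intro generate.incl UnI2)
    next
      case False
      then obtain l m where lm: "snd l < n" "snd m < n" "snd l \<noteq> snd m"
        "(complexity (\<phi> \<otimes>\<^bsub>A\<^esub> transv l m), complexity \<phi>) \<in> less_than <*lex*> less_than"
        using monomial_if_irreducible[OF 1(2)] by blast
      have T: "transv l m \<in> auto F" using lm by simp
      have TS: "transv l m \<in> ?S" using lm by blast
      have "(\<phi> \<otimes>\<^bsub>A\<^esub> transv l m, \<phi>) \<in> inv_image (less_than <*lex*> less_than) complexity"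
        using lm(4) unfolding in_inv_image .
      then have "\<phi> \<otimes>\<^bsub>A\<^esub> transv l m \<in> generate A ?S"
        using A_closed(1)[OF 1(2) T] by (rule 1(1))
      moreover have "inv\<^bsub>A\<^esub> transv l m \<in> generate A ?S" using TS by (rule generate.inv)
      ultimately have "\<phi> \<otimes>\<^bsub>A\<^esub> transv l m \<otimes>\<^bsub>A\<^esub> inv\<^bsub>A\<^esub> transv l m \<in> generate A ?S"
        by (rule generate.eng)
      then show ?thesis using 1(2) T by (simp add: A.m_assoc)
    qed
  qed
qed

end

section \<open>Vector descent in groups with Steinberg relations\<close>

text \<open>
  Letters index the coordinates up to sign: \<open>v g\<close> is the row of index \<open>e\<close> of the integer matrix of \<open>g\<close>,
  extended to inverse letters by oddness, \<open>x l m\<close> acts by adding the entry at \<open>m\<close> to the entry at \<open>l\<close>,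
  and \<open>W\<close> acts by signed permutations.  The subgroup \<open>P\<close> is the expected stabilizer of the unit vector
  at \<open>e\<close>; Silvester's argument shows that it is the stabilizer.
\<close>

locale steinberg_group = group G for G (structure) +
  fixes J :: "'i set" and e :: 'i
    and x :: "bool \<times> 'i \<Rightarrow> bool \<times> 'i \<Rightarrow> 'a" and W P :: "'a set"
    and act :: "'a \<Rightarrow> bool \<times> 'i \<Rightarrow> bool \<times> 'i" and v :: "'a \<Rightarrow> bool \<times> 'i \<Rightarrow> int"
  assumes finite_J: "finite J"
    and x_closed: "snd l \<in> J \<Longrightarrow> snd m \<in> J \<Longrightarrow> snd l \<noteq> snd m \<Longrightarrow> x l m \<in> carrier G"
    and x_inv_right: "snd l \<in> J \<Longrightarrow> snd m \<in> J \<Longrightarrow> snd l \<noteq> snd m \<Longrightarrow> x l (inv_letter m) = inv (x l m)"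
    and x_inv_left: "snd l \<in> J \<Longrightarrow> snd m \<in> J \<Longrightarrow> snd l \<noteq> snd m \<Longrightarrow> x (inv_letter l) m = inv (x l m)"
    and x_comm: "snd l \<in> J \<Longrightarrow> snd m \<in> J \<Longrightarrow> snd k \<in> J \<Longrightarrow> snd q \<in> J \<Longrightarrow>
      snd l \<noteq> snd m \<Longrightarrow> snd k \<noteq> snd q \<Longrightarrow> snd l \<noteq> snd q \<Longrightarrow> snd m \<noteq> snd k \<Longrightarrow>
      x l m \<otimes> x k q = x k q \<otimes> x l m"
    and x_triple: "snd l \<in> J \<Longrightarrow> snd m \<in> J \<Longrightarrow> snd k \<in> J \<Longrightarrow>
      snd l \<noteq> snd m \<Longrightarrow> snd k \<noteq> snd m \<Longrightarrow> snd l \<noteq> snd k \<Longrightarrow>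
      x m k \<otimes> x l m = x l m \<otimes> x m k \<otimes> x l k"
    and W_closed: "w \<in> W \<Longrightarrow> w \<in> carrier G"
    and W_mult: "w \<in> W \<Longrightarrow> w' \<in> W \<Longrightarrow> w \<otimes> w' \<in> W"
    and W_one: "\<one> \<in> W"
    and act_letter: "w \<in> W \<Longrightarrow> snd l \<in> J \<Longrightarrow> snd (act w l) \<in> J"
    and act_surj: "w \<in> W \<Longrightarrow> snd l \<in> J \<Longrightarrow> \<exists>k. snd k \<in> J \<and> act w k = l"
    and act_snd: "w \<in> W \<Longrightarrow> snd l \<in> J \<Longrightarrow> snd m \<in> J \<Longrightarrow> snd (act w l) = snd (act w m) \<longleftrightarrow> snd l = snd m"
    and x_act: "w \<in> W \<Longrightarrow> snd l \<in> J \<Longrightarrow> snd m \<in> J \<Longrightarrow> snd l \<noteq> snd m \<Longrightarrow>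
      x (act w l) (act w m) \<otimes> w = w \<otimes> x l m"
    and x_W: "snd l \<in> J \<Longrightarrow> snd m \<in> J \<Longrightarrow> snd l \<noteq> snd m \<Longrightarrow>
      x l (inv_letter m) \<otimes> x m l \<otimes> x l (inv_letter m) \<in> W"
    and v_inv: "g \<in> carrier G \<Longrightarrow> v g (inv_letter l) = - v g l"
    and v_x: "g \<in> carrier G \<Longrightarrow> snd l \<in> J \<Longrightarrow> snd m \<in> J \<Longrightarrow> snd l \<noteq> snd m \<Longrightarrow>
      v (g \<otimes> x l m) l = v g l + v g m"
    and v_x_other: "g \<in> carrier G \<Longrightarrow> snd l \<in> J \<Longrightarrow> snd m \<in> J \<Longrightarrow> snd l \<noteq> snd m \<Longrightarrow>
      snd k \<in> J \<Longrightarrow> snd k \<noteq> snd l \<Longrightarrow> v (g \<otimes> x l m) k = v g k"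
    and v_W: "g \<in> carrier G \<Longrightarrow> w \<in> W \<Longrightarrow> snd l \<in> J \<Longrightarrow> v (g \<otimes> w) l = v g (act w l)"
    and P_subgroup: "subgroup P G"
    and v_P: "p \<in> P \<Longrightarrow> snd l \<in> J \<Longrightarrow> v p l = (if snd l = e then if fst l then 1 else - 1 else 0)"
    and x_P: "snd l \<in> J \<Longrightarrow> snd m \<in> J \<Longrightarrow> snd l \<noteq> snd m \<Longrightarrow> snd m \<noteq> e \<Longrightarrow> x l m \<in> P"
    and W_P: "w \<in> W \<Longrightarrow> act w (True, e) = (True, e) \<Longrightarrow> w \<in> P"
    and e_J: "e \<in> J"
begin

text \<open>
  In an ascending product every transvection increases the l1-norm \<open>N\<close>, so if \<open>v\<close> ends at a unit
  vector no transvection occurs.  All elements are ascending: a descending last step is moved through the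
  product using the Steinberg relations, along vectors of smaller norm.
\<close>

inductive_set ascending :: "'a set" where
  base: "p \<in> P \<Longrightarrow> w \<in> W \<Longrightarrow> p \<otimes> w \<in> ascending"
| up: "g \<in> ascending \<Longrightarrow> snd l \<in> J \<Longrightarrow> snd m \<in> J \<Longrightarrow> snd l \<noteq> snd m \<Longrightarrow>
    v g m > 0 \<Longrightarrow> v g l \<ge> 0 \<Longrightarrow> g \<otimes> x l m \<in> ascending"

definition N :: "'a \<Rightarrow> int" where
  "N g = (\<Sum>i\<in>J. \<bar>v g (True, i)\<bar>)"

lemma P_closed: "p \<in> P \<Longrightarrow> p \<in> carrier G"
  using P_subgroup subgroup.mem_carrier by metis

lemma ascending_closed: "g \<in> ascending \<Longrightarrow> g \<in> carrier G"
  by (induction rule: ascending.induct) (auto simp: P_closed W_closed x_closed)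

lemma letter_eq: "snd a = snd b \<Longrightarrow> a = b \<or> a = inv_letter b"
  by (cases a; cases b) (auto simp: inv_letter_def)

lemma letter_eq_pos:
  "g \<in> carrier G \<Longrightarrow> snd a = snd b \<Longrightarrow> v g a > 0 \<Longrightarrow> v g b > 0 \<Longrightarrow> a = b"
  using letter_eq[of a b] v_inv[of g b] by auto

lemma abs_v: "g \<in> carrier G \<Longrightarrow> \<bar>v g l\<bar> = \<bar>v g (True, snd l)\<bar>"
  using v_inv[of g "(True, snd l)"] by (cases l; cases "fst l") (auto simp: inv_letter_def)

lemma N_x:
  assumes g: "g \<in> carrier G" and lm: "snd l \<in> J" "snd m \<in> J" "snd l \<noteq> snd m"
  shows "N (g \<otimes> x l m) = N g - \<bar>v g l\<bar> + \<bar>v g l + v g m\<bar>"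
proof -
  have gx: "g \<otimes> x l m \<in> carrier G" using g lm x_closed by simp
  have "N (g \<otimes> x l m) = \<bar>v (g \<otimes> x l m) (True, snd l)\<bar> + (\<Sum>i\<in>J - {snd l}. \<bar>v (g \<otimes> x l m) (True, i)\<bar>)"
    unfolding N_def using finite_J lm(1) by (rule sum.remove)
  also have "(\<Sum>i\<in>J - {snd l}. \<bar>v (g \<otimes> x l m) (True, i)\<bar>) = (\<Sum>i\<in>J - {snd l}. \<bar>v g (True, i)\<bar>)"
    by (rule sum.cong) (use v_x_other[OF g lm] in auto)
  also have "\<bar>v (g \<otimes> x l m) (True, snd l)\<bar> = \<bar>v g l + v g m\<bar>"
    using abs_v[OF gx, of l] v_x[OF g lm] by simp
  finally show ?thesis
    unfolding N_def using finite_J lm(1) abs_v[OF g, of l]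
    by (simp add: sum.remove[of J "snd l" "\<lambda>i. \<bar>v g (True, i)\<bar>"])
qed

lemma v_base:
  assumes "p \<in> P" "w \<in> W" "snd l \<in> J" "v (p \<otimes> w) l \<noteq> 0"
  shows "snd (act w l) = e"
  using assms v_W[OF P_closed[OF assms(1)]] v_P[OF assms(1) act_letter[OF assms(2,3)]]
  by (auto split: if_splits simp: P_closed)

lemma N_pos: "N g \<ge> 0"
  unfolding N_def by (simp add: sum_nonneg)

text \<open>An element of \<open>W\<close> is pushed to the left through each up step:
  \<open>x_act\<close> renames the letters of the step and \<open>v_W\<close> carries the sign
  conditions along.\<close>

lemma ascending_W: "g \<in> ascending \<Longrightarrow> w \<in> W \<Longrightarrow> g \<otimes> w \<in> ascending"
proof (induction arbitrary: w rule: ascending.induct)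
  case (base p w')
  then show ?case
    using ascending.base[OF base(1) W_mult[OF base(2,3)]] by (simp add: m_assoc P_closed W_closed)
next
  case (up g l m)
  obtain l' m' where lm: "snd l' \<in> J" "act w l' = l" "snd m' \<in> J" "act w m' = m"
    using act_surj[OF up.prems] up.hyps by metis
  have ne: "snd l' \<noteq> snd m'" using act_snd[OF up.prems lm(1,3)] lm up.hyps by simp
  have g: "g \<in> carrier G" using up ascending_closed by blast
  have "g \<otimes> w \<otimes> x l' m' \<in> ascending"
    using up lm ne v_W[OF g up.prems] by (intro ascending.up) auto
  moreover have "g \<otimes> x l m \<otimes> w = g \<otimes> w \<otimes> x l' m'"
    using x_act[OF up.prems lm(1,3) ne] lm g up.prems ne up.hyps
    by (simp add: m_assoc x_closed W_closed)
  ultimately show ?case by simp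
qed

lemma ascending_cases [consumes 1, case_names base up]:
  assumes g: "g \<in> ascending"
    and "\<And>p w. g = p \<otimes> w \<Longrightarrow> p \<in> P \<Longrightarrow> w \<in> W \<Longrightarrow> thesis"
    and "\<And>h a b. g = h \<otimes> x a b \<Longrightarrow> h \<in> ascending \<Longrightarrow> snd a \<in> J \<Longrightarrow> snd b \<in> J \<Longrightarrow> snd a \<noteq> snd b \<Longrightarrow>
      v h b > 0 \<Longrightarrow> v h a \<ge> 0 \<Longrightarrow> v g a = v h a + v h b \<Longrightarrow> (\<And>k. snd k \<in> J \<Longrightarrow> snd k \<noteq> snd a \<Longrightarrow> v g k = v h k) \<Longrightarrow>
      N g = N h + v h b \<Longrightarrow> thesis"
  shows thesis
  using g
proof (cases rule: ascending.cases)
  case (base p w)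
  then show ?thesis using assms(2) by blast
next
  case (up h l m)
  have h: "h \<in> carrier G" using up ascending_closed by blast
  show ?thesis
    using up v_x[OF h up(3-5)] v_x_other[OF h up(3-5)] N_x[OF h up(3-5)] by (intro assms(3)[of h l m]) auto
qed

section \<open>Absorbing one more transvection into an ascending product, by induction on the
  norm\<close>

context
  fixes g
  assumes g: "g \<in> ascending"
    and IH: "\<And>h l m. h \<in> ascending \<Longrightarrow> N h < N g \<Longrightarrow> snd l \<in> J \<Longrightarrow> snd m \<in> J \<Longrightarrow> snd l \<noteq> snd m \<Longrightarrow>
      h \<otimes> x l m \<in> ascending"
begin

text \<open>Adding a zero entry does not change the norm, so the step can be moved in front of the
  last up step, where the norm is smaller and \<open>IH\<close> applies. In a base product it is
  moved past w and lands in \<open>P\<close>, because a zero entry of a unit vector is not at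
  e.\<close>

lemma ascending_zero:
  assumes lm: "snd l \<in> J" "snd m \<in> J" "snd l \<noteq> snd m" and zero: "v g m = 0"
  shows "g \<otimes> x l m \<in> ascending"
  using g
proof (cases rule: ascending_cases)
  case (base p w)
  have "v p (act w m) = 0" using base v_W[of p w m] lm zero by (simp add: P_closed)
  then have "snd (act w m) \<noteq> e" using v_P[OF base(2) act_letter[OF base(3) lm(2)]] by (auto split: if_splits)
  then have xP: "x (act w l) (act w m) \<in> P"
    using base act_snd act_letter lm by (intro x_P) auto
  then have "p \<otimes> x (act w l) (act w m) \<otimes> w \<in> ascending"
    using base by (intro ascending.base subgroup.m_closed[OF P_subgroup])
  moreover have "p \<otimes> x (act w l) (act w m) \<otimes> w = p \<otimes> w \<otimes> x l m"
    using x_act[of w l m] base lm P_closed[OF xP] by (simp add: m_assoc x_closed W_closed P_closed)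
  ultimately show ?thesis using base by simp
next
  case (up h a b)
  have h: "h \<in> carrier G" "g \<in> carrier G" using up g ascending_closed by blast+
  have ma: "snd m \<noteq> snd a" and mb: "snd m \<noteq> snd b"
  proof -
    have ab: "v g a > 0" "v g b > 0" using up by auto
    show "snd m \<noteq> snd a" using abs_v[OF h(2), of m] abs_v[OF h(2), of a] ab zero by auto
    show "snd m \<noteq> snd b" using abs_v[OF h(2), of m] abs_v[OF h(2), of b] ab zero by auto
  qed
  have vm: "v h m = 0" using up(9)[OF lm(2) ma] zero by simp
  have Nh: "N h < N g" using up by simp
  have c: "x a b \<in> carrier G" "x l m \<in> carrier G" using up lm x_closed by auto
  show ?thesis
  proof (cases "snd l = snd b")
    case False
    have N0: "N (h \<otimes> x l m) = N h" using N_x[OF h(1) lm] vm by simp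
    have 1: "h \<otimes> x l m \<in> ascending" by (rule IH) (use up(2) Nh lm in auto)
    have "h \<otimes> x l m \<otimes> x a b \<in> ascending"
      by (rule IH) (use 1 N0 up(3-5) Nh lm in auto)
    moreover have "x a b \<otimes> x l m = x l m \<otimes> x a b"
      using False up ma lm by (intro x_comm) auto
    ultimately show ?thesis using h c up(1) by (simp add: m_assoc)
  next
    case True
    \<comment> \<open>The sign of m is adapted so that the target becomes the letter b. In the
      rewriting x_ab x_bm' = x_am'^-1 x_bm' x_ab the first two factors on the right both add a zero
      entry, and the norm stays at that of h until the last factor.\<close>
    obtain m' where m': "x l m = x b m'" "snd m' = snd m" "v h m' = 0"
    proof (cases "l = b")
      case True
      then show thesis using that[of m] vm by blast
    next
      case F: False
      then have "l = inv_letter b" using True letter_eq by metis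
      then have "x l m = x b (inv_letter m)"
        using x_inv_left[of b m] x_inv_right[of b m] up True lm by simp
      then show thesis using that[of "inv_letter m"] v_inv[OF h(1), of m] vm by simp
    qed
    have m'J: "snd m' \<in> J" "snd a \<noteq> snd m'" "snd b \<noteq> snd m'" using m' lm ma mb by auto
    have c2: "x b m' \<in> carrier G" "x a m' \<in> carrier G" using up m'J x_closed by auto
    have i: "x a (inv_letter m') = inv (x a m')" using up m'J by (intro x_inv_right) auto
    have v0: "v h (inv_letter m') = 0" using v_inv[OF h(1), of m'] m' by simp
    have 1: "h \<otimes> x a (inv_letter m') \<in> ascending" by (rule IH) (use up(2-5) m'J Nh in auto)
    have N1: "N (h \<otimes> x a (inv_letter m')) = N h"
      using N_x[OF h(1), of a "inv_letter m'"] v0 up m'J by simp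
    have v1: "v (h \<otimes> x a (inv_letter m')) m' = 0"
      using v_x_other[OF h(1), of a "inv_letter m'" m'] m' up m'J by simp
    have 2: "h \<otimes> x a (inv_letter m') \<otimes> x b m' \<in> ascending"
      by (rule IH) (use 1 N1 up(2-5) m'J Nh in auto)
    have N2: "N (h \<otimes> x a (inv_letter m') \<otimes> x b m') = N h"
      using N_x[OF ascending_closed[OF 1], of b m'] v1 up m'J N1 by simp
    have 3: "h \<otimes> x a (inv_letter m') \<otimes> x b m' \<otimes> x a b \<in> ascending"
      by (rule IH) (use 2 N2 up(2-5) Nh in auto)
    have t: "x b m' \<otimes> x a b = x a b \<otimes> x b m' \<otimes> x a m'"
      using up m'J by (intro x_triple) auto
    have k: "x b m' \<otimes> x a m' = x a m' \<otimes> x b m'" "x a b \<otimes> x a m' = x a m' \<otimes> x a b"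
      using up m'J by (intro x_comm; auto)+
    have "inv (x a m') \<otimes> (x b m' \<otimes> x a b) = x a b \<otimes> x b m'"
    proof -
      have "x b m' \<otimes> x a b = x a m' \<otimes> (x a b \<otimes> x b m')"
        unfolding t using c c2 k by (metis m_assoc)
      then show ?thesis using c c2 by (simp add: m_assoc[symmetric])
    qed
    then show ?thesis using 3 i h c c2 up(1) m'(1) by (simp add: m_assoc)
  qed
qed

text \<open>The subtraction cancels the last up step, which added d to c, or is exchanged with it.
  Every exchange writes the two steps as a chain of transvections from h whose norms stay below that
  of g before each step, so \<open>IH\<close> can be applied along the chain. Since all four entries
  of g are positive, l and m agree with c or d as letters as soon as the indices agree.\<close>

lemma ascending_descent:
  assumes lm: "snd l \<in> J" "snd m \<in> J" "snd l \<noteq> snd m" and v: "v g l \<ge> v g m" "v g m > 0"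
  shows "g \<otimes> x l (inv_letter m) \<in> ascending"
  using g
proof (cases rule: ascending_cases)
  case (base p w)
  have "snd (act w l) = e" "snd (act w m) = e"
    using v_base[OF base(2,3) lm(1)] v_base[OF base(2,3) lm(2)] v base(1) by auto
  then show ?thesis using act_snd[OF base(3) lm(1,2)] lm by simp
next
  case (up h c d)
  have h: "h \<in> carrier G" "g \<in> carrier G" using up g ascending_closed by blast+
  have Nh: "N h < N g" using up by simp
  have vd: "v g d = v h d" using up by simp
  have pos: "v g l > 0" "v g c > 0" "v g d > 0" using v up vd by auto
  have same: "snd l = snd c \<longleftrightarrow> l = c" "snd l = snd d \<longleftrightarrow> l = d" "snd m = snd c \<longleftrightarrow> m = c" "snd m = snd d \<longleftrightarrow> m = d"
    using letter_eq_pos[OF h(2), of l c] letter_eq_pos[OF h(2), of l d] letter_eq_pos[OF h(2), of m c]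
      letter_eq_pos[OF h(2), of m d] pos v by auto
  have inv: "x l (inv_letter m) = inv (x l m)" using lm by (rule x_inv_right)
  have im: "snd (inv_letter m) \<in> J" "snd l \<noteq> snd (inv_letter m)" using lm by auto
  have vm': "v k (inv_letter m) = - v k m" if "k \<in> carrier G" for k using v_inv[OF that] .
  have xc: "x l m \<in> carrier G" "x c d \<in> carrier G" "x l (inv_letter m) \<in> carrier G"
    using x_closed lm im up by auto
  consider (same) "l = c" "m = d" | (target) "l = c" "m \<noteq> d" | (disj) "l \<noteq> c" "m \<noteq> c" "l \<noteq> d"
    | (chain1) "l \<noteq> c" "m = c" "l \<noteq> d" | (chain2) "l \<noteq> c" "m \<noteq> c" "l = d" | (opp) "m = c" "l = d"
    by blast
  then show ?thesis
  proof cases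
    case same
    then show ?thesis using up inv h xc by (simp add: m_assoc)
  next
    case disj
    have vl: "v h l = v g l" "v h m = v g m" using up disj same lm by auto
    have 1: "h \<otimes> x l (inv_letter m) \<in> ascending" by (rule IH) (use up(2-5) lm im Nh in auto)
    have N1: "N (h \<otimes> x l (inv_letter m)) < N g"
      using N_x[OF h(1) lm(1) im] vl v vm'[OF h(1)] Nh by simp
    have 2: "h \<otimes> x l (inv_letter m) \<otimes> x c d \<in> ascending" by (rule IH) (use 1 N1 up(3-5) in auto)
    have "x c d \<otimes> x l (inv_letter m) = x l (inv_letter m) \<otimes> x c d"
      using disj same lm im up by (intro x_comm) auto
    then show ?thesis using 2 up(1) h xc by (simp add: m_assoc)
  next
    case target
    have ne: "snd m \<noteq> snd d" "snd m \<noteq> snd c" using target same lm by auto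
    have vh: "v h m = v g m" "v h l = v g l - v g d" using up target ne lm vd by auto
    \<comment> \<open>The two steps commute. After exchanging them, the norm in between stays below
      that of g unless v_m + v_d >= 2 v_l, which forces the three entries to be equal because v_l is
      at least v_m and v_d.\<close>
    show ?thesis
    proof (cases "v g l = v g d \<and> v g l = v g m")
      case False
      have 1: "h \<otimes> x l (inv_letter m) \<in> ascending" by (rule IH) (use up(2-5) lm im Nh in auto)
      have le: "v g d \<le> v g l" using up(7,8) vd target by simp
      have "N (h \<otimes> x l (inv_letter m)) = N h - (v g l - v g d) + \<bar>v g l - v g d - v g m\<bar>"
        using N_x[OF h(1) lm(1) im] vh vm'[OF h(1)] le by simp
      moreover have "N g = N h + v g d" using up(10) vd by simp
      ultimately have N1: "N (h \<otimes> x l (inv_letter m)) < N g"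
        using False le v pos by arith
      have 2: "h \<otimes> x l (inv_letter m) \<otimes> x c d \<in> ascending" by (rule IH) (use 1 N1 up(3-5) in auto)
      have "x c d \<otimes> x l (inv_letter m) = x l (inv_letter m) \<otimes> x c d"
        using target ne lm im up by (intro x_comm) auto
      then show ?thesis using 2 up(1) h xc by (simp add: m_assoc)
    next
      case True
      \<comment> \<open>With equal entries, that at d is cleared first and restored last: x_ld
        x_lm^-1 = x_dm^-1 x_ld x_dm, where the middle factor adds zero to l.\<close>
      have dm: "snd d \<in> J" "snd m \<in> J" "snd d \<noteq> snd m" using up lm ne by auto
      have dm': "snd d \<noteq> snd (inv_letter m)" using dm by simp
      have 1: "h \<otimes> x d (inv_letter m) \<in> ascending" by (rule IH) (use up(2-5) dm dm' im Nh in auto)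
      have c1: "h \<otimes> x d (inv_letter m) \<in> carrier G" using 1 ascending_closed by blast
      have N1: "N (h \<otimes> x d (inv_letter m)) < N g"
        using N_x[OF h(1) dm(1) im(1) dm'] vh True vm'[OF h(1)] vd up by simp
      have v1: "v (h \<otimes> x d (inv_letter m)) d = 0"
        using v_x[OF h(1) dm(1) im(1) dm'] vm'[OF h(1)] vh True vd by simp
      have 2: "h \<otimes> x d (inv_letter m) \<otimes> x l d \<in> ascending"
        by (rule IH) (use 1 N1 up(2-5) target in auto)
      have N2: "N (h \<otimes> x d (inv_letter m) \<otimes> x l d) < N g"
        using N_x[OF c1, of l d] N1 v1 up target by simp
      have 3: "h \<otimes> x d (inv_letter m) \<otimes> x l d \<otimes> x d m \<in> ascending"
        by (rule IH) (use 2 N2 dm in auto)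
      have t: "x d m \<otimes> x l d = x l d \<otimes> x d m \<otimes> x l m"
        using dm lm up target by (intro x_triple) auto
      have c2: "x d m \<in> carrier G" "x l d \<in> carrier G" using x_closed dm up target by auto
      have "x l d \<otimes> x d m = x d m \<otimes> x l d \<otimes> inv (x l m)"
        unfolding t using c2 xc by (simp add: m_assoc)
      then have "inv (x d m) \<otimes> (x l d \<otimes> x d m) = x l d \<otimes> inv (x l m)"
        using c2 xc by (simp add: m_assoc[symmetric])
      moreover have "x d (inv_letter m) = inv (x d m)" using dm by (rule x_inv_right)
      ultimately show ?thesis using 3 up(1) target inv h c2 xc by (simp add: m_assoc)
    qed
  next
    case chain1
    \<comment> \<open>The entry at m receives d and is then taken off l. Equivalently, d and the old
      entry at m are taken off l, and m receives d at the end.\<close>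
    have ne: "snd l \<noteq> snd d" "snd l \<noteq> snd c" using chain1 same lm by auto
    have ld: "snd l \<in> J" "snd d \<in> J" "snd l \<noteq> snd (inv_letter d)" "snd (inv_letter d) \<in> J"
      using lm up ne by auto
    have vh: "v h l = v g l" "v h m = v g m - v g d" using up chain1 ne lm vd by auto
    have vdm: "v g d \<le> v g m" using up vd chain1 by simp
    have vd': "v h (inv_letter d) = - v g d" using v_inv[OF h(1)] vd by simp
    have 1: "h \<otimes> x l (inv_letter d) \<in> ascending" by (rule IH) (use up(2-5) ld Nh in auto)
    have c1: "h \<otimes> x l (inv_letter d) \<in> carrier G" using 1 ascending_closed by blast
    have N1: "N (h \<otimes> x l (inv_letter d)) = N h - v g d"
      using N_x[OF h(1) ld(1,4,3)] vh v vdm pos vd' by simp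
    have v1: "v (h \<otimes> x l (inv_letter d)) l = v g l - v g d" "v (h \<otimes> x l (inv_letter d)) m = v g m - v g d"
      using v_x[OF h(1) ld(1,4,3)] v_x_other[OF h(1) ld(1,4,3), of m] vd' vh lm by auto
    have 2: "h \<otimes> x l (inv_letter d) \<otimes> x l (inv_letter m) \<in> ascending"
      by (rule IH) (use 1 N1 Nh pos lm im in auto)
    have N2: "N (h \<otimes> x l (inv_letter d) \<otimes> x l (inv_letter m)) < N g"
      using N_x[OF c1 lm(1) im] N1 v1 vm'[OF c1] Nh v vdm pos by simp
    have 3: "h \<otimes> x l (inv_letter d) \<otimes> x l (inv_letter m) \<otimes> x m d \<in> ascending"
      by (rule IH) (use 2 N2 chain1 up(2-5) in auto)
    have t: "x m d \<otimes> x l m = x l m \<otimes> x m d \<otimes> x l d"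
      using lm up chain1 ne by (intro x_triple) auto
    have c2: "x m d \<in> carrier G" "x l d \<in> carrier G" using x_closed lm up chain1 ne by auto
    have k: "x m d \<otimes> x l d = x l d \<otimes> x m d" "x l m \<otimes> x l d = x l d \<otimes> x l m"
      using up lm chain1 ne by (intro x_comm; auto)+
    have "x m d \<otimes> inv (x l m) = inv (x l d) \<otimes> inv (x l m) \<otimes> x m d"
    proof -
      have "x l m \<otimes> x l d \<otimes> (x m d \<otimes> inv (x l m)) = x l m \<otimes> (x l d \<otimes> x m d) \<otimes> inv (x l m)"
        using c2 xc by (simp add: m_assoc)
      also have "\<dots> = x m d \<otimes> x l m \<otimes> inv (x l m)"
        unfolding t k(1)[symmetric] using c2 xc by (simp add: m_assoc)
      also have "\<dots> = x m d" using c2 xc by (simp add: m_assoc)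
      finally have "inv (x l m \<otimes> x l d) \<otimes> (x l m \<otimes> x l d \<otimes> (x m d \<otimes> inv (x l m))) = inv (x l m \<otimes> x l d) \<otimes> x m d"
        by simp
      then have "x m d \<otimes> inv (x l m) = inv (x l m \<otimes> x l d) \<otimes> x m d"
        using c2 xc by (simp add: m_assoc inv_mult_group)
      then show ?thesis using c2 xc by (simp add: inv_mult_group)
    qed
    moreover have "x l (inv_letter d) = inv (x l d)" using ld up ne by (intro x_inv_right) auto
    ultimately show ?thesis using 3 up(1) chain1 inv h c2 xc by (simp add: m_assoc)
  next
    case chain2
    \<comment> \<open>The entry at l is added to c and then loses m. Equivalently, l loses m first,
      and c then receives m and the diminished l.\<close>
    have ne: "snd m \<noteq> snd c" "snd l \<noteq> snd c" using chain2 same lm by auto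
    have vh: "v h l = v g l" "v h m = v g m" "v h c = v g c - v g l" using up chain2 ne lm vd by auto
    have 1: "h \<otimes> x l (inv_letter m) \<in> ascending" by (rule IH) (use up(2-5) lm im Nh in auto)
    have c1: "h \<otimes> x l (inv_letter m) \<in> carrier G" using 1 ascending_closed by blast
    have N1: "N (h \<otimes> x l (inv_letter m)) = N h - v g m"
      using N_x[OF h(1) lm(1) im] vh v vm'[OF h(1)] by simp
    have v1: "v (h \<otimes> x l (inv_letter m)) m = v g m" "v (h \<otimes> x l (inv_letter m)) c = v g c - v g l"
      using v_x_other[OF h(1) lm(1) im lm(2)] v_x_other[OF h(1) lm(1) im up(3)] vh lm(3) ne(2) by simp_all
    have cm: "snd c \<in> J" "snd m \<in> J" "snd c \<noteq> snd m" using up lm ne by auto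
    have 2: "h \<otimes> x l (inv_letter m) \<otimes> x c m \<in> ascending"
      by (rule IH) (use 1 N1 Nh v cm in auto)
    have N2: "N (h \<otimes> x l (inv_letter m) \<otimes> x c m) < N g"
      using N_x[OF c1 cm] N1 v1 Nh v up chain2 vd by simp
    have 3: "h \<otimes> x l (inv_letter m) \<otimes> x c m \<otimes> x c l \<in> ascending"
      by (rule IH) (use 2 N2 chain2 up(2-5) in auto)
    have t: "x l m \<otimes> x c l = x c l \<otimes> x l m \<otimes> x c m"
      using lm up chain2 ne by (intro x_triple) auto
    have c2: "x c m \<in> carrier G" "x c l \<in> carrier G" using x_closed cm lm up chain2 by auto
    have k: "x l m \<otimes> x c m = x c m \<otimes> x l m" "x c l \<otimes> x c m = x c m \<otimes> x c l"
      using up lm chain2 ne by (intro x_comm; auto)+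
    have "x c l \<otimes> inv (x l m) = inv (x l m) \<otimes> x c m \<otimes> x c l"
    proof -
      have "x l m \<otimes> (x c l \<otimes> inv (x l m)) = x c l \<otimes> (x l m \<otimes> x c m) \<otimes> inv (x l m)"
        using c2 xc t by (metis inv_closed m_assoc)
      also have "\<dots> = x c m \<otimes> x c l"
        unfolding k(1) using c2 xc k(2) by (simp add: m_assoc)
      finally have "inv (x l m) \<otimes> (x l m \<otimes> (x c l \<otimes> inv (x l m))) = inv (x l m) \<otimes> (x c m \<otimes> x c l)"
        by simp
      then show ?thesis using c2 xc by (simp add: m_assoc)
    qed
    then show ?thesis using 3 up(1) chain2 inv h c2 xc by (simp add: m_assoc)
  next
    case opp
    \<comment> \<open>The two opposite steps are two of the three factors of a Weyl element w, so
      they equal w followed by one transvection. The entry of h at m vanishes because v_m <= v_l in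
      g, and then h w has smaller norm than g.\<close>
    have ml: "snd m \<in> J" "snd l \<in> J" "snd m \<noteq> snd l" using lm by auto
    define w where "w = x m l \<otimes> x l (inv_letter m) \<otimes> x m l"
    have "x l (inv_letter m) = x (inv_letter l) m"
      using inv x_inv_left[OF lm] by simp
    then have w: "w \<in> W" using x_W[of m "inv_letter l"] ml unfolding w_def by simp
    have hw: "h \<otimes> w \<in> ascending" using ascending_W up w by blast
    have Nw: "N (h \<otimes> w) < N g"
    proof -
      have 1: "v g l \<le> v g m" using up opp vd by simp
      have "v h m = 0" "v h l = v g l" using opp up v vd by auto
      have c: "x m l \<in> carrier G" "h \<otimes> x m l \<in> carrier G" "h \<otimes> x m l \<otimes> x l (inv_letter m) \<in> carrier G"
        using h xc opp by auto
      have gx: "g = h \<otimes> x m l" using up opp by simp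
      have "N (h \<otimes> w) = N (g \<otimes> x l (inv_letter m) \<otimes> x m l)"
        unfolding w_def gx using h xc c by (simp add: m_assoc)
      also have "\<dots> = N g - v g l + \<bar>v g l - v g m\<bar> - \<bar>v g m\<bar> + \<bar>v g m + (v g l - v g m)\<bar>"
        using N_x[OF _ ml, of "g \<otimes> x l (inv_letter m)"] N_x[OF h(2) lm(1) im] v_x[OF h(2) lm(1) im]
          v_x_other[OF h(2) lm(1) im, of m] vm'[OF h(2)] h xc pos lm by simp
      finally show ?thesis using 1 v by simp
    qed
    have "h \<otimes> w \<otimes> x m (inv_letter l) \<in> ascending" by (rule IH) (use hw Nw ml in auto)
    moreover have "x m (inv_letter l) = inv (x m l)" using ml by (rule x_inv_right)
    ultimately show ?thesis using up(1) opp h xc unfolding w_def by (simp add: m_assoc)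
  qed
qed

end

text \<open>Changing the signs of l and m together does not change the transvection, so the entry at
  m may be taken to be nonnegative. If it is positive, the step goes up or subtracts from a positive
  entry, and only the subtraction of a larger from a smaller entry is new.\<close>

lemma ascending_x:
  assumes "g \<in> ascending" and lm: "snd l \<in> J" "snd m \<in> J" "snd l \<noteq> snd m"
  shows "g \<otimes> x l m \<in> ascending"
  using assms
proof (induction "nat (N g)" arbitrary: g l m rule: less_induct)
  case less
  have IH: "h \<otimes> x l m \<in> ascending"
    if "h \<in> ascending" "N h < N g" "snd l \<in> J" "snd m \<in> J" "snd l \<noteq> snd m" for h l m
    using less.hyps[of h l m] that N_pos[of h] by simp
  note g = less.prems(1) and lm = less.prems(2-4)
  have gc: "g \<in> carrier G" using g ascending_closed by blast
  have pos: "g \<otimes> x l m \<in> ascending" if lm: "snd l \<in> J" "snd m \<in> J" "snd l \<noteq> snd m" and m: "v g m > 0" for l m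
  proof (cases "v g l \<ge> 0")
    case True
    then show ?thesis using lm m g by (intro ascending.up)
  next
    case False
    define l' where "l' = inv_letter l"
    have l': "snd l' = snd l" "v g l' = - v g l" unfolding l'_def using v_inv[OF gc] by auto
    have xl: "x l m = x l' (inv_letter m)"
      unfolding l'_def using lm x_inv_left[of "inv_letter l" m] x_inv_right[of "inv_letter l" m] by simp
    have l'm: "snd l' \<in> J" "snd l' \<noteq> snd m" using lm l' by auto
    show ?thesis
    proof (cases "v g l' \<ge> v g m")
      case True
      then show ?thesis unfolding xl using ascending_descent[OF g IH] l'm lm m by simp
    next
      case small: False
      \<comment> \<open>The Weyl element w swaps the entries at l' and m up to sign and keeps the
        norm. From x_l'm^-1 = w x_l'm x_ml'^-1, the step after w subtracts the smaller from the
        larger entry, and the remaining one falls under \<open>IH\<close>.\<close>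
      define w where "w = x l' (inv_letter m) \<otimes> x m l' \<otimes> x l' (inv_letter m)"
      have w: "w \<in> W" unfolding w_def using l'm lm by (intro x_W) auto
      have c: "x l' m \<in> carrier G" "x m l' \<in> carrier G" using x_closed l'm lm by auto
      have i: "x l' (inv_letter m) = inv (x l' m)" "x m (inv_letter l') = inv (x m l')"
        using x_inv_right[of l' m] x_inv_right[of m l'] l'm lm by auto
      have gw: "g \<otimes> w = g \<otimes> x l' (inv_letter m) \<otimes> x m l' \<otimes> x l' (inv_letter m)"
        unfolding w_def using gc c i by (simp add: m_assoc)
      have b: "v g l' > 0" "v g l' < v g m" using False l' small by auto
      have im: "snd (inv_letter m) \<in> J" "snd l' \<noteq> snd (inv_letter m)" using lm l'm by auto
      define g1 where "g1 = g \<otimes> x l' (inv_letter m)"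
      have g1: "g1 \<in> carrier G" unfolding g1_def using gc i c by simp
      have v1: "v g1 l' = v g l' - v g m" "v g1 m = v g m" "N g1 = N g - v g l' + v g m - v g l'"
        unfolding g1_def using v_x[OF gc l'm(1) im] v_x_other[OF gc l'm(1) im, of m] N_x[OF gc l'm(1) im]
          v_inv[OF gc, of m] lm l'm b by auto
      define g2 where "g2 = g1 \<otimes> x m l'"
      have g2: "g2 \<in> carrier G" unfolding g2_def using g1 c by simp
      have v2: "v g2 m = v g l'" "v g2 l' = v g l' - v g m" "N g2 = N g1 - v g m + v g l'"
        unfolding g2_def using v_x[OF g1, of m l'] v_x_other[OF g1, of m l' l'] N_x[OF g1, of m l'] v1 b lm l'm
        by auto
      define g3 where "g3 = g2 \<otimes> x l' (inv_letter m)"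
      have g3: "g3 \<in> carrier G" unfolding g3_def using g2 c i by simp
      have v3: "v g3 m = v g l'" "v g3 l' = - v g m" "N g3 = N g"
        unfolding g3_def using v_x[OF g2 l'm(1) im] v_x_other[OF g2 l'm(1) im, of m] N_x[OF g2 l'm(1) im]
          v_inv[OF g2, of m] v1 v2 b lm l'm by auto
      have g3w: "g3 = g \<otimes> w" unfolding g3_def g2_def g1_def gw ..
      have g3a: "g3 \<in> ascending" unfolding g3w using ascending_W[OF g w] .
      have "g3 \<otimes> x (inv_letter l') (inv_letter m) \<in> ascending"
        using g3a IH v3 lm l'm b v_inv[OF g3, of l'] by (intro ascending_descent) auto
      moreover have "x (inv_letter l') (inv_letter m) = x l' m"
        using x_inv_left[of l' "inv_letter m"] im l'm i c by simp
      ultimately have 4: "g3 \<otimes> x l' m \<in> ascending" by simp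
      have N4: "N (g3 \<otimes> x l' m) < N g" using N_x[OF g3, of l' m] v3 lm l'm b by simp
      have "g3 \<otimes> x l' m \<otimes> x m (inv_letter l') \<in> ascending"
        by (rule IH[OF 4 N4]) (use lm l'm in auto)
      moreover have "g3 \<otimes> x l' m \<otimes> x m (inv_letter l') = g \<otimes> x l m"
        unfolding g3w xl w_def i using gc c by (simp add: m_assoc)
      ultimately show ?thesis by simp
    qed
  qed
  consider "v g m > 0" | "v g m = 0" | "v g m < 0" by linarith
  then show ?case
  proof cases
    case 1
    then show ?thesis using pos lm by blast
  next
    case 2
    then show ?thesis using ascending_zero[OF g IH] lm by blast
  next
    case 3
    have "g \<otimes> x (inv_letter l) (inv_letter m) \<in> ascending"
      using 3 v_inv[OF gc, of m] lm by (intro pos) auto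
    moreover have "x (inv_letter l) (inv_letter m) = x l m"
      using x_inv_left[of l "inv_letter m"] x_inv_right[of l m] x_closed[of l m] lm by simp
    ultimately show ?thesis by simp
  qed
qed

text \<open>Every generated element is ascending. After an up step there are positive entries at two
  different indices, which a unit vector lacks, so the element is a base product, and there w has to
  fix the letter at e.\<close>

theorem stabilizer_subset:
  assumes g: "g \<in> generate G ({x l m |l m. snd l \<in> J \<and> snd m \<in> J \<and> snd l \<noteq> snd m} \<union> W)"
    and W_inv: "\<And>w. w \<in> W \<Longrightarrow> inv w \<in> W"
    and v: "v g (True, e) = 1" "\<And>l. snd l \<in> J \<Longrightarrow> snd l \<noteq> e \<Longrightarrow> v g l = 0"
  shows "g \<in> P"
proof -
  let ?S = "{x l m |l m. snd l \<in> J \<and> snd m \<in> J \<and> snd l \<noteq> snd m} \<union> W"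
  have S: "?S \<subseteq> carrier G" using x_closed W_closed by auto
  have Sinv: "inv s \<in> ?S" if s: "s \<in> ?S" for s
  proof (cases "s \<in> W")
    case True
    then show ?thesis using W_inv by blast
  next
    case False
    then obtain l m where "s = x l m" and lm: "snd l \<in> J" "snd m \<in> J" "snd l \<noteq> snd m"
      using s by blast
    then have "inv s = x l (inv_letter m)" using x_inv_right by simp
    moreover have "snd (inv_letter m) \<in> J" "snd l \<noteq> snd (inv_letter m)" using lm by auto
    ultimately show ?thesis using lm(1) by blast
  qed
  have step: "h \<otimes> s \<in> ascending" if "h \<in> ascending" "s \<in> ?S" for h s
    using that ascending_x ascending_W by blast
  have "h \<otimes> y \<in> ascending" if "h \<in> ascending" "y \<in> generate G ?S" for h y
    using that(2,1)
  proof (induction arbitrary: h)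
    case one
    then show ?case using ascending_closed by simp
  next
    case (incl s)
    then show ?case using step by blast
  next
    case (inv s)
    then show ?case using step Sinv by blast
  next
    case (eng y z)
    then have "h \<otimes> y \<otimes> z \<in> ascending" by blast
    moreover have "y \<in> carrier G" "z \<in> carrier G" "h \<in> carrier G"
      using generate_in_carrier[OF S] eng ascending_closed by blast+
    ultimately show ?case by (simp add: m_assoc)
  qed
  moreover have "\<one> \<in> ascending"
    using ascending.base[OF subgroup.one_closed[OF P_subgroup] W_one] by simp
  ultimately have "\<one> \<otimes> g \<in> ascending" using g by blast
  then have "g \<in> ascending" using generate_in_carrier[OF S g] by simp
  then show ?thesis
  proof (cases rule: ascending_cases)
    case (base p w)
    have "v p (act w (True, e)) = 1" using v(1) base v_W[of p w "(True, e)"] e_J P_closed by auto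
    then have "act w (True, e) = (True, e)"
      using v_P[OF base(2), of "act w (True, e)"] act_letter[OF base(3), of "(True, e)"] e_J
      by (cases "act w (True, e)") (auto split: if_splits)
    then show ?thesis using base W_P subgroup.m_closed[OF P_subgroup] by blast
  next
    case (up h a b)
    have "v g a > 0" "v g b > 0" using up by auto
    then have "snd a = e" "snd b = e" using v(2)[OF up(3)] v(2)[OF up(4)] by auto
    then show ?thesis using up by simp
  qed
qed

end

section \<open>The Johnson filtration\<close>

context free_group_aut
begin

abbreviation L :: "nat \<Rightarrow> nat word set" where "L \<equiv> lower_central F"
abbreviation J :: "nat \<Rightarrow> (nat word \<Rightarrow> nat word) set" where "J \<equiv> johnson F"

lemma L_closed: "w \<in> L k \<Longrightarrow> w \<in> carrier F"
  by (rule F.lower_central_closed)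

lemma johnson_iff: "\<phi> \<in> J k \<longleftrightarrow> \<phi> \<in> auto F \<and> (\<forall>x\<in>carrier F. \<phi> x \<otimes>\<^bsub>F\<^esub> inv\<^bsub>F\<^esub> x \<in> L k)"
proof (cases "\<phi> \<in> auto F")
  case True
  interpret N: normal "L k" F by (rule F.lower_central_normal)
  have N: "\<phi> ` L k = L k" using F.characteristic_lower_central True by (simp add: characteristic_def)
  have car: "carrier (F Mod L k) = (\<lambda>a. L k #>\<^bsub>F\<^esub> a) ` carrier F"
    by (auto simp: FactGroup_def RCOSETS_def)
  have "\<phi> \<in> J k \<longleftrightarrow> induced_aut F (L k) \<phi> = (\<lambda>C\<in>carrier (F Mod L k). C)"
    using True unfolding johnson_def kernel_def by (simp add: AutoGroup_def BijGroup_def)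
  also have "\<dots> \<longleftrightarrow> (\<forall>C\<in>carrier (F Mod L k). induced_aut F (L k) \<phi> C = C)"
    by (auto simp: fun_eq_iff induced_aut_def restrict_def)
  also have "\<dots> \<longleftrightarrow> (\<forall>a\<in>carrier F. L k #>\<^bsub>F\<^esub> \<phi> a = L k #>\<^bsub>F\<^esub> a)"
    unfolding car using N.induced_aut_coset[OF True N] by simp
  also have "\<dots> \<longleftrightarrow> (\<forall>x\<in>carrier F. \<phi> x \<otimes>\<^bsub>F\<^esub> inv\<^bsub>F\<^esub> x \<in> L k)"
    using F.coset_eq_iff[OF F.lower_central_normal auto_apply_closed[OF True]] by blast
  finally show ?thesis using True by blast
next
  case False
  then show ?thesis unfolding johnson_def kernel_def by simp
qed

lemma johnson_auto [simp]: "\<phi> \<in> J k \<Longrightarrow> \<phi> \<in> auto F"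
  using johnson_iff by blast

lemma johnsonD: "\<phi> \<in> J k \<Longrightarrow> x \<in> carrier F \<Longrightarrow> \<phi> x \<otimes>\<^bsub>F\<^esub> inv\<^bsub>F\<^esub> x \<in> L k"
  using johnson_iff by blast

lemma johnson_normal: "J k \<lhd> A"
proof -
  have "induced_aut F (L k) \<in> hom A (AutoGroup (F Mod L k))"
    by (rule F.induced_aut_hom[OF F.characteristic_lower_central])
  moreover have "group (AutoGroup (F Mod L k))"
    using group.AutoGroup[OF normal.factorgroup_is_group[OF F.lower_central_normal]] .
  ultimately interpret group_hom A "AutoGroup (F Mod L k)" "induced_aut F (L k)"
    by (simp add: group_hom.intro group_hom_axioms.intro A.is_group)
  show ?thesis unfolding johnson_def by (rule normal_kernel)
qed

lemma johnson_subgroup: "subgroup (J k) A"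
  using johnson_normal normal_imp_subgroup by blast

lemma johnson_antimono: "i \<le> j \<Longrightarrow> J j \<subseteq> J i"
  using F.lower_central_antimono[of i j] johnson_iff by blast

text \<open>The normal subgroup is left general because this serves both for the lower central
  series and for [K, K].\<close>

lemma hom_cong_mod:
  assumes N: "N \<lhd> F" and \<phi>: "\<phi> \<in> hom F F"
    and gens: "\<And>i. i < n \<Longrightarrow> \<phi> (gen i) \<otimes>\<^bsub>F\<^esub> inv\<^bsub>F\<^esub> gen i \<in> N"
    and x: "x \<in> carrier F"
  shows "\<phi> x \<otimes>\<^bsub>F\<^esub> inv\<^bsub>F\<^esub> x \<in> N"
proof -
  interpret \<phi>: group_hom F F \<phi> using group_hom_free_group[OF F.is_group \<phi>] .
  interpret h: group_hom F "F Mod N" "\<lambda>x. N #>\<^bsub>F\<^esub> x" by (rule F.coset_group_hom[OF N])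
  have "(\<lambda>x. N #>\<^bsub>F\<^esub> \<phi> x) \<in> hom F (F Mod N)" "(\<lambda>x. N #>\<^bsub>F\<^esub> x) \<in> hom F (F Mod N)"
    using Group.hom_compose[OF \<phi> h.homh] h.homh by (simp_all add: comp_def)
  moreover have "\<exists>l. snd l = i \<and> N #>\<^bsub>F\<^esub> \<phi> [l] = N #>\<^bsub>F\<^esub> [l]" if "i \<in> {..<n}" for i
    using gens[of i] that F.coset_eq_iff[OF N \<phi>.hom_closed[of "gen i"], of "gen i"]
    by (intro exI[of _ "(True, i)"]) simp
  ultimately have "N #>\<^bsub>F\<^esub> \<phi> x = N #>\<^bsub>F\<^esub> x"
    using free_group_hom_eqI[OF h.H.is_group _ _ _ x] by blast
  then show ?thesis using F.coset_eq_iff[OF N \<phi>.hom_closed[OF x] x] by simp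
qed

lemma johnsonI:
  assumes "\<phi> \<in> auto F" "\<And>i. i < n \<Longrightarrow> \<phi> (gen i) \<otimes>\<^bsub>F\<^esub> inv\<^bsub>F\<^esub> gen i \<in> L k"
  shows "\<phi> \<in> J k"
  using assms hom_cong_mod[OF F.lower_central_normal auto_hom[OF assms(1)]] by (auto simp: johnson_iff)

lemma subgroup_cong_mod:
  assumes N: "N \<lhd> F" and \<phi>: "\<phi> \<in> auto F"
  shows "subgroup {x \<in> carrier F. \<phi> x \<otimes>\<^bsub>F\<^esub> inv\<^bsub>F\<^esub> x \<in> N} F"
proof -
  interpret h: group_hom F "F Mod N" "\<lambda>x. N #>\<^bsub>F\<^esub> x" by (rule F.coset_group_hom[OF N])
  have eq: "{x \<in> carrier F. \<phi> x \<otimes>\<^bsub>F\<^esub> inv\<^bsub>F\<^esub> x \<in> N} = {x \<in> carrier F. N #>\<^bsub>F\<^esub> \<phi> x = N #>\<^bsub>F\<^esub> x}"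
    using F.coset_eq_iff[OF N auto_apply_closed[OF \<phi>]] by blast
  show ?thesis
    unfolding eq
  proof (rule F.subgroupI)
    have "\<one>\<^bsub>F\<^esub> \<in> {x \<in> carrier F. N #>\<^bsub>F\<^esub> \<phi> x = N #>\<^bsub>F\<^esub> x}" using auto_one[OF \<phi>] by simp
    then show "{x \<in> carrier F. N #>\<^bsub>F\<^esub> \<phi> x = N #>\<^bsub>F\<^esub> x} \<noteq> {}" by blast
  qed (auto simp: auto_inv[OF \<phi>] auto_mult[OF \<phi>] auto_apply_closed[OF \<phi>])
qed

lemma johnson_coset:
  assumes "\<phi> \<in> J k" "x \<in> carrier F"
  shows "\<phi> x = (\<phi> x \<otimes>\<^bsub>F\<^esub> inv\<^bsub>F\<^esub> x) \<otimes>\<^bsub>F\<^esub> x"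
  using assms auto_apply_closed[OF johnson_auto] by (simp add: F.m_assoc)

text \<open>With \<phi> a = e a and \<phi> r = s r, bilinearity reduces [e a, s r] to [a, r] modulo
  level j+2. The term with s is deep because s is one level deeper than r, the term [e, r] because e
  lies in the commutator subgroup.\<close>

lemma torelli_trivial_on_graded:
  assumes \<phi>: "\<phi> \<in> J (Suc 0)" and x: "x \<in> L j"
  shows "\<phi> x \<otimes>\<^bsub>F\<^esub> inv\<^bsub>F\<^esub> x \<in> L (Suc j)"
  using x
proof (induction j arbitrary: x)
  case 0
  then show ?case using johnsonD[OF \<phi>] by simp
next
  case (Suc j)
  let ?N = "L (Suc (Suc j))"
  note N = F.lower_central_normal[of "Suc (Suc j)"]
  have \<phi>a: "\<phi> \<in> auto F" using \<phi> by simp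
  note cl = auto_apply_closed[OF \<phi>a]
  interpret h: group_hom F "F Mod ?N" "\<lambda>x. ?N #>\<^bsub>F\<^esub> x" by (rule F.coset_group_hom[OF N])
  have "L (Suc j) \<subseteq> {x \<in> carrier F. \<phi> x \<otimes>\<^bsub>F\<^esub> inv\<^bsub>F\<^esub> x \<in> ?N}"
  proof (rule F.lower_central_Suc_least[OF subgroup_cong_mod[OF N \<phi>a]])
    fix a r assume a: "a \<in> carrier F" and r: "r \<in> L j"
    have rc: "r \<in> carrier F" using r by (rule L_closed)
    define e s where "e = \<phi> a \<otimes>\<^bsub>F\<^esub> inv\<^bsub>F\<^esub> a" and "s = \<phi> r \<otimes>\<^bsub>F\<^esub> inv\<^bsub>F\<^esub> r"
    have e: "e \<in> L (Suc 0)" "e \<in> carrier F" and s: "s \<in> L (Suc j)" "s \<in> carrier F"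
      unfolding e_def s_def using johnsonD[OF \<phi> a] Suc.IH[OF r] L_closed by auto
    have sj: "s \<in> L j" using s F.lower_central_Suc_subset by blast
    have eq: "\<phi> a = e \<otimes>\<^bsub>F\<^esub> a" "\<phi> r = s \<otimes>\<^bsub>F\<^esub> r"
      unfolding e_def s_def using a rc cl by (simp_all add: F.m_assoc)
    have ea: "e \<otimes>\<^bsub>F\<^esub> a \<in> carrier F" using e a by simp
    have "\<phi> (gcomm F a r) = gcomm F (e \<otimes>\<^bsub>F\<^esub> a) (s \<otimes>\<^bsub>F\<^esub> r)"
      using group_hom.hom_gcomm[OF auto_group_hom[OF \<phi>a] a rc] eq by simp
    then have "?N #>\<^bsub>F\<^esub> \<phi> (gcomm F a r) =
        (?N #>\<^bsub>F\<^esub> gcomm F (e \<otimes>\<^bsub>F\<^esub> a) s) \<otimes>\<^bsub>F Mod ?N\<^esub> (?N #>\<^bsub>F\<^esub> gcomm F (e \<otimes>\<^bsub>F\<^esub> a) r)"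
      using hom_mult[OF F.gcomm_right_hom[OF ea, of j], of s r] sj r by simp
    also have "?N #>\<^bsub>F\<^esub> gcomm F (e \<otimes>\<^bsub>F\<^esub> a) s = \<one>\<^bsub>F Mod ?N\<^esub>"
      using F.coset_one_iff[OF N] F.gcomm_lower_central[OF ea s(1)] ea s by simp
    also have "?N #>\<^bsub>F\<^esub> gcomm F (e \<otimes>\<^bsub>F\<^esub> a) r =
        (?N #>\<^bsub>F\<^esub> gcomm F e r) \<otimes>\<^bsub>F Mod ?N\<^esub> (?N #>\<^bsub>F\<^esub> gcomm F a r)"
      using hom_mult[OF F.gcomm_left_hom[OF r], of e a] e a by simp
    also have "?N #>\<^bsub>F\<^esub> gcomm F e r = \<one>\<^bsub>F Mod ?N\<^esub>"
      using F.coset_one_iff[OF N] F.gcomm_commutator_lower_central[OF e(1) r] e rc by simp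
    finally have "?N #>\<^bsub>F\<^esub> \<phi> (gcomm F a r) = ?N #>\<^bsub>F\<^esub> gcomm F a r" using a rc by simp
    then show "gcomm F a r \<in> {x \<in> carrier F. \<phi> x \<otimes>\<^bsub>F\<^esub> inv\<^bsub>F\<^esub> x \<in> ?N}"
      using F.coset_eq_iff[OF N cl, of "gcomm F a r" "gcomm F a r"] a rc by simp
  qed
  then show ?case using Suc.prems by blast
qed

text \<open>Each correction term in [e a, f b], with e and f in \<open>L k\<close>, is a commutator
  with an element of \<open>L k\<close> and so vanishes modulo \<open>L (Suc k)\<close>.\<close>

lemma johnson_trivial_on_commutators:
  assumes \<phi>: "\<phi> \<in> J k" and x: "x \<in> L (Suc 0)"
  shows "\<phi> x \<otimes>\<^bsub>F\<^esub> inv\<^bsub>F\<^esub> x \<in> L (Suc k)"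
proof -
  let ?N = "L (Suc k)"
  note N = F.lower_central_normal[of "Suc k"]
  have \<phi>a: "\<phi> \<in> auto F" using \<phi> by simp
  note cl = auto_apply_closed[OF \<phi>a]
  interpret h: group_hom F "F Mod ?N" "\<lambda>x. ?N #>\<^bsub>F\<^esub> x" by (rule F.coset_group_hom[OF N])
  have "L (Suc 0) \<subseteq> {x \<in> carrier F. \<phi> x \<otimes>\<^bsub>F\<^esub> inv\<^bsub>F\<^esub> x \<in> ?N}"
  proof (rule F.lower_central_Suc_least[OF subgroup_cong_mod[OF N \<phi>a]])
    fix a b assume a: "a \<in> carrier F" and "b \<in> L 0"
    then have b: "b \<in> carrier F" by simp
    define e f where "e = \<phi> a \<otimes>\<^bsub>F\<^esub> inv\<^bsub>F\<^esub> a" and "f = \<phi> b \<otimes>\<^bsub>F\<^esub> inv\<^bsub>F\<^esub> b"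
    have e: "e \<in> L k" "e \<in> carrier F" and f: "f \<in> L k" "f \<in> carrier F"
      unfolding e_def f_def using johnsonD[OF \<phi>] a b L_closed by auto
    have eq: "\<phi> a = e \<otimes>\<^bsub>F\<^esub> a" "\<phi> b = f \<otimes>\<^bsub>F\<^esub> b"
      unfolding e_def f_def using a b cl by (simp_all add: F.m_assoc)
    have one: "?N #>\<^bsub>F\<^esub> gcomm F e y = \<one>\<^bsub>F Mod ?N\<^esub>" "?N #>\<^bsub>F\<^esub> gcomm F f y = \<one>\<^bsub>F Mod ?N\<^esub>"
      "?N #>\<^bsub>F\<^esub> gcomm F y f = \<one>\<^bsub>F Mod ?N\<^esub>" if "y \<in> carrier F" for y
      using that e f F.coset_one_iff[OF N] F.gcomm_lower_central'[OF that] F.gcomm_lower_central[OF that] by auto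
    have "\<phi> (gcomm F a b) = gcomm F (e \<otimes>\<^bsub>F\<^esub> a) (f \<otimes>\<^bsub>F\<^esub> b)"
      using group_hom.hom_gcomm[OF auto_group_hom[OF \<phi>a] a b] eq by simp
    then have "?N #>\<^bsub>F\<^esub> \<phi> (gcomm F a b) = ?N #>\<^bsub>F\<^esub> gcomm F a (f \<otimes>\<^bsub>F\<^esub> b)"
      using F.gcomm_mult_left[of e a "f \<otimes>\<^bsub>F\<^esub> b"] one a b e f by simp
    also have "\<dots> = ?N #>\<^bsub>F\<^esub> gcomm F a b"
      using F.gcomm_mult_right[of a f b] one a b f by simp
    finally show "gcomm F a b \<in> {x \<in> carrier F. \<phi> x \<otimes>\<^bsub>F\<^esub> inv\<^bsub>F\<^esub> x \<in> ?N}"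
      using F.coset_eq_iff[OF N cl, of "gcomm F a b" "gcomm F a b"] a b by simp
  qed
  then show ?thesis using x by blast
qed

text \<open>With \<psi> x = e x and \<phi> x = d x, both composites send x to e d x modulo
  \<open>L (Suc k)\<close>: \<phi> fixes the class of e in \<open>L k\<close>, \<psi> fixes that of
  d because d is in the commutator subgroup, and e is central there.\<close>

lemma gcomm_johnson:
  assumes \<phi>: "\<phi> \<in> J (Suc 0)" and \<psi>: "\<psi> \<in> J k"
  shows "gcomm A \<phi> \<psi> \<in> J (Suc k)"
proof -
  let ?N = "L (Suc k)"
  note N = F.lower_central_normal[of "Suc k"]
  interpret h: group_hom F "F Mod ?N" "\<lambda>x. ?N #>\<^bsub>F\<^esub> x" by (rule F.coset_group_hom[OF N])
  have aut: "\<phi> \<in> auto F" "\<psi> \<in> auto F" using \<phi> \<psi> by auto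
  note cl = auto_apply_closed[OF aut(1)] auto_apply_closed[OF aut(2)]
  have main: "?N #>\<^bsub>F\<^esub> \<phi> (\<psi> x) = ?N #>\<^bsub>F\<^esub> \<psi> (\<phi> x)" if x: "x \<in> carrier F" for x
  proof -
    define e d where "e = \<psi> x \<otimes>\<^bsub>F\<^esub> inv\<^bsub>F\<^esub> x" and "d = \<phi> x \<otimes>\<^bsub>F\<^esub> inv\<^bsub>F\<^esub> x"
    have e: "e \<in> L k" "e \<in> carrier F" and d: "d \<in> L (Suc 0)" "d \<in> carrier F"
      unfolding e_def d_def using johnsonD[OF \<phi> x] johnsonD[OF \<psi> x] L_closed by auto
    have eq: "\<psi> x = e \<otimes>\<^bsub>F\<^esub> x" "\<phi> x = d \<otimes>\<^bsub>F\<^esub> x"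
      unfolding e_def d_def using x cl by (simp_all add: F.m_assoc)
    have 1: "?N #>\<^bsub>F\<^esub> \<phi> e = ?N #>\<^bsub>F\<^esub> e"
      using torelli_trivial_on_graded[OF \<phi> e(1)] F.coset_eq_iff[OF N cl(1)[OF e(2)] e(2)] by simp
    have 2: "?N #>\<^bsub>F\<^esub> \<psi> d = ?N #>\<^bsub>F\<^esub> d"
      using johnson_trivial_on_commutators[OF \<psi> d(1)] F.coset_eq_iff[OF N cl(2)[OF d(2)] d(2)] by simp
    have 3: "(?N #>\<^bsub>F\<^esub> e) \<otimes>\<^bsub>F Mod ?N\<^esub> (?N #>\<^bsub>F\<^esub> d) = (?N #>\<^bsub>F\<^esub> d) \<otimes>\<^bsub>F Mod ?N\<^esub> (?N #>\<^bsub>F\<^esub> e)"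
      using F.gcomm_lower_central'[OF d(2) e(1)] by (intro F.coset_commute[OF N e(2) d(2)])
    have "?N #>\<^bsub>F\<^esub> \<phi> (\<psi> x) = ?N #>\<^bsub>F\<^esub> (\<phi> e \<otimes>\<^bsub>F\<^esub> (d \<otimes>\<^bsub>F\<^esub> x))"
      unfolding eq(1) auto_mult[OF aut(1) e(2) x] eq(2) ..
    also have "\<dots> = (?N #>\<^bsub>F\<^esub> e) \<otimes>\<^bsub>F Mod ?N\<^esub> (?N #>\<^bsub>F\<^esub> d) \<otimes>\<^bsub>F Mod ?N\<^esub> (?N #>\<^bsub>F\<^esub> x)"
      using 1 cl(1)[OF e(2)] e d x by (simp add: h.H.m_assoc)
    also have "\<dots> = ?N #>\<^bsub>F\<^esub> (\<psi> d \<otimes>\<^bsub>F\<^esub> (e \<otimes>\<^bsub>F\<^esub> x))"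
      unfolding 3 using 2 cl(2)[OF d(2)] e d x by (simp add: h.H.m_assoc)
    also have "\<dots> = ?N #>\<^bsub>F\<^esub> \<psi> (\<phi> x)"
      unfolding eq(2) auto_mult[OF aut(2) d(2) x] eq(1) ..
    finally show ?thesis .
  qed
  have ca: "gcomm A \<phi> \<psi> \<in> auto F" using A.gcomm_closed[of \<phi> \<psi>] aut by simp
  have "gcomm A \<phi> \<psi> y \<otimes>\<^bsub>F\<^esub> inv\<^bsub>F\<^esub> y \<in> ?N" if y: "y \<in> carrier F" for y
  proof -
    define x where "x = (inv\<^bsub>A\<^esub> (\<psi> \<otimes>\<^bsub>A\<^esub> \<phi>)) y"
    have pp: "\<psi> \<otimes>\<^bsub>A\<^esub> \<phi> \<in> auto F" using aut by simp
    have x: "x \<in> carrier F" unfolding x_def using auto_apply_closed[OF A_closed(2)[OF pp] y] .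
    have yx: "y = \<psi> (\<phi> x)" using A_inv_apply(2)[OF pp y] x aut unfolding x_def[symmetric] by simp
    have "gcomm A \<phi> \<psi> \<otimes>\<^bsub>A\<^esub> (\<psi> \<otimes>\<^bsub>A\<^esub> \<phi>) = \<phi> \<otimes>\<^bsub>A\<^esub> \<psi>"
      using aut by (simp add: gcomm_def A.m_assoc)
    then have "gcomm A \<phi> \<psi> y = \<phi> (\<psi> x)"
      using yx A_apply[OF ca pp x] A_apply[OF aut x] A_apply[OF aut(2,1) x] by simp
    then have "?N #>\<^bsub>F\<^esub> gcomm A \<phi> \<psi> y = ?N #>\<^bsub>F\<^esub> y" using main[OF x] yx by simp
    then show ?thesis using F.coset_eq_iff[OF N auto_apply_closed[OF ca y] y] by simp
  qed
  then show ?thesis using ca by (simp add: johnson_iff)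
qed

lemma gcomm_subgroup_eq:
  assumes "subgroup H A" "x \<in> H" "y \<in> H"
  shows "gcomm (A\<lparr>carrier := H\<rparr>) x y = gcomm A x y"
  using A.m_inv_consistent[OF assms(1)] assms by (simp add: gcomm_def)

text \<open>The shift by one comes from the numbering: the term of index 0 is I itself, which is
  \<open>J 1\<close>.\<close>

lemma lower_central_torelli: "lower_central (A\<lparr>carrier := J (Suc 0)\<rparr>) i \<subseteq> J (Suc i)"
proof (induction i)
  case 0
  then show ?case by simp
next
  case (Suc i)
  let ?G = "A\<lparr>carrier := J (Suc 0)\<rparr>"
  interpret G: group ?G by (rule subgroup.subgroup_is_group[OF johnson_subgroup A.is_group])
  have "subgroup (J (Suc (Suc i))) ?G"
    using johnson_subgroup johnson_antimono by (intro A.subgroup_incl) auto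
  then show ?case
  proof (rule G.lower_central_Suc_least)
    fix a r assume "a \<in> carrier ?G" "r \<in> lower_central ?G i"
    then have ar: "a \<in> J (Suc 0)" "r \<in> J (Suc i)" "r \<in> J (Suc 0)"
      using Suc johnson_antimono[of "Suc 0" "Suc i"] by auto
    then show "gcomm ?G a r \<in> J (Suc (Suc i))"
      using gcomm_johnson gcomm_subgroup_eq[OF johnson_subgroup] by simp
  qed
qed

text \<open>Interpolates between \<open>J k\<close> and \<open>J (Suc k)\<close> one basis element
  at a time, so that each quotient embeds into a single copy of L_k/L_{k+1} rather than into its
  n-th power.\<close>

definition partial_johnson :: "nat \<Rightarrow> nat \<Rightarrow> (nat word \<Rightarrow> nat word) set" where
  "partial_johnson k i = {\<phi> \<in> J k. \<forall>j<i. \<phi> (gen j) \<otimes>\<^bsub>F\<^esub> inv\<^bsub>F\<^esub> gen j \<in> L (Suc k)}"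

lemma partial_johnson_0: "partial_johnson k 0 = J k"
  by (simp add: partial_johnson_def)

lemma partial_johnson_n: "partial_johnson k n = J (Suc k)"
proof
  show "partial_johnson k n \<subseteq> J (Suc k)"
    unfolding partial_johnson_def using johnsonI johnson_auto by blast
  show "J (Suc k) \<subseteq> partial_johnson k n"
    unfolding partial_johnson_def using johnsonD johnson_antimono[of k "Suc k"] by (auto simp: subset_iff)
qed

text \<open>One coordinate of the Johnson homomorphism. The element to compute is \<phi>(e) d, where
  \<phi> fixes the class of e because e lies in \<open>L k\<close>.\<close>

lemma johnson_hom:
  assumes k: "k \<ge> 1" and i: "i < n" and \<phi>: "\<phi> \<in> J k" and \<psi>: "\<psi> \<in> J k"
  shows "L (Suc k) #>\<^bsub>F\<^esub> ((\<phi> \<otimes>\<^bsub>A\<^esub> \<psi>) (gen i) \<otimes>\<^bsub>F\<^esub> inv\<^bsub>F\<^esub> gen i) =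
    (L (Suc k) #>\<^bsub>F\<^esub> (\<phi> (gen i) \<otimes>\<^bsub>F\<^esub> inv\<^bsub>F\<^esub> gen i)) \<otimes>\<^bsub>F Mod L (Suc k)\<^esub>
    (L (Suc k) #>\<^bsub>F\<^esub> (\<psi> (gen i) \<otimes>\<^bsub>F\<^esub> inv\<^bsub>F\<^esub> gen i))"
proof -
  let ?N = "L (Suc k)"
  note N = F.lower_central_normal[of "Suc k"]
  interpret h: group_hom F "F Mod ?N" "\<lambda>x. ?N #>\<^bsub>F\<^esub> x" by (rule F.coset_group_hom[OF N])
  have \<phi>1: "\<phi> \<in> J (Suc 0)" using \<phi> johnson_antimono[of "Suc 0" k] k by auto
  have aut: "\<phi> \<in> auto F" "\<psi> \<in> auto F" using \<phi> \<psi> by auto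
  have x: "gen i \<in> carrier F" using i by simp
  define e d where "e = \<psi> (gen i) \<otimes>\<^bsub>F\<^esub> inv\<^bsub>F\<^esub> gen i" and "d = \<phi> (gen i) \<otimes>\<^bsub>F\<^esub> inv\<^bsub>F\<^esub> gen i"
  have e: "e \<in> L k" "e \<in> carrier F" and d: "d \<in> L k" "d \<in> carrier F"
    unfolding e_def d_def using johnsonD[OF \<phi> x] johnsonD[OF \<psi> x] L_closed by auto
  have eq: "\<psi> (gen i) = e \<otimes>\<^bsub>F\<^esub> gen i"
    unfolding e_def using x auto_apply_closed[OF aut(2) x] by (simp add: F.m_assoc)
  have 1: "?N #>\<^bsub>F\<^esub> \<phi> e = ?N #>\<^bsub>F\<^esub> e"
    using torelli_trivial_on_graded[OF \<phi>1 e(1)] F.coset_eq_iff[OF N auto_apply_closed[OF aut(1) e(2)] e(2)] by simp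
  have "(\<phi> \<otimes>\<^bsub>A\<^esub> \<psi>) (gen i) \<otimes>\<^bsub>F\<^esub> inv\<^bsub>F\<^esub> gen i = \<phi> e \<otimes>\<^bsub>F\<^esub> d"
    unfolding A_apply[OF aut x] eq auto_mult[OF aut(1) e(2) x] d_def
    using auto_apply_closed[OF aut(1)] e x by (simp add: F.m_assoc)
  then have "?N #>\<^bsub>F\<^esub> ((\<phi> \<otimes>\<^bsub>A\<^esub> \<psi>) (gen i) \<otimes>\<^bsub>F\<^esub> inv\<^bsub>F\<^esub> gen i) = (?N #>\<^bsub>F\<^esub> e) \<otimes>\<^bsub>F Mod ?N\<^esub> (?N #>\<^bsub>F\<^esub> d)"
    using 1 auto_apply_closed[OF aut(1) e(2)] d by simp
  also have "\<dots> = (?N #>\<^bsub>F\<^esub> d) \<otimes>\<^bsub>F Mod ?N\<^esub> (?N #>\<^bsub>F\<^esub> e)"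
    using F.gcomm_lower_central[OF e(2) d(1)] by (intro F.coset_commute[OF N e(2) d(2)])
  finally show ?thesis unfolding e_def d_def .
qed

lemma partial_johnson_subgroup:
  assumes k: "k \<ge> 1" and i: "i \<le> n"
  shows "subgroup (partial_johnson k i) A"
proof -
  let ?N = "L (Suc k)"
  note N = F.lower_central_normal[of "Suc k"]
  let ?G = "A\<lparr>carrier := J k\<rparr>"
  interpret h: group_hom F "F Mod ?N" "\<lambda>x. ?N #>\<^bsub>F\<^esub> x" by (rule F.coset_group_hom[OF N])
  interpret G: group ?G by (rule subgroup.subgroup_is_group[OF johnson_subgroup A.is_group])
  have cl: "\<phi> (gen j) \<otimes>\<^bsub>F\<^esub> inv\<^bsub>F\<^esub> gen j \<in> carrier F" if "\<phi> \<in> J k" "j < n" for \<phi> j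
    using that johnsonD[OF that(1), of "gen j"] L_closed by simp
  have hom: "group_hom ?G (F Mod ?N) (\<lambda>\<phi>. ?N #>\<^bsub>F\<^esub> (\<phi> (gen j) \<otimes>\<^bsub>F\<^esub> inv\<^bsub>F\<^esub> gen j))" if j: "j < n" for j
    using johnson_hom[OF k j] h.hom_closed[OF cl] j
    by (intro group_hom.intro group_hom_axioms.intro G.is_group h.H.is_group) (auto simp: hom_def)
  \<comment> \<open>The case i = 0 is kept apart: the empty intersection is not
    \<open>J k\<close>.\<close>
  have "subgroup (\<Inter>j\<in>{..<i}. kernel ?G (F Mod ?N) (\<lambda>\<phi>. ?N #>\<^bsub>F\<^esub> (\<phi> (gen j) \<otimes>\<^bsub>F\<^esub> inv\<^bsub>F\<^esub> gen j))) ?G" if "i > 0"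
    using that i group_hom.subgroup_kernel[OF hom] by (intro G.subgroups_Inter) auto
  moreover have "(\<Inter>j\<in>{..<i}. kernel ?G (F Mod ?N) (\<lambda>\<phi>. ?N #>\<^bsub>F\<^esub> (\<phi> (gen j) \<otimes>\<^bsub>F\<^esub> inv\<^bsub>F\<^esub> gen j))) = partial_johnson k i"
    if "i > 0"
  proof (rule Set.set_eqI)
    fix \<phi>
    have ker: "?N #>\<^bsub>F\<^esub> (\<phi> (gen j) \<otimes>\<^bsub>F\<^esub> inv\<^bsub>F\<^esub> gen j) = \<one>\<^bsub>F Mod ?N\<^esub> \<longleftrightarrow> \<phi> (gen j) \<otimes>\<^bsub>F\<^esub> inv\<^bsub>F\<^esub> gen j \<in> ?N"
      if "\<phi> \<in> J k" "j < i" for j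
      using that i by (intro F.coset_one_iff[OF N cl]) auto
    have "\<phi> \<in> (\<Inter>j\<in>{..<i}. kernel ?G (F Mod ?N) (\<lambda>\<phi>. ?N #>\<^bsub>F\<^esub> (\<phi> (gen j) \<otimes>\<^bsub>F\<^esub> inv\<^bsub>F\<^esub> gen j))) \<longleftrightarrow>
        \<phi> \<in> J k \<and> (\<forall>j<i. ?N #>\<^bsub>F\<^esub> (\<phi> (gen j) \<otimes>\<^bsub>F\<^esub> inv\<^bsub>F\<^esub> gen j) = \<one>\<^bsub>F Mod ?N\<^esub>)"
      unfolding kernel_def using that by simp blast
    also have "\<dots> \<longleftrightarrow> \<phi> \<in> partial_johnson k i"
      unfolding partial_johnson_def mem_Collect_eq using ker by blast
    finally show "\<phi> \<in> (\<Inter>j\<in>{..<i}. kernel ?G (F Mod ?N) (\<lambda>\<phi>. ?N #>\<^bsub>F\<^esub> (\<phi> (gen j) \<otimes>\<^bsub>F\<^esub> inv\<^bsub>F\<^esub> gen j))) \<longleftrightarrow>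
        \<phi> \<in> partial_johnson k i" .
  qed
  ultimately have "subgroup (partial_johnson k i) ?G" if "i > 0" using that by simp
  then show ?thesis
    using A.incl_subgroup[OF johnson_subgroup] johnson_subgroup partial_johnson_0 by (cases "i = 0") auto
qed

text \<open>A covering by finitely many translates of M H', formulated for sets so that stages can
  be composed without treating M H' as a group.\<close>

definition finite_over :: "(nat word \<Rightarrow> nat word) set \<Rightarrow> (nat word \<Rightarrow> nat word) set \<Rightarrow> (nat word \<Rightarrow> nat word) set \<Rightarrow> bool" where
  "finite_over M H H' \<longleftrightarrow> (\<exists>R. finite R \<and> R \<subseteq> auto F \<and>
    (\<forall>h\<in>H. \<exists>\<mu>\<in>M. \<exists>z\<in>H'. \<exists>r\<in>R. h = \<mu> \<otimes>\<^bsub>A\<^esub> z \<otimes>\<^bsub>A\<^esub> r))"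

lemma finite_over_trans:
  assumes M: "subgroup M A" and "finite_over M H H'" "finite_over M H' H''" and H'': "H'' \<subseteq> auto F"
  shows "finite_over M H H''"
proof -
  obtain R where R: "finite R" "R \<subseteq> auto F" "\<forall>h\<in>H. \<exists>\<mu>\<in>M. \<exists>z\<in>H'. \<exists>r\<in>R. h = \<mu> \<otimes>\<^bsub>A\<^esub> z \<otimes>\<^bsub>A\<^esub> r"
    using assms(2) unfolding finite_over_def by (elim exE conjE) (rule that)
  obtain S where S: "finite S" "S \<subseteq> auto F" "\<forall>h\<in>H'. \<exists>\<mu>\<in>M. \<exists>z\<in>H''. \<exists>r\<in>S. h = \<mu> \<otimes>\<^bsub>A\<^esub> z \<otimes>\<^bsub>A\<^esub> r"
    using assms(3) unfolding finite_over_def by (elim exE conjE) (rule that)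
  let ?T = "(\<lambda>(s, r). s \<otimes>\<^bsub>A\<^esub> r) ` (S \<times> R)"
  have "\<exists>\<mu>\<in>M. \<exists>z\<in>H''. \<exists>r\<in>?T. h = \<mu> \<otimes>\<^bsub>A\<^esub> z \<otimes>\<^bsub>A\<^esub> r" if h: "h \<in> H" for h
  proof -
    obtain \<mu> z r where 1: "\<mu> \<in> M" "z \<in> H'" "r \<in> R" "h = \<mu> \<otimes>\<^bsub>A\<^esub> z \<otimes>\<^bsub>A\<^esub> r" using bspec[OF R(3) h] by (elim bexE) (rule that)
    obtain \<mu>' z' s where 2: "\<mu>' \<in> M" "z' \<in> H''" "s \<in> S" "z = \<mu>' \<otimes>\<^bsub>A\<^esub> z' \<otimes>\<^bsub>A\<^esub> s" using bspec[OF S(3) 1(2)] by (elim bexE) (rule that)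
    have c: "\<mu> \<in> carrier A" "\<mu>' \<in> carrier A" "z' \<in> carrier A" "s \<in> carrier A" "r \<in> carrier A"
      using subgroup.mem_carrier[OF M 1(1)] subgroup.mem_carrier[OF M 2(1)]
        subsetD[OF H'' 2(2)] subsetD[OF S(2) 2(3)] subsetD[OF R(2) 1(3)] by simp_all
    have "h = (\<mu> \<otimes>\<^bsub>A\<^esub> \<mu>') \<otimes>\<^bsub>A\<^esub> z' \<otimes>\<^bsub>A\<^esub> (s \<otimes>\<^bsub>A\<^esub> r)"
      unfolding 1(4) 2(4) using c by (simp only: A.m_assoc A.m_closed)
    moreover have "\<mu> \<otimes>\<^bsub>A\<^esub> \<mu>' \<in> M" using subgroup.m_closed[OF M 1(1) 2(1)] .
    moreover have "s \<otimes>\<^bsub>A\<^esub> r \<in> ?T" using 1(3) 2(3) by (auto intro!: rev_image_eqI[of "(s, r)"])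
    ultimately show ?thesis using 2(2) by blast
  qed
  moreover have "finite ?T" "?T \<subseteq> auto F"
    using R(1) S(1) A_closed(1)[OF subsetD[OF S(2)] subsetD[OF R(2)]] by auto
  ultimately show ?thesis
    unfolding finite_over_def by (intro exI[of _ ?T] conjI ballI)
qed

text \<open>The coordinate map at x_i goes to the image of \<open>L k\<close> in F/L_{k+1}, which is
  abelian and finitely generated, and its kernel on one stage of the filtration is contained in the
  next stage.\<close>

lemma finite_over_partial:
  assumes M: "subgroup M A" and k: "k \<ge> 1" and i: "i < n"
    and tors: "\<And>\<phi>. \<phi> \<in> J (Suc 0) \<Longrightarrow> \<exists>m>0::nat. \<phi> [^]\<^bsub>A\<^esub> m \<in> M"
  shows "finite_over M (partial_johnson k i) (partial_johnson k (Suc i))"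
proof -
  let ?N = "L (Suc k)"
  note N = F.lower_central_normal[of "Suc k"]
  let ?h = "\<lambda>x. ?N #>\<^bsub>F\<^esub> x"
  interpret h: group_hom F "F Mod ?N" ?h by (rule F.coset_group_hom[OF N])
  let ?B = "(F Mod ?N)\<lparr>carrier := ?h ` L k\<rparr>"
  have B: "subgroup (?h ` L k) (F Mod ?N)"
    by (rule h.subgroup_img_is_subgroup[OF F.lower_central_subgroup])
  interpret B: group ?B by (rule subgroup.subgroup_is_group[OF B h.H.is_group])
  have comm: "comm_group ?B"
  proof (rule B.group_comm_groupI)
    fix x y assume "x \<in> carrier ?B" "y \<in> carrier ?B"
    then obtain a b where ab: "a \<in> L k" "x = ?h a" "b \<in> L k" "y = ?h b" by auto
    then show "x \<otimes>\<^bsub>?B\<^esub> y = y \<otimes>\<^bsub>?B\<^esub> x"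
      using F.coset_commute[OF N L_closed[OF ab(1)] L_closed[OF ab(3)]
          F.gcomm_lower_central[OF L_closed[OF ab(1)] ab(3)]] by simp
  qed
  define \<tau> where "\<tau> \<phi> = ?h (\<phi> (gen i) \<otimes>\<^bsub>F\<^esub> inv\<^bsub>F\<^esub> gen i)" for \<phi>
  have sub: "partial_johnson k i \<subseteq> J k" by (auto simp: partial_johnson_def)
  have \<tau>: "\<tau> \<phi> \<in> ?h ` L k" if "\<phi> \<in> J k" for \<phi>
    unfolding \<tau>_def using johnsonD[OF that, of "gen i"] i by simp
  have hom: "\<tau> \<in> hom (A\<lparr>carrier := partial_johnson k i\<rparr>) ?B"
  proof (rule homI)
    fix \<phi> \<psi> assume "\<phi> \<in> carrier (A\<lparr>carrier := partial_johnson k i\<rparr>)" "\<psi> \<in> carrier (A\<lparr>carrier := partial_johnson k i\<rparr>)"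
    then have "\<phi> \<in> J k" "\<psi> \<in> J k" using sub by auto
    then show "\<tau> (\<phi> \<otimes>\<^bsub>A\<lparr>carrier := partial_johnson k i\<rparr>\<^esub> \<psi>) = \<tau> \<phi> \<otimes>\<^bsub>?B\<^esub> \<tau> \<psi>"
      using johnson_hom[OF k i] unfolding \<tau>_def by simp
  next
    fix \<phi> assume "\<phi> \<in> carrier (A\<lparr>carrier := partial_johnson k i\<rparr>)"
    then show "\<tau> \<phi> \<in> carrier ?B" using \<tau> sub by auto
  qed
  have genF: "generate F (gen ` {..<n}) = carrier F" by (rule free_group_generated)
  have gc: "gen ` {..<n} \<subseteq> carrier F" by auto
  obtain S where S: "finite S" "S \<subseteq> L k" "L k \<subseteq> generate F (S \<union> ?N)"
    using F.lower_central_fg[OF _ gc genF, of k] by blast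
  have SN: "S \<union> ?N \<subseteq> carrier F" using S(2) L_closed by blast
  have hS: "?h ` S \<subseteq> carrier ?B" using S(2) by auto
  have "?h ` L k \<subseteq> generate (F Mod ?N) (?h ` (S \<union> ?N))"
    unfolding h.generate_img[OF SN] using S(3) by blast
  also have "\<dots> \<subseteq> generate (F Mod ?N) (?h ` S)"
  proof (rule h.H.generate_subgroup_incl)
    have "?h ` S \<subseteq> carrier (F Mod ?N)" using S(2) L_closed by auto
    then show "subgroup (generate (F Mod ?N) (?h ` S)) (F Mod ?N)" by (rule h.H.generate_is_subgroup)
    have "?h x \<in> generate (F Mod ?N) (?h ` S)" if "x \<in> ?N" for x
      using F.coset_one_iff[OF N L_closed[OF that]] that generate.one[of "F Mod ?N" "?h ` S"] by simp
    then show "?h ` (S \<union> ?N) \<subseteq> generate (F Mod ?N) (?h ` S)"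
      using generate.incl[of _ "?h ` S" "F Mod ?N"] by blast
  qed
  also have "\<dots> = generate ?B (?h ` S)"
    using h.H.generate_consistent[OF _ B] S(2) by (metis image_mono)
  finally have "?h ` L k \<subseteq> generate ?B (?h ` S)" .
  then have genB: "\<tau> ` partial_johnson k i \<subseteq> generate ?B (?h ` S)"
    by (intro image_subsetI) (rule subsetD, assumption, rule \<tau>, rule subsetD[OF sub])
  have tors': "\<exists>m>0::nat. \<phi> [^]\<^bsub>A\<^esub> m \<in> M" if "\<phi> \<in> partial_johnson k i" for \<phi>
    using tors[of \<phi>] that sub johnson_antimono[of "Suc 0" k] k by auto
  have H: "subgroup (partial_johnson k i) A" using partial_johnson_subgroup k i by simp
  obtain R where R: "finite R" "R \<subseteq> partial_johnson k i" "\<forall>h\<in>partial_johnson k i.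
      \<exists>\<mu>\<in>M \<inter> partial_johnson k i. \<exists>z\<in>partial_johnson k i. \<exists>r\<in>R. \<tau> z = \<one>\<^bsub>?B\<^esub> \<and> h = \<mu> \<otimes>\<^bsub>A\<^esub> z \<otimes>\<^bsub>A\<^esub> r"
  proof -
    have "\<exists>R. finite R \<and> R \<subseteq> partial_johnson k i \<and> (\<forall>h\<in>partial_johnson k i.
      \<exists>\<mu>\<in>M \<inter> partial_johnson k i. \<exists>z\<in>partial_johnson k i. \<exists>r\<in>R. \<tau> z = \<one>\<^bsub>?B\<^esub> \<and> h = \<mu> \<otimes>\<^bsub>A\<^esub> z \<otimes>\<^bsub>A\<^esub> r)"
      by (rule A.finite_cosets_torsion_hom[OF H M comm hom finite_imageI[OF S(1)] hS genB tors'])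
    then show thesis by (elim exE conjE) (rule that)
  qed
  have "z \<in> partial_johnson k (Suc i)" if z: "z \<in> partial_johnson k i" "\<tau> z = \<one>\<^bsub>?B\<^esub>" for z
  proof -
    have "z (gen i) \<otimes>\<^bsub>F\<^esub> inv\<^bsub>F\<^esub> gen i \<in> L k" using z(1) sub johnsonD[of z k "gen i"] i by auto
    then have "z (gen i) \<otimes>\<^bsub>F\<^esub> inv\<^bsub>F\<^esub> gen i \<in> ?N"
      using F.coset_one_iff[OF N L_closed] z(2) unfolding \<tau>_def by simp
    then show ?thesis using z(1) unfolding partial_johnson_def by (auto simp: less_Suc_eq)
  qed
  then have "\<exists>\<mu>\<in>M. \<exists>z\<in>partial_johnson k (Suc i). \<exists>r\<in>R. h = \<mu> \<otimes>\<^bsub>A\<^esub> z \<otimes>\<^bsub>A\<^esub> r" if hP: "h \<in> partial_johnson k i" for h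
  proof -
    obtain \<mu> z r where "\<mu> \<in> M \<inter> partial_johnson k i" "z \<in> partial_johnson k i" "r \<in> R" "\<tau> z = \<one>\<^bsub>?B\<^esub>"
      and h: "h = \<mu> \<otimes>\<^bsub>A\<^esub> z \<otimes>\<^bsub>A\<^esub> r"
      using bspec[OF R(3) hP] by (elim bexE conjE) (rule that)
    then show ?thesis unfolding h using \<open>\<And>z. z \<in> partial_johnson k i \<Longrightarrow> \<tau> z = \<one>\<^bsub>?B\<^esub> \<Longrightarrow> z \<in> partial_johnson k (Suc i)\<close> by blast
  qed
  moreover have "R \<subseteq> auto F" using R(2) sub johnson_auto by blast
  ultimately show ?thesis unfolding finite_over_def using R(1) by blast
qed

lemma finite_over_johnson:
  assumes M: "subgroup M A" and k: "k \<ge> 1"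
    and tors: "\<And>\<phi>. \<phi> \<in> J (Suc 0) \<Longrightarrow> \<exists>m>0::nat. \<phi> [^]\<^bsub>A\<^esub> m \<in> M"
  shows "finite_over M (J (Suc 0)) (J k)"
proof -
  have refl: "finite_over M H H" if "H \<subseteq> auto F" for H
  proof -
    have "\<forall>h\<in>H. \<exists>\<mu>\<in>M. \<exists>z\<in>H. \<exists>r\<in>{\<one>\<^bsub>A\<^esub>}. h = \<mu> \<otimes>\<^bsub>A\<^esub> z \<otimes>\<^bsub>A\<^esub> r"
    proof
      fix h assume h: "h \<in> H"
      then have "h = \<one>\<^bsub>A\<^esub> \<otimes>\<^bsub>A\<^esub> h \<otimes>\<^bsub>A\<^esub> \<one>\<^bsub>A\<^esub>" using subsetD[OF that h] by simp
      then show "\<exists>\<mu>\<in>M. \<exists>z\<in>H. \<exists>r\<in>{\<one>\<^bsub>A\<^esub>}. h = \<mu> \<otimes>\<^bsub>A\<^esub> z \<otimes>\<^bsub>A\<^esub> r"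
        using h subgroup.one_closed[OF M] by blast
    qed
    then show ?thesis unfolding finite_over_def using A_closed(3) by (intro exI[of _ "{\<one>\<^bsub>A\<^esub>}"]) simp
  qed
  have autJ: "J j \<subseteq> auto F" for j using johnson_auto by blast
  have autP: "partial_johnson j i \<subseteq> auto F" for j i using autJ by (auto simp: partial_johnson_def)
  have step: "finite_over M (J j) (J (Suc j))" if j: "j \<ge> 1" for j
  proof -
    have "finite_over M (J j) (partial_johnson j i)" if "i \<le> n" for i
      using that
    proof (induction i)
      case 0
      then show ?case using refl[OF autJ] by (simp add: partial_johnson_0)
    next
      case (Suc i)
      then show ?case
        using finite_over_trans[OF M _ finite_over_partial[OF M j _ tors] autP] by simp
    qed
    then show ?thesis using partial_johnson_n by (metis order_refl)
  qed
  show ?thesis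
    using k
  proof (induction k rule: dec_induct)
    case base
    then show ?case using refl[OF autJ] by simp
  next
    case (step j)
    then show ?case using finite_over_trans[OF M _ _ autJ] \<open>\<And>j. j \<ge> 1 \<Longrightarrow> _\<close> by blast
  qed
qed

end

section \<open>Torsion classes in the Torelli group\<close>

locale homological = free_group_aut n for n +
  fixes K :: "nat word set" and k :: nat
  assumes n3: "n \<ge> 3" and k1: "k \<ge> 1"
    and K_char: "characteristic K F" and K_finite: "finite (rcosets\<^bsub>F\<^esub> K)"
begin

abbreviation FK :: "nat word monoid" where "FK \<equiv> F\<lparr>carrier := K\<rparr>"
abbreviation \<rho> :: "(nat word \<Rightarrow> nat word) \<Rightarrow> nat word set \<Rightarrow> nat word set" where "\<rho> \<equiv> homological_rep F K"
abbreviation KK :: "nat word set" where "KK \<equiv> derived F K"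

lemma K_normal: "K \<lhd> F"
  by (rule F.characteristic_imp_normal[OF K_char])

lemma K_subgroup: "subgroup K F"
  using K_normal normal_imp_subgroup by blast

lemma K_closed: "x \<in> K \<Longrightarrow> x \<in> carrier F"
  using K_subgroup subgroup.mem_carrier by metis

lemma KK_normal: "KK \<lhd> F"
  by (rule F.derived_is_normal[OF K_normal])

lemma KK_FK: "derived FK K = KK"
  by (rule F.derived_consistent[OF subset_refl K_subgroup])

lemma gcomm_KK: "x \<in> K \<Longrightarrow> y \<in> K \<Longrightarrow> gcomm F x y \<in> KK"
  unfolding derived_def gcomm_def by (intro generate.incl) blast

lemma group_FK: "group FK"
  by (rule subgroup.subgroup_is_group[OF K_subgroup F.is_group])

lemma rho_group_hom: "group_hom A (GL_H1 FK) \<rho>"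
proof -
  interpret FK: group FK by (rule group_FK)
  have "derived FK (carrier FK) \<lhd> FK" by (rule FK.derived_self_is_normal)
  then have "group (H1 FK)" unfolding H1_def by (rule normal.factorgroup_is_group)
  then have "group (GL_H1 FK)" by (rule group.AutoGroup)
  then show ?thesis
    by (intro group_hom.intro group_hom_axioms.intro A.is_group F.homological_rep_hom[OF K_char])
qed

sublocale \<rho>: group_hom A "GL_H1 FK" \<rho>
  by (rule rho_group_hom)

lemma rho_one:
  assumes \<phi>: "\<phi> \<in> auto F" and triv: "\<And>x. x \<in> K \<Longrightarrow> \<phi> x \<otimes>\<^bsub>F\<^esub> inv\<^bsub>F\<^esub> x \<in> KK"
  shows "\<rho> \<phi> = \<one>\<^bsub>GL_H1 FK\<^esub>"
proof -
  interpret FK: group FK by (rule group_FK)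
  have c: "derived FK (carrier FK) = KK" using KK_FK by simp
  have char: "characteristic KK FK" using FK.characteristic_derived c by simp
  interpret N: normal KK FK by (rule FK.characteristic_imp_normal[OF char])
  have r: "restrict \<phi> K \<in> auto FK"
    using hom_in_carrier[OF F.restrict_hom[OF K_char], of \<phi>] \<phi> by (simp add: carrier_AutoGroup)
  have rN: "restrict \<phi> K ` KK = KK" using char r unfolding characteristic_def by blast
  have eq: "induced_aut FK KK (restrict \<phi> K) C = C" if C: "C \<in> carrier (FK Mod KK)" for C
  proof -
    obtain a where a: "a \<in> K" "C = KK #>\<^bsub>FK\<^esub> a" using C by (auto simp: FactGroup_def RCOSETS_def)
    have \<phi>a: "\<phi> a \<in> K" using autoD(3)[OF r] a(1) by auto
    have "KK #>\<^bsub>FK\<^esub> \<phi> a = KK #>\<^bsub>FK\<^esub> a"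
      using FK.coset_eq_iff[OF N.normal_axioms, of "\<phi> a" a] triv[OF a(1)] a \<phi>a F.m_inv_consistent[OF K_subgroup] by simp
    then show ?thesis using N.induced_aut_coset[OF r rN, of a] a by simp
  qed
  have "\<rho> \<phi> = (\<lambda>C\<in>carrier (FK Mod KK). C)"
    unfolding homological_rep_def KK_FK using eq
    by (auto simp: fun_eq_iff restrict_def induced_aut_def)
  also have "\<dots> = \<one>\<^bsub>GL_H1 FK\<^esub>"
    unfolding H1_def c by (simp add: AutoGroup_def BijGroup_def)
  finally show ?thesis .
qed

definition expo :: nat where "expo = order (F Mod K)"

lemma expo: "expo > 0" "x \<in> carrier F \<Longrightarrow> x [^]\<^bsub>F\<^esub> expo \<in> K"
proof -
  interpret h: group_hom F "F Mod K" "\<lambda>x. K #>\<^bsub>F\<^esub> x" by (rule F.coset_group_hom[OF K_normal])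
  have "finite (carrier (F Mod K))" using K_finite by (simp add: FactGroup_def)
  then show "expo > 0" unfolding expo_def using h.H.order_gt_0_iff_finite by blast
  assume x: "x \<in> carrier F"
  have "(K #>\<^bsub>F\<^esub> x) [^]\<^bsub>F Mod K\<^esub> expo = \<one>\<^bsub>F Mod K\<^esub>"
    unfolding expo_def using h.hom_closed[OF x] by (rule h.H.pow_order_eq_1)
  then show "x [^]\<^bsub>F\<^esub> expo \<in> K" using F.coset_one_iff[OF K_normal, of "x [^]\<^bsub>F\<^esub> expo"] x by (simp add: h.hom_nat_pow)
qed

text \<open>Equivalently the product of I_k with the part of the kernel of rho in I. The quotient
  I/\<open>M\<close> is isomorphic to rho(I)/rho(I_k), the group whose finiteness is
  claimed.\<close>

definition M :: "(nat word \<Rightarrow> nat word) set" where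
  "M = {\<phi> \<in> J (Suc 0). \<rho> \<phi> \<in> \<rho> ` J k}"

lemma rho_J_subgroup: "subgroup (\<rho> ` J k) (GL_H1 FK)"
  by (rule \<rho>.subgroup_img_is_subgroup[OF johnson_subgroup])

lemma M_normal: "M \<lhd> A"
proof (rule A.normal_invI)
  show "subgroup M A"
  proof (rule A.subgroupI)
    show "M \<subseteq> carrier A" unfolding M_def carrier_A using johnson_auto by blast
    have "\<one>\<^bsub>A\<^esub> \<in> M"
      unfolding M_def using subgroup.one_closed[OF johnson_subgroup] by blast
    then show "M \<noteq> {}" by blast
    fix \<phi> assume "\<phi> \<in> M"
    then have \<phi>: "\<phi> \<in> J (Suc 0)" "\<rho> \<phi> \<in> \<rho> ` J k" unfolding M_def by blast+
    have "\<rho> (inv\<^bsub>A\<^esub> \<phi>) \<in> \<rho> ` J k"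
      using \<rho>.hom_inv[of \<phi>] subgroup.m_inv_closed[OF rho_J_subgroup \<phi>(2)] \<phi>(1) by simp
    then show "inv\<^bsub>A\<^esub> \<phi> \<in> M"
      unfolding M_def using subgroup.m_inv_closed[OF johnson_subgroup \<phi>(1)] by blast
  next
    fix \<phi> \<psi> assume "\<phi> \<in> M" "\<psi> \<in> M"
    then have \<phi>: "\<phi> \<in> J (Suc 0)" "\<rho> \<phi> \<in> \<rho> ` J k" and \<psi>: "\<psi> \<in> J (Suc 0)" "\<rho> \<psi> \<in> \<rho> ` J k"
      unfolding M_def by blast+
    have "\<rho> (\<phi> \<otimes>\<^bsub>A\<^esub> \<psi>) \<in> \<rho> ` J k"
      using \<rho>.hom_mult[of \<phi> \<psi>] subgroup.m_closed[OF rho_J_subgroup \<phi>(2) \<psi>(2)] \<phi>(1) \<psi>(1) by simp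
    then show "\<phi> \<otimes>\<^bsub>A\<^esub> \<psi> \<in> M"
      unfolding M_def using subgroup.m_closed[OF johnson_subgroup \<phi>(1) \<psi>(1)] by blast
  qed
next
  fix \<alpha> \<phi> assume \<alpha>: "\<alpha> \<in> carrier A" and "\<phi> \<in> M"
  then obtain \<psi> where \<phi>: "\<phi> \<in> J (Suc 0)" and \<psi>: "\<psi> \<in> J k" "\<rho> \<phi> = \<rho> \<psi>" unfolding M_def by blast
  have c: "\<phi> \<in> carrier A" "\<psi> \<in> carrier A" using \<phi> \<psi> by simp_all
  have "\<alpha> \<otimes>\<^bsub>A\<^esub> \<phi> \<otimes>\<^bsub>A\<^esub> inv\<^bsub>A\<^esub> \<alpha> \<in> J (Suc 0)" "\<alpha> \<otimes>\<^bsub>A\<^esub> \<psi> \<otimes>\<^bsub>A\<^esub> inv\<^bsub>A\<^esub> \<alpha> \<in> J k"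
    using normal.inv_op_closed2[OF johnson_normal \<alpha>] \<phi> \<psi> by auto
  moreover have "\<rho> (\<alpha> \<otimes>\<^bsub>A\<^esub> \<phi> \<otimes>\<^bsub>A\<^esub> inv\<^bsub>A\<^esub> \<alpha>) = \<rho> (\<alpha> \<otimes>\<^bsub>A\<^esub> \<psi> \<otimes>\<^bsub>A\<^esub> inv\<^bsub>A\<^esub> \<alpha>)"
    using \<alpha> c \<psi>(2) by (simp only: \<rho>.hom_mult \<rho>.hom_inv A.m_closed A.inv_closed)
  ultimately show "\<alpha> \<otimes>\<^bsub>A\<^esub> \<phi> \<otimes>\<^bsub>A\<^esub> inv\<^bsub>A\<^esub> \<alpha> \<in> M" unfolding M_def by blast
qed

lemma M_subgroup: "subgroup M A"
  using M_normal normal_imp_subgroup by blast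

lemma M_subset: "M \<subseteq> J (Suc 0)"
  unfolding M_def by blast

lemma J_subset_M: "J k \<subseteq> M"
  unfolding M_def using johnson_antimono[of "Suc 0" k] k1 by auto

lemma M_I:
  assumes "\<phi> \<in> J (Suc 0)" "\<psi> \<in> J k" "\<And>x. x \<in> K \<Longrightarrow> (\<phi> \<otimes>\<^bsub>A\<^esub> inv\<^bsub>A\<^esub> \<psi>) x \<otimes>\<^bsub>F\<^esub> inv\<^bsub>F\<^esub> x \<in> KK"
  shows "\<phi> \<in> M"
proof -
  have c: "\<phi> \<in> auto F" "\<psi> \<in> auto F" using assms by simp_all
  have "\<rho> (\<phi> \<otimes>\<^bsub>A\<^esub> inv\<^bsub>A\<^esub> \<psi>) = \<one>\<^bsub>GL_H1 FK\<^esub>"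
    by (rule rho_one) (use c assms(3) in simp_all)
  then have "\<rho> \<phi> \<otimes>\<^bsub>GL_H1 FK\<^esub> inv\<^bsub>GL_H1 FK\<^esub> \<rho> \<psi> = \<one>\<^bsub>GL_H1 FK\<^esub>"
    using c \<rho>.hom_mult[of \<phi> "inv\<^bsub>A\<^esub> \<psi>"] \<rho>.hom_inv[of \<psi>] by (simp del: \<rho>.hom_mult)
  then have "\<rho> \<phi> = \<rho> \<psi>"
    using \<rho>.hom_closed[of \<phi>] \<rho>.hom_closed[of \<psi>] c \<rho>.H.inv_solve_right'[of "\<one>\<^bsub>GL_H1 FK\<^esub>" "\<rho> \<phi>" "\<rho> \<psi>"] by simp
  then show ?thesis unfolding M_def using assms by blast
qed

text \<open>Killing x_i retracts F onto the free group on the other generators, and a homomorphism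
  carries commutators to commutators.\<close>

lemma retraction_commutator:
  assumes i: "i < n" and w: "w \<in> Fix i" "w \<in> L 1"
  shows "w \<in> lower_central (free_group ({..<n} - {i})) 1"
proof -
  let ?G = "free_group ({..<n} - {i})"
  let ?r = "eval_word ?G (\<lambda>j. if j = i then \<one>\<^bsub>?G\<^esub> else gen j)"
  interpret G: group ?G by (rule group_free_group)
  have f: "(\<lambda>j. if j = i then \<one>\<^bsub>?G\<^esub> else gen j) \<in> {..<n} \<rightarrow> carrier ?G" by auto
  have hom: "?r \<in> hom F ?G" by (rule G.free_group_universal(1)[OF f])
  interpret r: group_hom F ?G ?r using group_hom_free_group[OF G.is_group hom] .
  have "?r w = w"
  proof (rule free_group_hom_eqI[OF G.is_group _ _ _ w(1)])
    show "?r \<in> hom ?G ?G"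
      using hom Fix_closed[of _ i] by (auto simp: hom_def Pi_iff mult_free_group)
    show "(\<lambda>w. w) \<in> hom ?G ?G" by (simp add: hom_def)
    fix j assume j: "j \<in> {..<n} - {i}"
    then show "\<exists>l. snd l = j \<and> ?r [l] = [l]"
      using G.free_group_universal(2)[OF f, of j] by (intro exI[of _ "(True, j)"]) simp
  qed
  moreover have "?r w \<in> lower_central ?G 1" using r.lower_central_image_subset[of 1] w(2) by blast
  ultimately show ?thesis by simp
qed

text \<open>All commutators are taken in \<open>?Q\<close>, the image of the smaller free group
  modulo [K, K], so that w' is found in \<open>Fix i\<close>. Otherwise substitution by the replaced
  words would not be known to be an automorphism.\<close>

lemma commutator_power_deep:
  assumes i: "i < n" and w: "w \<in> Fix i" "w \<in> L 1"
  shows "\<exists>m>0::nat. \<exists>w'\<in>Fix i \<inter> L k. KK #>\<^bsub>F\<^esub> w [^]\<^bsub>F\<^esub> m = KK #>\<^bsub>F\<^esub> w'"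
proof -
  let ?G = "free_group ({..<n} - {i})"
  interpret G: group ?G by (rule group_free_group)
  have Geq: "?G = F\<lparr>carrier := Fix i\<rparr>" by (rule free_group_eq)
  have inc: "(\<lambda>w. w) \<in> hom ?G F" using Fix_closed[of _ i] by (auto simp: hom_def mult_free_group)
  interpret inc: group_hom ?G F "\<lambda>w. w" using group_hom_free_group[OF F.is_group inc] .
  interpret h: group_hom F "F Mod KK" "\<lambda>x. KK #>\<^bsub>F\<^esub> x" by (rule F.coset_group_hom[OF KK_normal])
  interpret hG: group_hom ?G "F Mod KK" "\<lambda>x. KK #>\<^bsub>F\<^esub> x"
    using group_hom_free_group[OF h.H.is_group Group.hom_compose[OF inc h.homh]] by (simp add: comp_def)
  let ?Q = "(F Mod KK)\<lparr>carrier := (\<lambda>x. KK #>\<^bsub>F\<^esub> x) ` Fix i\<rparr>"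
  have sub: "subgroup ((\<lambda>x. KK #>\<^bsub>F\<^esub> x) ` Fix i) (F Mod KK)"
    by (rule h.subgroup_img_is_subgroup[OF Fix_subgroup])
  interpret Q: group ?Q by (rule subgroup.subgroup_is_group[OF sub h.H.is_group])
  interpret q: group_hom ?G ?Q "\<lambda>x. KK #>\<^bsub>F\<^esub> x"
    using hG.homh by (intro group_hom.intro group_hom_axioms.intro G.is_group Q.is_group) (auto simp: hom_def)
  have im: "(\<lambda>x. KK #>\<^bsub>F\<^esub> x) ` lower_central ?G j = lower_central ?Q j" for j
    by (rule q.lower_central_image) simp
  have pow: "(KK #>\<^bsub>F\<^esub> x) [^]\<^bsub>?Q\<^esub> m = KK #>\<^bsub>F\<^esub> x [^]\<^bsub>F\<^esub> m" if "x \<in> Fix i" for x and m :: nat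
    using that h.hom_nat_pow[of x m] by (simp add: h.H.nat_pow_consistent[symmetric])
  have pF: "x [^]\<^bsub>F\<^esub> m \<in> Fix i" if "x \<in> Fix i" for x and m :: nat
    using that by (induction m) auto
  have tors: "\<exists>m>0::nat. \<exists>l>0::nat. gcomm ?Q (a [^]\<^bsub>?Q\<^esub> m) (r [^]\<^bsub>?Q\<^esub> l) \<in> lower_central ?Q (Suc (Suc j))"
    if ar: "a \<in> carrier ?Q" "r \<in> lower_central ?Q j" for a r j
  proof -
    have "r \<in> carrier ?Q" using Q.lower_central_closed[OF ar(2)] .
    then obtain x y where xy: "x \<in> Fix i" "a = KK #>\<^bsub>F\<^esub> x" "y \<in> Fix i" "r = KK #>\<^bsub>F\<^esub> y"
      using ar(1) by auto
    have "gcomm ?Q (a [^]\<^bsub>?Q\<^esub> expo) (r [^]\<^bsub>?Q\<^esub> expo) = KK #>\<^bsub>F\<^esub> gcomm ?G (x [^]\<^bsub>F\<^esub> expo) (y [^]\<^bsub>F\<^esub> expo)"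
      using q.hom_gcomm[of "x [^]\<^bsub>F\<^esub> expo" "y [^]\<^bsub>F\<^esub> expo"] pow pF xy by simp
    also have "gcomm ?G (x [^]\<^bsub>F\<^esub> expo) (y [^]\<^bsub>F\<^esub> expo) = gcomm F (x [^]\<^bsub>F\<^esub> expo) (y [^]\<^bsub>F\<^esub> expo)"
      using inc.hom_gcomm pF xy by simp
    also have "KK #>\<^bsub>F\<^esub> \<dots> = \<one>\<^bsub>F Mod KK\<^esub>"
      using F.coset_one_iff[OF KK_normal] gcomm_KK expo(2) xy by simp
    finally have "gcomm ?Q (a [^]\<^bsub>?Q\<^esub> expo) (r [^]\<^bsub>?Q\<^esub> expo) = \<one>\<^bsub>?Q\<^esub>" by simp
    then have "gcomm ?Q (a [^]\<^bsub>?Q\<^esub> expo) (r [^]\<^bsub>?Q\<^esub> expo) \<in> lower_central ?Q (Suc (Suc j))"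
      using subgroup.one_closed[OF Q.lower_central_subgroup] by metis
    then show ?thesis using expo(1) by blast
  qed
  have deep: "\<exists>m>0::nat. z [^]\<^bsub>?Q\<^esub> m \<in> lower_central ?Q j" if z: "z \<in> lower_central ?Q 1" and j: "j \<ge> 1" for z j
    using j
  proof (induction j rule: dec_induct)
    case base
    have "z [^]\<^bsub>?Q\<^esub> (1::nat) = z" by (rule Q.nat_pow_eone[OF Q.lower_central_closed[OF z]])
    then show ?case using z by (intro exI[of _ 1]) simp
  next
    case (step j)
    then obtain m :: nat where m: "m > 0" "z [^]\<^bsub>?Q\<^esub> m \<in> lower_central ?Q j" by blast
    obtain j' where j': "j = Suc j'" using step by (cases j) auto
    obtain l :: nat where l: "l > 0" "(z [^]\<^bsub>?Q\<^esub> m) [^]\<^bsub>?Q\<^esub> l \<in> lower_central ?Q (Suc j)"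
      using Q.lower_central_torsion_step[OF tors m(2)[unfolded j']] unfolding j' by blast
    then have "z [^]\<^bsub>?Q\<^esub> (m * l) \<in> lower_central ?Q (Suc j)"
      using Q.nat_pow_pow[OF Q.lower_central_closed[OF z]] by simp
    then show ?case using m l by (metis nat_0_less_mult_iff)
  qed
  have "KK #>\<^bsub>F\<^esub> w \<in> lower_central ?Q 1" using retraction_commutator[OF i w] im[of 1] by blast
  then obtain m :: nat where m: "m > 0" "(KK #>\<^bsub>F\<^esub> w) [^]\<^bsub>?Q\<^esub> m \<in> lower_central ?Q k"
    using deep k1 by blast
  then have "KK #>\<^bsub>F\<^esub> w [^]\<^bsub>F\<^esub> m \<in> (\<lambda>x. KK #>\<^bsub>F\<^esub> x) ` lower_central ?G k"
    using pow[OF w(1)] im by simp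
  then obtain w' where w': "w' \<in> lower_central ?G k" "KK #>\<^bsub>F\<^esub> w [^]\<^bsub>F\<^esub> m = KK #>\<^bsub>F\<^esub> w'" by blast
  have "w' \<in> Fix i" using G.lower_central_closed[OF w'(1)] .
  moreover have "w' \<in> L k" using inc.lower_central_image_subset[of k] w'(1) by blast
  ultimately show ?thesis using m w' by blast
qed

text \<open>Modulo \<open>M\<close> this is the commutator subgroup of I/\<open>M\<close>, so
  \<open>T\<close> is the preimage in I of the torsion of the abelianization of
  I/\<open>M\<close>.\<close>

definition D :: "(nat word \<Rightarrow> nat word) set" where
  "D = generate A (M \<union> {gcomm A \<phi> \<psi> |\<phi> \<psi>. \<phi> \<in> J (Suc 0) \<and> \<psi> \<in> J (Suc 0)})"

definition T :: "(nat word \<Rightarrow> nat word) set" where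
  "T = {\<phi> \<in> J (Suc 0). \<exists>m>0::nat. \<phi> [^]\<^bsub>A\<^esub> m \<in> D}"

lemma D_normal: "D \<lhd> A"
  unfolding D_def
proof (rule A.normal_generateI)
  show "M \<union> {gcomm A \<phi> \<psi> |\<phi> \<psi>. \<phi> \<in> J (Suc 0) \<and> \<psi> \<in> J (Suc 0)} \<subseteq> carrier A"
    using M_subset johnson_auto A.gcomm_closed by auto
next
  fix h \<alpha> assume h: "h \<in> M \<union> {gcomm A \<phi> \<psi> |\<phi> \<psi>. \<phi> \<in> J (Suc 0) \<and> \<psi> \<in> J (Suc 0)}" and \<alpha>: "\<alpha> \<in> carrier A"
  show "\<alpha> \<otimes>\<^bsub>A\<^esub> h \<otimes>\<^bsub>A\<^esub> inv\<^bsub>A\<^esub> \<alpha> \<in> M \<union> {gcomm A \<phi> \<psi> |\<phi> \<psi>. \<phi> \<in> J (Suc 0) \<and> \<psi> \<in> J (Suc 0)}"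
  proof (cases "h \<in> M")
    case True
    then show ?thesis using normal.inv_op_closed2[OF M_normal \<alpha>] by blast
  next
    case False
    then obtain \<phi> \<psi> where h: "h = gcomm A \<phi> \<psi>" "\<phi> \<in> J (Suc 0)" "\<psi> \<in> J (Suc 0)" using h by blast
    have c: "\<phi> \<in> carrier A" "\<psi> \<in> carrier A" using h by simp_all
    have "\<alpha> \<otimes>\<^bsub>A\<^esub> h \<otimes>\<^bsub>A\<^esub> inv\<^bsub>A\<^esub> \<alpha> = gcomm A (\<alpha> \<otimes>\<^bsub>A\<^esub> \<phi> \<otimes>\<^bsub>A\<^esub> inv\<^bsub>A\<^esub> \<alpha>) (\<alpha> \<otimes>\<^bsub>A\<^esub> \<psi> \<otimes>\<^bsub>A\<^esub> inv\<^bsub>A\<^esub> \<alpha>)"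
      unfolding h gcomm_def using \<alpha> c
      by (simp only: A.m_assoc A.inv_mult_group A.inv_inv A.m_closed A.inv_closed A.cancel_left)
    then show ?thesis
      using normal.inv_op_closed2[OF johnson_normal \<alpha>] h by blast
  qed
qed

lemma M_subset_D: "M \<subseteq> D"
  unfolding D_def by (intro subsetI generate.incl UnI1)

lemma T_subgroup: "subgroup T A"
  unfolding T_def
proof (rule A.subgroup_torsion_mod[OF D_normal johnson_subgroup])
  fix x y assume "x \<in> J (Suc 0)" "y \<in> J (Suc 0)"
  then show "gcomm A x y \<in> D" unfolding D_def by (intro generate.incl UnI2) blast
qed

lemma T_subset: "T \<subseteq> J (Suc 0)"
  unfolding T_def by blast

lemma M_subset_T: "M \<subseteq> T"
proof
  fix \<phi> assume \<phi>: "\<phi> \<in> M"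
  then have "\<phi> \<in> D" "\<phi> \<in> carrier A" using M_subset_D subgroup.mem_carrier[OF M_subgroup] by blast+
  then have "\<phi> [^]\<^bsub>A\<^esub> (1::nat) \<in> D" using A.nat_pow_eone by metis
  then show "\<phi> \<in> T" unfolding T_def using \<phi> M_subset by blast
qed

text \<open>The exponents that arise on the way (m1 m2, the order of F/K, and n - 1) are all
  discarded by this rule.\<close>

lemma T_root:
  assumes "\<phi> \<in> J (Suc 0)" "m > 0" "\<phi> [^]\<^bsub>A\<^esub> (m::nat) \<in> T"
  shows "\<phi> \<in> T"
proof -
  obtain l :: nat where l: "l > 0" "(\<phi> [^]\<^bsub>A\<^esub> m) [^]\<^bsub>A\<^esub> l \<in> D" using assms(3) unfolding T_def by blast
  then have "\<phi> [^]\<^bsub>A\<^esub> (m * l) \<in> D" using A.nat_pow_pow[of \<phi>] assms(1) by simp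
  then show ?thesis unfolding T_def using assms l by (metis (mono_tags, lifting) mem_Collect_eq nat_0_less_mult_iff)
qed

lemma T_normal: "T \<lhd> A"
proof (rule A.normal_invI[OF T_subgroup])
  fix \<alpha> \<phi> assume \<alpha>: "\<alpha> \<in> carrier A" and "\<phi> \<in> T"
  then obtain m :: nat where \<phi>: "\<phi> \<in> J (Suc 0)" "m > 0" "\<phi> [^]\<^bsub>A\<^esub> m \<in> D" unfolding T_def by blast
  have c: "\<phi> \<in> carrier A" using \<phi> by simp
  have "(\<alpha> \<otimes>\<^bsub>A\<^esub> \<phi> \<otimes>\<^bsub>A\<^esub> inv\<^bsub>A\<^esub> \<alpha>) [^]\<^bsub>A\<^esub> m = \<alpha> \<otimes>\<^bsub>A\<^esub> \<phi> [^]\<^bsub>A\<^esub> m \<otimes>\<^bsub>A\<^esub> inv\<^bsub>A\<^esub> \<alpha>"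
  proof (induction m)
    case 0
    then show ?case using \<alpha> by (simp del: carrier_A)
  next
    case (Suc m)
    then show ?case using \<alpha> c by (simp add: A.m_assoc del: carrier_A)
  qed
  then have "(\<alpha> \<otimes>\<^bsub>A\<^esub> \<phi> \<otimes>\<^bsub>A\<^esub> inv\<^bsub>A\<^esub> \<alpha>) [^]\<^bsub>A\<^esub> m \<in> D"
    using normal.inv_op_closed2[OF D_normal \<alpha> \<phi>(3)] by simp
  moreover have "\<alpha> \<otimes>\<^bsub>A\<^esub> \<phi> \<otimes>\<^bsub>A\<^esub> inv\<^bsub>A\<^esub> \<alpha> \<in> J (Suc 0)" using normal.inv_op_closed2[OF johnson_normal \<alpha> \<phi>(1)] .
  ultimately show "\<alpha> \<otimes>\<^bsub>A\<^esub> \<phi> \<otimes>\<^bsub>A\<^esub> inv\<^bsub>A\<^esub> \<alpha> \<in> T" unfolding T_def using \<phi>(2) by blast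
qed

lemma sub_johnson:
  assumes i: "i < n" and uv: "u \<in> Fix i" "v \<in> Fix i" and N: "N \<lhd> F" and mem: "u \<in> N" "v \<in> N"
    and j: "j < n"
  shows "sub i u v (gen j) \<otimes>\<^bsub>F\<^esub> inv\<^bsub>F\<^esub> gen j \<in> N"
proof (cases "j = i")
  case True
  have c: "gen i \<in> carrier F" using i by simp
  have "gen i \<otimes>\<^bsub>F\<^esub> v \<otimes>\<^bsub>F\<^esub> inv\<^bsub>F\<^esub> gen i \<in> N" using normal.inv_op_closed2[OF N c mem(2)] .
  then have "u \<otimes>\<^bsub>F\<^esub> (gen i \<otimes>\<^bsub>F\<^esub> v \<otimes>\<^bsub>F\<^esub> inv\<^bsub>F\<^esub> gen i) \<in> N"
    using mem(1) N normal_imp_subgroup subgroup.m_closed by metis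
  then show ?thesis using True i uv c by (simp add: F.m_assoc)
next
  case False
  have "\<one>\<^bsub>F\<^esub> \<in> N" using N normal_imp_subgroup subgroup.one_closed by metis
  then show ?thesis using False i uv j by simp
qed

lemma sub_commutator_in_J:
  assumes i: "i < n" and uv: "u \<in> Fix i" "v \<in> Fix i" "u \<in> L j" "v \<in> L j"
  shows "sub i u v \<in> J j"
  using sub_johnson[OF i uv(1,2) F.lower_central_normal uv(3,4)] i uv by (intro johnsonI) auto

text \<open>For fixed i powers are taken on both sides separately, and m1 m2 is a common exponent
  for u and v. The power of the substitution, divided by the one with u' and v', multiplies x_i by
  elements of [K, K] only, hence is trivial on K modulo [K, K], while the divisor is in I_k.\<close>

lemma sub_commutator_in_T:
  assumes i: "i < n" and uv: "u \<in> Fix i" "v \<in> Fix i" "u \<in> L 1" "v \<in> L 1"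
  shows "sub i u v \<in> T"
proof -
  interpret h: group_hom F "F Mod KK" "\<lambda>x. KK #>\<^bsub>F\<^esub> x" by (rule F.coset_group_hom[OF KK_normal])
  obtain m1 u1 where 1: "m1 > (0::nat)" "u1 \<in> Fix i" "u1 \<in> L k" "KK #>\<^bsub>F\<^esub> u [^]\<^bsub>F\<^esub> m1 = KK #>\<^bsub>F\<^esub> u1"
    using commutator_power_deep[OF i uv(1,3)] by blast
  obtain m2 v1 where 2: "m2 > (0::nat)" "v1 \<in> Fix i" "v1 \<in> L k" "KK #>\<^bsub>F\<^esub> v [^]\<^bsub>F\<^esub> m2 = KK #>\<^bsub>F\<^esub> v1"
    using commutator_power_deep[OF i uv(2,4)] by blast
  define u' v' where "u' = u1 [^]\<^bsub>F\<^esub> m2" and "v' = v1 [^]\<^bsub>F\<^esub> m1"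
  have pF: "x [^]\<^bsub>F\<^esub> m \<in> Fix i" if "x \<in> Fix i" for x and m :: nat
    using that by (induction m) auto
  have pL: "x [^]\<^bsub>F\<^esub> m \<in> L k" if "x \<in> L k" for x and m :: nat
    using that subgroup.m_closed[OF F.lower_central_subgroup] subgroup.one_closed[OF F.lower_central_subgroup]
    by (induction m) auto
  have u': "u' \<in> Fix i" "u' \<in> L k" and v': "v' \<in> Fix i" "v' \<in> L k"
    unfolding u'_def v'_def using pF pL 1 2 by blast+
  let ?m = "m1 * m2"
  have um: "u [^]\<^bsub>F\<^esub> ?m \<in> Fix i" "v [^]\<^bsub>F\<^esub> ?m \<in> Fix i" using pF uv by blast+
  have "KK #>\<^bsub>F\<^esub> u [^]\<^bsub>F\<^esub> ?m = KK #>\<^bsub>F\<^esub> u'"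
    unfolding u'_def using h.hom_nat_pow[of "u [^]\<^bsub>F\<^esub> m1" m2] h.hom_nat_pow[of u1 m2] 1 uv F.nat_pow_pow[of u m1 m2] by simp
  moreover have "KK #>\<^bsub>F\<^esub> v [^]\<^bsub>F\<^esub> ?m = KK #>\<^bsub>F\<^esub> v'"
    unfolding v'_def using h.hom_nat_pow[of "v [^]\<^bsub>F\<^esub> m2" m1] h.hom_nat_pow[of v1 m1] 2 uv F.nat_pow_pow[of v m2 m1]
    by (simp add: mult.commute)
  ultimately have one: "KK #>\<^bsub>F\<^esub> (inv\<^bsub>F\<^esub> u' \<otimes>\<^bsub>F\<^esub> u [^]\<^bsub>F\<^esub> ?m) = \<one>\<^bsub>F Mod KK\<^esub>" "KK #>\<^bsub>F\<^esub> (v [^]\<^bsub>F\<^esub> ?m \<otimes>\<^bsub>F\<^esub> inv\<^bsub>F\<^esub> v') = \<one>\<^bsub>F Mod KK\<^esub>"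
    using u' v' um uv by simp_all
  then have d: "inv\<^bsub>F\<^esub> u' \<otimes>\<^bsub>F\<^esub> u [^]\<^bsub>F\<^esub> ?m \<in> KK" "v [^]\<^bsub>F\<^esub> ?m \<otimes>\<^bsub>F\<^esub> inv\<^bsub>F\<^esub> v' \<in> KK"
    using iffD1[OF F.coset_one_iff[OF KK_normal] one(1)] iffD1[OF F.coset_one_iff[OF KK_normal] one(2)] u' v' um
    by simp_all
  have J1: "sub i u v \<in> J (Suc 0)" using sub_commutator_in_J[OF i uv(1,2), of "Suc 0"] uv by simp
  have eq: "sub i u v [^]\<^bsub>A\<^esub> ?m \<otimes>\<^bsub>A\<^esub> inv\<^bsub>A\<^esub> sub i u' v' = sub i (inv\<^bsub>F\<^esub> u' \<otimes>\<^bsub>F\<^esub> u [^]\<^bsub>F\<^esub> ?m) (v [^]\<^bsub>F\<^esub> ?m \<otimes>\<^bsub>F\<^esub> inv\<^bsub>F\<^esub> v')"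
    using i uv u' v' um by (simp add: sub_pow sub_inv sub_comp)
  have "sub i u v [^]\<^bsub>A\<^esub> ?m \<in> M"
  proof (rule M_I)
    show "sub i u v [^]\<^bsub>A\<^esub> ?m \<in> J (Suc 0)"
      using subgroup.m_closed[OF johnson_subgroup _ J1] subgroup.one_closed[OF johnson_subgroup] by (induction ("m1 * m2")) auto
    show "sub i u' v' \<in> J k" by (rule sub_commutator_in_J[OF i u'(1) v'(1) u'(2) v'(2)])
    fix x assume "x \<in> K"
    then have x: "x \<in> carrier F" by (rule K_closed)
    have dF: "inv\<^bsub>F\<^esub> u' \<otimes>\<^bsub>F\<^esub> u [^]\<^bsub>F\<^esub> ?m \<in> Fix i" "v [^]\<^bsub>F\<^esub> ?m \<otimes>\<^bsub>F\<^esub> inv\<^bsub>F\<^esub> v' \<in> Fix i" using u' v' um by simp_all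
    show "(sub i u v [^]\<^bsub>A\<^esub> ?m \<otimes>\<^bsub>A\<^esub> inv\<^bsub>A\<^esub> sub i u' v') x \<otimes>\<^bsub>F\<^esub> inv\<^bsub>F\<^esub> x \<in> KK"
      unfolding eq
      by (rule hom_cong_mod[OF KK_normal auto_hom[OF sub_auto[OF i dF]] _ x])
        (rule sub_johnson[OF i dF KK_normal d])
  qed
  then show ?thesis
    using T_root[OF J1, of ?m] M_subset_T 1(1) 2(1) by (simp add: subset_iff)
qed

end

section \<open>Partial conjugations are torsion classes\<close>

context homological
begin

sublocale h: group_hom A "A Mod T" "\<lambda>\<phi>. T #>\<^bsub>A\<^esub> \<phi>"
  by (rule A.coset_group_hom[OF T_normal])

lemma T_coset_eqI:
  assumes "\<phi> \<in> auto F" "\<psi> \<in> auto F" "\<phi> \<otimes>\<^bsub>A\<^esub> inv\<^bsub>A\<^esub> \<psi> \<in> T"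
  shows "T #>\<^bsub>A\<^esub> \<phi> = T #>\<^bsub>A\<^esub> \<psi>"
  using A.coset_eq_iff[OF T_normal] assms by simp

text \<open>One of Magnus' generators of I. \<open>sub_commutator_in_T\<close> does not reach it,
  since the generator x_j is not in the commutator subgroup.\<close>

definition kappa :: "nat \<Rightarrow> nat \<Rightarrow> nat word \<Rightarrow> nat word" where
  "kappa i j = sub i (gen j) (inv\<^bsub>F\<^esub> gen j)"

lemma kappa_auto [simp]: "i < n \<Longrightarrow> j < n \<Longrightarrow> i \<noteq> j \<Longrightarrow> kappa i j \<in> auto F"
  by (simp add: kappa_def)

lemma gcomm_L1: "x \<in> carrier F \<Longrightarrow> y \<in> carrier F \<Longrightarrow> gcomm F x y \<in> L 1"
  using F.gcomm_lower_central[of x y 0] by simp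

lemma kappa_J:
  assumes ij: "i < n" "j < n" "i \<noteq> j"
  shows "kappa i j \<in> J (Suc 0)"
proof (rule johnsonI)
  show "kappa i j \<in> auto F" using ij by simp
  fix l assume l: "l < n"
  show "kappa i j (gen l) \<otimes>\<^bsub>F\<^esub> inv\<^bsub>F\<^esub> gen l \<in> L (Suc 0)"
  proof (cases "l = i")
    case True
    have "kappa i j (gen i) \<otimes>\<^bsub>F\<^esub> inv\<^bsub>F\<^esub> gen i = gcomm F (gen j) (gen i)"
      using ij by (simp add: kappa_def gcomm_def)
    then show ?thesis using gcomm_L1[of "gen j" "gen i"] ij True by simp
  next
    case False
    then show ?thesis using ij l subgroup.one_closed[OF F.lower_central_subgroup] by (simp add: kappa_def)
  qed
qed

text \<open>With \<open>y\<close> the element \<open>b\<inverse> c\<close> of the basis \<open>a, b, y, \<dots>\<close>, the automorphism \<open>b \<mapsto> b [y, a]\<close> is, up to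
  transvections by commutators, the product of \<open>kappa b a\<close> and the inverse of \<open>kappa c a\<close>.\<close>

lemma kappa_independent:
  assumes abc: "a < n" "b < n" "c < n" "a \<noteq> b" "a \<noteq> c" "b \<noteq> c"
  shows "T #>\<^bsub>A\<^esub> kappa b a = T #>\<^bsub>A\<^esub> kappa c a"
proof -
  let ?a = "gen a" and ?b = "gen b" and ?c = "gen c"
  define f where "f = sub b (?c \<otimes>\<^bsub>F\<^esub> ?a \<otimes>\<^bsub>F\<^esub> inv\<^bsub>F\<^esub> ?c) (inv\<^bsub>F\<^esub> ?a)"
  define g where "g = sub c (?b \<otimes>\<^bsub>F\<^esub> inv\<^bsub>F\<^esub> ?a \<otimes>\<^bsub>F\<^esub> inv\<^bsub>F\<^esub> ?b) ?a"
  define d where "d = sub c (inv\<^bsub>F\<^esub> ?b) \<one>\<^bsub>F\<^esub>"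
  define t where "t = sub b \<one>\<^bsub>F\<^esub> (gcomm F ?c ?a)"
  have fb: "?a \<in> Fix b" "?c \<in> Fix b" "?a \<in> Fix c" "?b \<in> Fix c" using abc by auto
  then have gb: "gcomm F ?c ?a \<in> Fix b" by (simp add: gcomm_def)
  have c: "?a \<in> carrier F" "?b \<in> carrier F" "?c \<in> carrier F" using abc by auto
  have aut: "f \<in> auto F" "g \<in> auto F" "d \<in> auto F" "t \<in> auto F"
    unfolding f_def g_def d_def t_def using abc fb gb by simp_all
  have eq: "d \<otimes>\<^bsub>A\<^esub> t = f \<otimes>\<^bsub>A\<^esub> g \<otimes>\<^bsub>A\<^esub> d"
  proof (rule auto_eqI)
    have f: "f ?a = ?a" "f ?b = ?c \<otimes>\<^bsub>F\<^esub> ?a \<otimes>\<^bsub>F\<^esub> inv\<^bsub>F\<^esub> ?c \<otimes>\<^bsub>F\<^esub> ?b \<otimes>\<^bsub>F\<^esub> inv\<^bsub>F\<^esub> ?a" "f ?c = ?c"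
      using abc fb by (simp_all add: f_def)
    have g: "g ?a = ?a" "g ?b = ?b" "g ?c = ?b \<otimes>\<^bsub>F\<^esub> inv\<^bsub>F\<^esub> ?a \<otimes>\<^bsub>F\<^esub> inv\<^bsub>F\<^esub> ?b \<otimes>\<^bsub>F\<^esub> ?c \<otimes>\<^bsub>F\<^esub> ?a"
      using abc fb by (simp_all add: g_def)
    have d: "d ?a = ?a" "d ?b = ?b" "d ?c = inv\<^bsub>F\<^esub> ?b \<otimes>\<^bsub>F\<^esub> ?c"
      using abc fb by (simp_all add: d_def)
    have t: "t ?b = ?b \<otimes>\<^bsub>F\<^esub> gcomm F ?c ?a" "t ?c = ?c"
      using abc gb by (simp_all add: t_def)
    have other: "f (gen i) = gen i" "g (gen i) = gen i" "d (gen i) = gen i" "t (gen i) = gen i"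
      if "i < n" "i \<noteq> b" "i \<noteq> c" for i
      using that abc fb gb by (simp_all add: f_def g_def d_def t_def)
    have ap: "(d \<otimes>\<^bsub>A\<^esub> t) x = d (t x)" "(f \<otimes>\<^bsub>A\<^esub> g \<otimes>\<^bsub>A\<^esub> d) x = f (g (d x))" if "x \<in> carrier F" for x
      using A_apply[OF aut(3,4) that] A_apply[OF A_closed(1)[OF aut(1,2)] aut(3) that]
        A_apply[OF aut(1,2) auto_apply_closed[OF aut(3) that]] by simp_all
    fix i assume i: "i < n"
    consider "i = b" | "i = c" | "i \<noteq> b" "i \<noteq> c" by blast
    then have "(d \<otimes>\<^bsub>A\<^esub> t) (gen i) = (f \<otimes>\<^bsub>A\<^esub> g \<otimes>\<^bsub>A\<^esub> d) (gen i)"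
    proof cases
      case 1
      have "d (t ?b) = ?c \<otimes>\<^bsub>F\<^esub> ?a \<otimes>\<^bsub>F\<^esub> inv\<^bsub>F\<^esub> ?c \<otimes>\<^bsub>F\<^esub> ?b \<otimes>\<^bsub>F\<^esub> inv\<^bsub>F\<^esub> ?a"
        unfolding t gcomm_def using c d by (simp add: auto_mult[OF aut(3)] auto_inv[OF aut(3)] F.m_assoc F.inv_mult_group)
      then show ?thesis unfolding 1 ap[OF c(2)] d(2) g(2) f(2) .
    next
      case 2
      have "g (d ?c) = inv\<^bsub>F\<^esub> ?a \<otimes>\<^bsub>F\<^esub> inv\<^bsub>F\<^esub> ?b \<otimes>\<^bsub>F\<^esub> ?c \<otimes>\<^bsub>F\<^esub> ?a"
        unfolding d using c g by (simp add: auto_mult[OF aut(2)] auto_inv[OF aut(2)] F.m_assoc)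
      moreover have "f (inv\<^bsub>F\<^esub> ?a \<otimes>\<^bsub>F\<^esub> inv\<^bsub>F\<^esub> ?b \<otimes>\<^bsub>F\<^esub> ?c \<otimes>\<^bsub>F\<^esub> ?a) = inv\<^bsub>F\<^esub> ?b \<otimes>\<^bsub>F\<^esub> ?c"
        using c f by (simp add: auto_mult[OF aut(1)] auto_inv[OF aut(1)] F.m_assoc F.inv_mult_group)
      ultimately show ?thesis unfolding 2 ap[OF c(3)] t(2) d(3) by simp
    next
      case 3
      have "gen i \<in> carrier F" using i by simp
      then show ?thesis unfolding ap other[OF i 3] using ap other[OF i 3] by simp
    qed
    then show "\<exists>l. snd l = i \<and> (d \<otimes>\<^bsub>A\<^esub> t) [l] = (f \<otimes>\<^bsub>A\<^esub> g \<otimes>\<^bsub>A\<^esub> d) [l]"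
      by (intro exI[of _ "(True, i)"]) simp
  next
    show "d \<otimes>\<^bsub>A\<^esub> t \<in> auto F" by (rule A_closed(1)[OF aut(3,4)])
    show "f \<otimes>\<^bsub>A\<^esub> g \<otimes>\<^bsub>A\<^esub> d \<in> auto F" by (rule A_closed(1)[OF A_closed(1)[OF aut(1,2)] aut(3)])
  qed
  have one: "\<one>\<^bsub>F\<^esub> \<in> L 1" by (rule subgroup.one_closed[OF F.lower_central_subgroup])
  have tT: "t \<in> T" unfolding t_def using abc gb gcomm_L1[of ?c ?a] c one by (intro sub_commutator_in_T) auto
  \<comment> \<open>The automorphism d performs the change of basis, and f g is the conjugate of t
    by it. This uses that \<open>T\<close> is normal in Aut(F_n) and not merely in I.\<close>
  have "f \<otimes>\<^bsub>A\<^esub> g = d \<otimes>\<^bsub>A\<^esub> t \<otimes>\<^bsub>A\<^esub> inv\<^bsub>A\<^esub> d"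
    unfolding eq using aut by (simp add: A.m_assoc)
  also have "\<dots> \<in> T" using normal.inv_op_closed2[OF T_normal _ tT, of d] aut by simp
  finally have fg: "(T #>\<^bsub>A\<^esub> f) \<otimes>\<^bsub>A Mod T\<^esub> (T #>\<^bsub>A\<^esub> g) = \<one>\<^bsub>A Mod T\<^esub>"
    using A.coset_one_iff[OF T_normal, of "f \<otimes>\<^bsub>A\<^esub> g"] aut by simp
  \<comment> \<open>On the left of b, f has the conjugate c a c^-1 in place of a. The quotient of
    the two is the commutator of a^-1 and c, so the class of f is that of
    \<open>kappa b a\<close>.\<close>
  have "f \<otimes>\<^bsub>A\<^esub> inv\<^bsub>A\<^esub> kappa b a = sub b (gcomm F (inv\<^bsub>F\<^esub> ?a) ?c) \<one>\<^bsub>F\<^esub>"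
    unfolding f_def kappa_def gcomm_def using abc fb by (simp add: sub_inv sub_comp F.m_assoc)
  moreover have "sub b (gcomm F (inv\<^bsub>F\<^esub> ?a) ?c) \<one>\<^bsub>F\<^esub> \<in> T"
    using abc fb gcomm_L1[of "inv\<^bsub>F\<^esub> ?a" ?c] c one by (intro sub_commutator_in_T) (auto simp: gcomm_def)
  ultimately have f: "T #>\<^bsub>A\<^esub> f = T #>\<^bsub>A\<^esub> kappa b a" using aut abc by (intro T_coset_eqI) auto
  have "g \<otimes>\<^bsub>A\<^esub> inv\<^bsub>A\<^esub> (inv\<^bsub>A\<^esub> kappa c a) = sub c (gcomm F ?a ?b) \<one>\<^bsub>F\<^esub>"
    unfolding g_def kappa_def gcomm_def using abc fb by (simp add: sub_inv sub_comp F.m_assoc)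
  moreover have "sub c (gcomm F ?a ?b) \<one>\<^bsub>F\<^esub> \<in> T"
    using abc fb gcomm_L1[of ?a ?b] c one by (intro sub_commutator_in_T) (auto simp: gcomm_def)
  ultimately have g: "T #>\<^bsub>A\<^esub> g = T #>\<^bsub>A\<^esub> inv\<^bsub>A\<^esub> kappa c a" using aut abc by (intro T_coset_eqI) auto
  have k: "kappa b a \<in> carrier A" "kappa c a \<in> carrier A" using abc by auto
  have "(T #>\<^bsub>A\<^esub> kappa b a) \<otimes>\<^bsub>A Mod T\<^esub> inv\<^bsub>A Mod T\<^esub> (T #>\<^bsub>A\<^esub> kappa c a) = \<one>\<^bsub>A Mod T\<^esub>"
    using fg unfolding f g h.hom_inv[OF k(2)] .
  then show ?thesis
    using h.hom_closed[OF k(1)] h.hom_closed[OF k(2)] h.H.inv_solve_right'[of "\<one>\<^bsub>A Mod T\<^esub>"] by simp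
qed

text \<open>Every index in \<open>S\<close> contributes one partial conjugation by x_j, and modulo
  \<open>T\<close> all of them equal that at \<open>i0\<close>. Arbitrary \<open>S\<close> is there
  for the induction; the goal is the set of all indices other than j.\<close>

lemma partial_conjugation:
  assumes j: "j < n" and i0: "i0 < n" "i0 \<noteq> j" and S: "finite S" "S \<subseteq> {..<n} - {j}"
  shows "\<exists>\<phi>\<in>J (Suc 0). (\<forall>i<n. \<phi> (gen i) = (if i \<in> S then gen j \<otimes>\<^bsub>F\<^esub> gen i \<otimes>\<^bsub>F\<^esub> inv\<^bsub>F\<^esub> gen j else gen i)) \<and>
    T #>\<^bsub>A\<^esub> \<phi> = (T #>\<^bsub>A\<^esub> kappa i0 j) [^]\<^bsub>A Mod T\<^esub> card S"
  using S
proof (induction S rule: finite_induct)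
  case empty
  have "\<one>\<^bsub>A\<^esub> \<in> J (Suc 0)" by (rule subgroup.one_closed[OF johnson_subgroup])
  moreover have "T #>\<^bsub>A\<^esub> \<one>\<^bsub>A\<^esub> = (T #>\<^bsub>A\<^esub> kappa i0 j) [^]\<^bsub>A Mod T\<^esub> (0::nat)" using h.hom_one by simp
  ultimately show ?case by (intro bexI[of _ "\<one>\<^bsub>A\<^esub>"]) simp_all
next
  case (insert s S)
  then obtain \<phi> where \<phi>: "\<phi> \<in> J (Suc 0)" "\<And>i. i < n \<Longrightarrow> \<phi> (gen i) = (if i \<in> S then gen j \<otimes>\<^bsub>F\<^esub> gen i \<otimes>\<^bsub>F\<^esub> inv\<^bsub>F\<^esub> gen j else gen i)"
    "T #>\<^bsub>A\<^esub> \<phi> = (T #>\<^bsub>A\<^esub> kappa i0 j) [^]\<^bsub>A Mod T\<^esub> card S" by blast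
  have s: "s < n" "s \<noteq> j" "s \<notin> S" "j \<notin> S" using insert by auto
  have k: "kappa s j \<in> J (Suc 0)" "kappa s j \<in> auto F" using kappa_J s j by auto
  have \<phi>a: "\<phi> \<in> auto F" using \<phi>(1) by simp
  have c: "gen s \<in> carrier F" "gen j \<in> carrier F" using s j by auto
  have "(\<phi> \<otimes>\<^bsub>A\<^esub> kappa s j) (gen i) = (if i \<in> insert s S then gen j \<otimes>\<^bsub>F\<^esub> gen i \<otimes>\<^bsub>F\<^esub> inv\<^bsub>F\<^esub> gen j else gen i)"
    if i: "i < n" for i
  proof (cases "i = s")
    case True
    have "kappa s j (gen s) = gen j \<otimes>\<^bsub>F\<^esub> gen s \<otimes>\<^bsub>F\<^esub> inv\<^bsub>F\<^esub> gen j" using s j by (simp add: kappa_def)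
    then show ?thesis using True A_apply[OF \<phi>a k(2) c(1)] auto_mult[OF \<phi>a] auto_inv[OF \<phi>a] c \<phi>(2)[OF s(1)] \<phi>(2)[OF j] s
      by simp
  next
    case False
    have "kappa s j (gen i) = gen i" using s j i False by (simp add: kappa_def)
    then show ?thesis using False A_apply[OF \<phi>a k(2), of "gen i"] i \<phi>(2)[OF i] by simp
  qed
  moreover have "\<phi> \<otimes>\<^bsub>A\<^esub> kappa s j \<in> J (Suc 0)"
    by (rule subgroup.m_closed[OF johnson_subgroup \<phi>(1) k(1)])
  moreover have "T #>\<^bsub>A\<^esub> kappa s j = T #>\<^bsub>A\<^esub> kappa i0 j"
    using kappa_independent[of j s i0] s j i0 by (cases "s = i0") auto
  then have "T #>\<^bsub>A\<^esub> (\<phi> \<otimes>\<^bsub>A\<^esub> kappa s j) = (T #>\<^bsub>A\<^esub> kappa i0 j) [^]\<^bsub>A Mod T\<^esub> card (insert s S)"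
    using h.hom_mult[of \<phi> "kappa s j"] \<phi>a k \<phi>(3) insert.hyps by simp
  ultimately show ?case by blast
qed

text \<open>For the full index set the automorphism is inner and its class is the (n-1)-st power of
  that of \<open>kappa i j\<close>. Two extractions of roots conclude, by the order of F/K for the
  inner automorphism and by n - 1 for \<open>kappa i j\<close>.\<close>

lemma kappa_T:
  assumes ij: "i < n" "j < n" "i \<noteq> j"
  shows "kappa i j \<in> T"
proof -
  obtain \<phi> where \<phi>: "\<phi> \<in> J (Suc 0)" and gens: "\<And>l. l < n \<Longrightarrow> \<phi> (gen l) = (if l \<in> {..<n} - {j} then gen j \<otimes>\<^bsub>F\<^esub> gen l \<otimes>\<^bsub>F\<^esub> inv\<^bsub>F\<^esub> gen j else gen l)"
    and coset: "T #>\<^bsub>A\<^esub> \<phi> = (T #>\<^bsub>A\<^esub> kappa i j) [^]\<^bsub>A Mod T\<^esub> card ({..<n} - {j})"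
    using partial_conjugation[OF ij(2,1,3), of "{..<n} - {j}"] by blast
  have \<phi>a: "\<phi> \<in> auto F" using \<phi> by simp
  have j: "gen j \<in> carrier F" using ij by simp
  have inner: "\<phi> x = gen j \<otimes>\<^bsub>F\<^esub> x \<otimes>\<^bsub>F\<^esub> inv\<^bsub>F\<^esub> gen j" if x: "x \<in> carrier F" for x
  proof (rule free_group_hom_eqI[OF F.is_group auto_hom[OF \<phi>a] _ _ x])
    show "(\<lambda>x. gen j \<otimes>\<^bsub>F\<^esub> x \<otimes>\<^bsub>F\<^esub> inv\<^bsub>F\<^esub> gen j) \<in> hom F F"
      using j by (auto simp: hom_def F.m_assoc)
    fix l assume "l \<in> {..<n}"
    then show "\<exists>l'. snd l' = l \<and> \<phi> [l'] = gen j \<otimes>\<^bsub>F\<^esub> [l'] \<otimes>\<^bsub>F\<^esub> inv\<^bsub>F\<^esub> gen j"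
      using gens[of l] j by (intro exI[of _ "(True, l)"]) (auto simp: F.m_assoc)
  qed
  have power: "(\<phi> [^]\<^bsub>A\<^esub> m) x = gen j [^]\<^bsub>F\<^esub> m \<otimes>\<^bsub>F\<^esub> x \<otimes>\<^bsub>F\<^esub> inv\<^bsub>F\<^esub> (gen j [^]\<^bsub>F\<^esub> m)" if x: "x \<in> carrier F" for x and m :: nat
    using x
  proof (induction m arbitrary: x)
    case 0
    then show ?case by simp
  next
    case (Suc m)
    have "\<phi> [^]\<^bsub>A\<^esub> m \<in> auto F" using A.nat_pow_closed[of \<phi> m] \<phi>a by simp
    then have "(\<phi> [^]\<^bsub>A\<^esub> Suc m) x = (\<phi> [^]\<^bsub>A\<^esub> m) (gen j \<otimes>\<^bsub>F\<^esub> x \<otimes>\<^bsub>F\<^esub> inv\<^bsub>F\<^esub> gen j)"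
      using A_apply[OF _ \<phi>a Suc.prems] inner[OF Suc.prems] by simp
    also have "\<dots> = gen j [^]\<^bsub>F\<^esub> m \<otimes>\<^bsub>F\<^esub> (gen j \<otimes>\<^bsub>F\<^esub> x \<otimes>\<^bsub>F\<^esub> inv\<^bsub>F\<^esub> gen j) \<otimes>\<^bsub>F\<^esub> inv\<^bsub>F\<^esub> (gen j [^]\<^bsub>F\<^esub> m)"
      using Suc j by simp
    also have "\<dots> = gen j [^]\<^bsub>F\<^esub> Suc m \<otimes>\<^bsub>F\<^esub> x \<otimes>\<^bsub>F\<^esub> inv\<^bsub>F\<^esub> (gen j [^]\<^bsub>F\<^esub> Suc m)"
      using Suc.prems j by (simp add: F.m_assoc F.inv_mult_group)
    finally show ?case .
  qed
  have pJ: "\<phi> [^]\<^bsub>A\<^esub> (m::nat) \<in> J i" if "\<phi> \<in> J i" for \<phi> m i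
    using that subgroup.m_closed[OF johnson_subgroup] subgroup.one_closed[OF johnson_subgroup] by (induction m) auto
  have "\<phi> [^]\<^bsub>A\<^esub> expo \<in> M"
  proof (rule M_I[OF pJ[OF \<phi>] subgroup.one_closed[OF johnson_subgroup]])
    fix x assume x: "x \<in> K"
    have a: "gen j [^]\<^bsub>F\<^esub> expo \<in> K" by (rule expo(2)[OF j])
    have "\<phi> [^]\<^bsub>A\<^esub> expo \<in> carrier A" using A.nat_pow_closed[of \<phi> expo] \<phi>a by simp
    then have "(\<phi> [^]\<^bsub>A\<^esub> expo \<otimes>\<^bsub>A\<^esub> inv\<^bsub>A\<^esub> \<one>\<^bsub>A\<^esub>) x \<otimes>\<^bsub>F\<^esub> inv\<^bsub>F\<^esub> x = gcomm F (gen j [^]\<^bsub>F\<^esub> expo) x"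
      using power[OF K_closed[OF x]] by (simp add: gcomm_def del: carrier_A)
    then show "(\<phi> [^]\<^bsub>A\<^esub> expo \<otimes>\<^bsub>A\<^esub> inv\<^bsub>A\<^esub> \<one>\<^bsub>A\<^esub>) x \<otimes>\<^bsub>F\<^esub> inv\<^bsub>F\<^esub> x \<in> KK"
      using gcomm_KK[OF a x] by simp
  qed
  then have "\<phi> \<in> T" using T_root[OF \<phi> expo(1)] M_subset_T by blast
  then have "T #>\<^bsub>A\<^esub> \<phi> = \<one>\<^bsub>A Mod T\<^esub>" using A.coset_one_iff[OF T_normal, of \<phi>] \<phi>a by simp
  then have "T #>\<^bsub>A\<^esub> (kappa i j [^]\<^bsub>A\<^esub> card ({..<n} - {j})) = \<one>\<^bsub>A Mod T\<^esub>"
    using coset h.hom_nat_pow[of "kappa i j" "card ({..<n} - {j})"] ij by simp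
  then have "kappa i j [^]\<^bsub>A\<^esub> card ({..<n} - {j}) \<in> T"
    using A.coset_one_iff[OF T_normal A.nat_pow_closed[of "kappa i j"]] ij by simp
  moreover have "card ({..<n} - {j}) > 0" using n3 ij by simp
  ultimately show ?thesis using T_root[OF kappa_J[OF ij]] by blast
qed

lemma kappa_letter_T:
  assumes i: "i < n" and m: "snd m < n" "snd m \<noteq> i"
  shows "sub i [m] (inv\<^bsub>F\<^esub> [m]) \<in> T"
proof -
  have k: "kappa i (snd m) \<in> T" using kappa_T i m by simp
  consider "m = (True, snd m)" | "m = inv_letter (True, snd m)" using snd_letter_eq[of m "(True, snd m)"] by auto
  then show ?thesis
  proof cases
    case 1
    then show ?thesis using k unfolding kappa_def by metis
  next
    case 2
    have "[m] = inv\<^bsub>F\<^esub> gen (snd m)" using 2 letter_inverse[of "(True, snd m)"] m by simp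
    then have "sub i [m] (inv\<^bsub>F\<^esub> [m]) = inv\<^bsub>A\<^esub> kappa i (snd m)"
      unfolding kappa_def using i m by (simp add: sub_inv)
    then show ?thesis using subgroup.m_inv_closed[OF T_subgroup k] by simp
  qed
qed

end

section \<open>Comparison with the general linear group over the integers\<close>

text \<open>For w the image of the generator x_l and varying i, these are the entries of column l of
  the integer matrix induced on the abelianization.\<close>

definition exponent_sum :: "nat \<Rightarrow> nat word \<Rightarrow> int" where
  "exponent_sum i w = (\<Sum>l\<leftarrow>w. if snd l = i then if fst l then 1 else - 1 else 0)"

lemma exponent_sum_Nil [simp]: "exponent_sum i [] = 0"
  by (simp add: exponent_sum_def)

lemma exponent_sum_Cons: "exponent_sum i (l # w) = exponent_sum i [l] + exponent_sum i w"
  by (simp add: exponent_sum_def)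

lemma exponent_sum_letter: "exponent_sum i [l] = (if snd l = i then if fst l then 1 else - 1 else 0)"
  by (simp add: exponent_sum_def)

lemma exponent_sum_inv_letter: "exponent_sum i [inv_letter l] = - exponent_sum i [l]"
  by (simp add: exponent_sum_letter inv_letter_def)

lemma exponent_sum_cancel_cons: "exponent_sum i (cancel_cons l w) = exponent_sum i [l] + exponent_sum i w"
proof (cases w)
  case Nil
  then show ?thesis by simp
next
  case (Cons m w')
  then show ?thesis by (simp add: exponent_sum_Cons[of i m w'] exponent_sum_Cons[of i l "m # w'"] exponent_sum_inv_letter)
qed

lemma exponent_sum_mult: "exponent_sum i (u \<otimes>\<^bsub>free_group X\<^esub> v) = exponent_sum i u + exponent_sum i v"
  unfolding mult_free_group
proof (induction u)
  case (Cons l u)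
  then show ?case by (simp add: exponent_sum_cancel_cons exponent_sum_Cons[of i l u])
qed simp

lemma exponent_sum_inv:
  assumes "w \<in> carrier (free_group X)"
  shows "exponent_sum i (inv\<^bsub>free_group X\<^esub> w) = - exponent_sum i w"
proof -
  interpret group "free_group X" by (rule group_free_group)
  have "exponent_sum i (inv\<^bsub>free_group X\<^esub> w \<otimes>\<^bsub>free_group X\<^esub> w) = 0"
    using assms by (simp add: one_free_group)
  then show ?thesis by (simp add: exponent_sum_mult)
qed

lemma exponent_sum_zero: "w \<in> carrier (free_group X) \<Longrightarrow> i \<notin> X \<Longrightarrow> exponent_sum i w = 0"
proof (induction w rule: free_group_induct)
  case one
  then show ?case by (simp add: one_free_group)
next
  case (Cons l w)
  then show ?case by (auto simp: exponent_sum_mult exponent_sum_letter)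
qed

context free_group_aut
begin

lemma exponent_sum_L1:
  assumes "w \<in> L 1"
  shows "exponent_sum i w = 0"
proof -
  have "subgroup {w \<in> carrier F. exponent_sum i w = 0} F"
  proof (rule F.subgroupI)
    have "\<one>\<^bsub>F\<^esub> \<in> {w \<in> carrier F. exponent_sum i w = 0}" by (simp add: one_free_group[symmetric]) (simp add: one_free_group)
    then show "{w \<in> carrier F. exponent_sum i w = 0} \<noteq> {}" by blast
  qed (auto simp: exponent_sum_mult exponent_sum_inv)
  then have "L (Suc 0) \<subseteq> {w \<in> carrier F. exponent_sum i w = 0}"
    by (rule F.lower_central_Suc_least) (simp add: gcomm_def exponent_sum_mult exponent_sum_inv)
  then show ?thesis using assms by auto
qed

lemma exponent_sum_J:
  assumes "\<phi> \<in> J (Suc 0)" "x \<in> carrier F"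
  shows "exponent_sum i (\<phi> x) = exponent_sum i x"
  using johnson_coset[OF assms] exponent_sum_L1[of "\<phi> x \<otimes>\<^bsub>F\<^esub> inv\<^bsub>F\<^esub> x" i] johnsonD[OF assms]
    exponent_sum_mult[where i = i and X = "{..<n}" and u = "\<phi> x \<otimes>\<^bsub>F\<^esub> inv\<^bsub>F\<^esub> x" and v = x] by simp

lemma transv_inv_right:
  assumes "snd l < n" "snd m < n" "snd l \<noteq> snd m"
  shows "transv l (inv_letter m) = inv\<^bsub>A\<^esub> transv l m"
  using assms by (simp add: transv_def sub_inv)

text \<open>The part of the commutation relation that holds in Aut(F_n) itself; equal targets are
  treated modulo \<open>T\<close>.\<close>

lemma transv_commute:
  assumes "snd l < n" "snd m < n" "snd k < n" "snd q < n"
    and "snd l \<noteq> snd m" "snd k \<noteq> snd q" "snd l \<noteq> snd q" "snd m \<noteq> snd k" "snd l \<noteq> snd k"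
  shows "transv l m \<otimes>\<^bsub>A\<^esub> transv k q = transv k q \<otimes>\<^bsub>A\<^esub> transv l m"
proof (rule auto_eqI)
  have aut: "transv l m \<in> auto F" "transv k q \<in> auto F" using assms by simp_all
  show "transv l m \<otimes>\<^bsub>A\<^esub> transv k q \<in> auto F" "transv k q \<otimes>\<^bsub>A\<^esub> transv l m \<in> auto F"
    using aut by simp_all
  fix i assume i: "i < n"
  consider "i = snd l" | "i = snd k" | "i \<noteq> snd l" "i \<noteq> snd k" by blast
  then show "\<exists>l'. snd l' = i \<and> (transv l m \<otimes>\<^bsub>A\<^esub> transv k q) [l'] = (transv k q \<otimes>\<^bsub>A\<^esub> transv l m) [l']"
  proof cases
    case 1
    then show ?thesis using aut assms by (intro exI[of _ l]) simp
  next
    case 2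
    then show ?thesis using aut assms by (intro exI[of _ k]) simp
  next
    case 3
    then show ?thesis using aut assms i by (intro exI[of _ "(True, i)"]) simp
  qed
qed

lemma transv_triple:
  assumes "snd l < n" "snd m < n" "snd k < n" "snd l \<noteq> snd m" "snd k \<noteq> snd m" "snd l \<noteq> snd k"
  shows "transv m k \<otimes>\<^bsub>A\<^esub> transv l m = transv l m \<otimes>\<^bsub>A\<^esub> transv m k \<otimes>\<^bsub>A\<^esub> transv l k"
proof (rule auto_eqI)
  have aut: "transv l m \<in> auto F" "transv m k \<in> auto F" "transv l k \<in> auto F" using assms by simp_all
  show "transv m k \<otimes>\<^bsub>A\<^esub> transv l m \<in> auto F" "transv l m \<otimes>\<^bsub>A\<^esub> transv m k \<otimes>\<^bsub>A\<^esub> transv l k \<in> auto F"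
    using aut by simp_all
  fix i assume i: "i < n"
  consider "i = snd l" | "i = snd m" | "i \<noteq> snd l" "i \<noteq> snd m" by blast
  then show "\<exists>l'. snd l' = i \<and> (transv m k \<otimes>\<^bsub>A\<^esub> transv l m) [l'] = (transv l m \<otimes>\<^bsub>A\<^esub> transv m k \<otimes>\<^bsub>A\<^esub> transv l k) [l']"
  proof cases
    case 1
    then show ?thesis using aut assms by (intro exI[of _ l]) (simp add: F.m_assoc)
  next
    case 2
    then show ?thesis using aut assms by (intro exI[of _ m]) simp
  next
    case 3
    then show ?thesis using aut assms i by (intro exI[of _ "(True, i)"]) simp
  qed
qed

lemma transv_monomial:
  assumes w: "w \<in> monomials" and lm: "snd l < n" "snd m < n" "snd l \<noteq> snd m"
  shows "transv (act w l) (act w m) \<otimes>\<^bsub>A\<^esub> w = w \<otimes>\<^bsub>A\<^esub> transv l m"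
proof (rule auto_eqI)
  have ne: "snd (act w l) \<noteq> snd (act w m)" using act_snd[OF w] lm by simp
  have aut: "transv (act w l) (act w m) \<in> auto F" "w \<in> auto F" "transv l m \<in> auto F"
    using lm w ne act(2)[OF w] by simp_all
  show "transv (act w l) (act w m) \<otimes>\<^bsub>A\<^esub> w \<in> auto F" "w \<otimes>\<^bsub>A\<^esub> transv l m \<in> auto F"
    using aut by simp_all
  fix i assume i: "i < n"
  show "\<exists>k. snd k = i \<and> (transv (act w l) (act w m) \<otimes>\<^bsub>A\<^esub> w) [k] = (w \<otimes>\<^bsub>A\<^esub> transv l m) [k]"
  proof (cases "i = snd l")
    case True
    have "(transv (act w l) (act w m) \<otimes>\<^bsub>A\<^esub> w) [l] = [act w l] \<otimes>\<^bsub>F\<^esub> [act w m]"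
      using aut lm ne act[OF w lm(1)] act(2)[OF w lm(2)] by simp
    moreover have "(w \<otimes>\<^bsub>A\<^esub> transv l m) [l] = [act w l] \<otimes>\<^bsub>F\<^esub> [act w m]"
      using aut lm act(1)[OF w lm(1)] act(1)[OF w lm(2)] auto_mult[OF aut(2)] by simp
    ultimately show ?thesis using True by (intro exI[of _ l]) simp
  next
    case False
    let ?k = "(True, i)"
    have k: "snd ?k < n" using i by simp
    have "snd (act w ?k) \<noteq> snd (act w l)" using act_snd[OF w k lm(1)] False by simp
    then have "(transv (act w l) (act w m) \<otimes>\<^bsub>A\<^esub> w) [?k] = [act w ?k]"
      using aut ne act[OF w k] act(2)[OF w lm(1)] act(2)[OF w lm(2)] i by simp
    moreover have "(w \<otimes>\<^bsub>A\<^esub> transv l m) [?k] = [act w ?k]"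
      using aut lm act(1)[OF w k] False i by simp
    ultimately show ?thesis by (intro exI[of _ ?k]) simp
  qed
qed

section \<open>Subgroups supported on an initial segment of the basis\<close>

definition low_monomials :: "nat \<Rightarrow> (nat word \<Rightarrow> nat word) set" where
  "low_monomials m = {w \<in> monomials. \<forall>i. m \<le> i \<longrightarrow> i < n \<longrightarrow> w (gen i) = gen i}"

definition low_gens :: "nat \<Rightarrow> (nat word \<Rightarrow> nat word) set" where
  "low_gens m = {transv l k |l k. snd l < m \<and> snd k < m \<and> snd l \<noteq> snd k} \<union> low_monomials m"

text \<open>Given by generators because the descent works through words in them; \<open>stab\<close>
  records how its elements act. The extreme cases are the trivial group and, by Nielsen reduction,
  all of Aut(F_n).\<close>

definition low :: "nat \<Rightarrow> (nat word \<Rightarrow> nat word) set" where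
  "low m = generate A (low_gens m)"

definition stab :: "nat \<Rightarrow> (nat word \<Rightarrow> nat word) set" where
  "stab m = {c \<in> auto F. (\<forall>i. m \<le> i \<longrightarrow> i < n \<longrightarrow> c (gen i) = gen i) \<and>
    c ` carrier (free_group {..<m}) = carrier (free_group {..<m})}"

lemma low_monomials_monomials: "w \<in> low_monomials m \<Longrightarrow> w \<in> monomials"
  by (simp add: low_monomials_def)

lemma low_monomials_subgroup: "subgroup (low_monomials m) A"
proof (rule A.subgroupI)
  show "low_monomials m \<subseteq> carrier A" using low_monomials_monomials by auto
  have "\<one>\<^bsub>A\<^esub> \<in> low_monomials m"
    using subgroup.one_closed[OF monomials_subgroup] unfolding low_monomials_def by simp
  then show "low_monomials m \<noteq> {}" by blast
  fix w assume w: "w \<in> low_monomials m"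
  then have "(inv\<^bsub>A\<^esub> w) (gen i) = gen i" if "m \<le> i" "i < n" for i
    using that A_inv_apply(1)[of w "gen i"] low_monomials_monomials[OF w] unfolding low_monomials_def by simp
  then show "inv\<^bsub>A\<^esub> w \<in> low_monomials m"
    using subgroup.m_inv_closed[OF monomials_subgroup low_monomials_monomials[OF w]] unfolding low_monomials_def by blast
next
  fix v w assume vw: "v \<in> low_monomials m" "w \<in> low_monomials m"
  then have "(v \<otimes>\<^bsub>A\<^esub> w) (gen i) = gen i" if "m \<le> i" "i < n" for i
    using that low_monomials_monomials[OF vw(1)] low_monomials_monomials[OF vw(2)] unfolding low_monomials_def by simp
  then show "v \<otimes>\<^bsub>A\<^esub> w \<in> low_monomials m"
    using subgroup.m_closed[OF monomials_subgroup low_monomials_monomials[OF vw(1)] low_monomials_monomials[OF vw(2)]]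
    unfolding low_monomials_def by blast
qed

lemma low_carrier: "m \<le> n \<Longrightarrow> carrier (free_group {..<m}) \<subseteq> carrier F"
  by (rule free_group_carrier_mono) auto

lemma image_low:
  assumes m: "m \<le> n" and c: "c \<in> auto F" and letters: "\<And>l. snd l < m \<Longrightarrow> c [l] \<in> carrier (free_group {..<m})"
  shows "c ` carrier (free_group {..<m}) \<subseteq> carrier (free_group {..<m})"
proof (rule image_subsetI)
  interpret G: group "free_group {..<m}" by (rule group_free_group)
  fix w assume "w \<in> carrier (free_group {..<m})"
  then show "c w \<in> carrier (free_group {..<m})"
  proof (induction w rule: free_group_induct)
    case one
    then show ?case using auto_one[OF c] G.one_closed by (simp add: one_free_group)
  next
    case (Cons l w)
    have "c ([l] \<otimes>\<^bsub>free_group {..<m}\<^esub> w) = c [l] \<otimes>\<^bsub>free_group {..<m}\<^esub> c w"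
      using auto_mult[OF c, of "[l]" w] Cons low_carrier[OF m] m by (auto simp: mult_free_group)
    then show ?case using Cons letters by simp
  qed
qed

lemma stabI:
  assumes m: "m \<le> n" and c: "c \<in> auto F" "\<And>i. m \<le> i \<Longrightarrow> i < n \<Longrightarrow> c (gen i) = gen i"
    and 1: "\<And>l. snd l < m \<Longrightarrow> c [l] \<in> carrier (free_group {..<m})"
    and 2: "\<And>l. snd l < m \<Longrightarrow> (inv\<^bsub>A\<^esub> c) [l] \<in> carrier (free_group {..<m})"
  shows "c \<in> stab m"
proof -
  note i = image_low[OF m c(1) 1] image_low[OF m A_closed(2)[OF c(1)] 2]
  have "carrier (free_group {..<m}) \<subseteq> c ` carrier (free_group {..<m})"
  proof
    fix w assume w: "w \<in> carrier (free_group {..<m})"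
    then have "w = c ((inv\<^bsub>A\<^esub> c) w)" using A_inv_apply(2)[OF c(1)] low_carrier[OF m] by auto
    then show "w \<in> c ` carrier (free_group {..<m})" using i(2) w by blast
  qed
  then show ?thesis using i c unfolding stab_def by blast
qed

lemma stab_subgroup:
  assumes m: "m \<le> n"
  shows "subgroup (stab m) A"
proof (rule A.subgroupI)
  let ?V = "carrier (free_group {..<m})"
  have V: "?V \<subseteq> carrier F" by (rule low_carrier[OF m])
  show "stab m \<subseteq> carrier A" unfolding stab_def by auto
  have "\<one>\<^bsub>A\<^esub> ` ?V = (\<lambda>w. w) ` ?V" by (rule image_cong[OF refl]) (rule A_one_apply[OF subsetD[OF V]])
  then have "\<one>\<^bsub>A\<^esub> \<in> stab m" unfolding stab_def by simp
  then show "stab m \<noteq> {}" by blast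
  fix c assume "c \<in> stab m"
  then have c: "c \<in> auto F" "\<And>i. m \<le> i \<Longrightarrow> i < n \<Longrightarrow> c (gen i) = gen i" "c ` ?V = ?V" unfolding stab_def by auto
  have "(inv\<^bsub>A\<^esub> c) ` c ` ?V = ?V"
    unfolding image_image using image_cong[OF refl A_inv_apply(1)[OF c(1) subsetD[OF V]], of ?V] by simp
  then have "(inv\<^bsub>A\<^esub> c) ` ?V = ?V" using c(3) by simp
  moreover have "(inv\<^bsub>A\<^esub> c) (gen i) = gen i" if "m \<le> i" "i < n" for i
    using A_inv_apply(1)[OF c(1), of "gen i"] c(2)[OF that] that by simp
  ultimately show "inv\<^bsub>A\<^esub> c \<in> stab m" unfolding stab_def using A_closed(2)[OF c(1)] by blast
next
  let ?V = "carrier (free_group {..<m})"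
  fix c d assume "c \<in> stab m" "d \<in> stab m"
  then have c: "c \<in> auto F" "\<And>i. m \<le> i \<Longrightarrow> i < n \<Longrightarrow> c (gen i) = gen i" "c ` ?V = ?V"
    and d: "d \<in> auto F" "\<And>i. m \<le> i \<Longrightarrow> i < n \<Longrightarrow> d (gen i) = gen i" "d ` ?V = ?V" unfolding stab_def by auto
  have "(c \<otimes>\<^bsub>A\<^esub> d) ` ?V = c ` d ` ?V"
    unfolding image_image by (rule image_cong[OF refl]) (rule A_apply[OF c(1) d(1) subsetD[OF low_carrier[OF m]]])
  then have "(c \<otimes>\<^bsub>A\<^esub> d) ` ?V = ?V" using c(3) d(3) by simp
  moreover have "(c \<otimes>\<^bsub>A\<^esub> d) (gen i) = gen i" if "m \<le> i" "i < n" for i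
    using A_apply[OF c(1) d(1), of "gen i"] c(2) d(2) that by simp
  ultimately show "c \<otimes>\<^bsub>A\<^esub> d \<in> stab m" unfolding stab_def using A_closed(1)[OF c(1) d(1)] by blast
qed

lemma transv_low:
  assumes m: "m \<le> n" and lk: "snd l < m" "snd k < m" "snd l \<noteq> snd k" and l': "snd l' < m"
  shows "transv l k [l'] \<in> carrier (free_group {..<m})"
proof -
  interpret G: group "free_group {..<m}" by (rule group_free_group)
  have sg: "subgroup (carrier (free_group {..<m})) F" using m by (intro subgroup_free_group) auto
  have c: "[l] \<in> carrier (free_group {..<m})" "[k] \<in> carrier (free_group {..<m})" using lk by auto
  have lkn: "snd l < n" "snd k < n" "snd l' < n" using lk l' m by auto
  have p: "[l] \<otimes>\<^bsub>F\<^esub> [k] \<in> carrier (free_group {..<m})" by (rule subgroup.m_closed[OF sg c])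
  show ?thesis
  proof (cases "snd l' = snd l")
    case True
    then consider "l' = l" | "l' = inv_letter l" using snd_letter_eq by blast
    then show ?thesis
    proof cases
      case 1
      then show ?thesis using p lk lkn by simp
    next
      case 2
      then have "transv l k [l'] = inv\<^bsub>F\<^esub> ([l] \<otimes>\<^bsub>F\<^esub> [k])" using lk lkn by simp
      then show ?thesis using subgroup.m_inv_closed[OF sg p] by simp
    qed
  next
    case False
    then show ?thesis using lk lkn l' by simp
  qed
qed

lemma low_monomials_low:
  assumes m: "m \<le> n" and w: "w \<in> low_monomials m" and l: "snd l < m"
  shows "w [l] \<in> carrier (free_group {..<m})"
proof -
  have wm: "w \<in> monomials" by (rule low_monomials_monomials[OF w])
  have ln: "snd l < n" using l m by simp
  have "snd (act w l) < m"
  proof (rule ccontr)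
    assume a: "\<not> snd (act w l) < m"
    let ?i = "snd (act w l)"
    have i: "m \<le> ?i" "?i < n" using a act(2)[OF wm ln] by auto
    then have "w (gen ?i) = gen ?i" using w unfolding low_monomials_def by blast
    then have "act w (True, ?i) = (True, ?i)" unfolding act_def by simp
    then have "snd (act w (True, ?i)) = snd (act w l)" by simp
    then have "?i = snd l" using act_snd[OF wm _ ln, of "(True, ?i)"] i by simp
    then show False using i l by simp
  qed
  then show ?thesis using act(1)[OF wm ln] by simp
qed

lemma low_gens_stab:
  assumes m: "m \<le> n"
  shows "low_gens m \<subseteq> stab m"
proof
  fix c assume "c \<in> low_gens m"
  then consider l k where "c = transv l k" "snd l < m" "snd k < m" "snd l \<noteq> snd k" | "c \<in> low_monomials m"
    unfolding low_gens_def by blast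
  then show "c \<in> stab m"
  proof cases
    case 1
    have n: "snd l < n" "snd k < n" using 1 m by auto
    have "inv\<^bsub>A\<^esub> c = transv l (inv_letter k)" using 1 n transv_inv_right by simp
    then show ?thesis
      using 1 n transv_low[OF m 1(2-4)] transv_low[OF m, of l "inv_letter k"] by (intro stabI[OF m]) auto
  next
    case 2
    show ?thesis
    proof (rule stabI[OF m])
      show "c \<in> auto F" using low_monomials_monomials[OF 2] by simp
      show "c (gen i) = gen i" if "m \<le> i" "i < n" for i using 2 that unfolding low_monomials_def by blast
      show "c [l] \<in> carrier (free_group {..<m})" if "snd l < m" for l by (rule low_monomials_low[OF m 2 that])
      show "(inv\<^bsub>A\<^esub> c) [l] \<in> carrier (free_group {..<m})" if "snd l < m" for l
        by (rule low_monomials_low[OF m subgroup.m_inv_closed[OF low_monomials_subgroup 2] that])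
    qed
  qed
qed

lemma low_stab: "m \<le> n \<Longrightarrow> low m \<subseteq> stab m"
  unfolding low_def by (rule A.generate_subgroup_incl[OF low_gens_stab stab_subgroup])

lemma low_gens_auto: "m \<le> n \<Longrightarrow> low_gens m \<subseteq> carrier A"
  using low_gens_stab subgroup.subset[OF stab_subgroup] by blast

lemma low_subgroup: "m \<le> n \<Longrightarrow> subgroup (low m) A"
  unfolding low_def by (rule A.generate_is_subgroup[OF low_gens_auto])

lemma low_n: "low n = auto F"
proof
  show "low n \<subseteq> auto F" using subgroup.subset[OF low_subgroup[OF order_refl]] unfolding carrier_A .
  have "{transv l m |l m. snd l < n \<and> snd m < n \<and> snd l \<noteq> snd m} \<union> monomials \<subseteq> low_gens n"
    unfolding low_gens_def low_monomials_def by auto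
  then show "auto F \<subseteq> low n"
    unfolding low_def using auto_generated A.mono_generate by blast
qed

lemma low_0:
  assumes "c \<in> low 0"
  shows "c = \<one>\<^bsub>A\<^esub>"
proof (rule auto_eqI)
  have c: "c \<in> stab 0" using low_stab[of 0] assms by auto
  then show "c \<in> auto F" unfolding stab_def by simp
  fix i assume "i < n"
  then show "\<exists>l. snd l = i \<and> c [l] = \<one>\<^bsub>A\<^esub> [l]" using c unfolding stab_def by (intro exI[of _ "(True, i)"]) simp
qed simp

text \<open>Conjugation by c turns x_m -> x_m u into x_m -> x_m c(u), because c fixes x_m and
  preserves the group of the first m generators. This is the semidirect product rule behind
  \<open>parab m\<close>.\<close>

lemma stab_sub:
  assumes m: "m < n" and c: "c \<in> stab m" and u: "u \<in> carrier (free_group {..<m})"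
  shows "c \<otimes>\<^bsub>A\<^esub> sub m \<one>\<^bsub>F\<^esub> u = sub m \<one>\<^bsub>F\<^esub> (c u) \<otimes>\<^bsub>A\<^esub> c" "c u \<in> carrier (free_group {..<m})"
proof -
  have sub_Fix: "carrier (free_group {..<m}) \<subseteq> Fix m" using m by (intro free_group_carrier_mono) auto
  have cc: "c \<in> auto F" "c (gen i) = gen i" if "m \<le> i" "i < n" for i using c that unfolding stab_def by auto
  have ca: "c \<in> auto F" using c unfolding stab_def by simp
  have cV: "c w \<in> carrier (free_group {..<m})" if "w \<in> carrier (free_group {..<m})" for w using c that unfolding stab_def by auto
  show cu: "c u \<in> carrier (free_group {..<m})" by (rule cV[OF u])
  have f: "u \<in> Fix m" "c u \<in> Fix m" using u cu sub_Fix by auto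
  have s: "sub m \<one>\<^bsub>F\<^esub> u \<in> auto F" "sub m \<one>\<^bsub>F\<^esub> (c u) \<in> auto F" using m f by simp_all
  show "c \<otimes>\<^bsub>A\<^esub> sub m \<one>\<^bsub>F\<^esub> u = sub m \<one>\<^bsub>F\<^esub> (c u) \<otimes>\<^bsub>A\<^esub> c"
  proof (rule auto_eqI)
    show "c \<otimes>\<^bsub>A\<^esub> sub m \<one>\<^bsub>F\<^esub> u \<in> auto F" "sub m \<one>\<^bsub>F\<^esub> (c u) \<otimes>\<^bsub>A\<^esub> c \<in> auto F" using ca s by simp_all
    fix i assume i: "i < n"
    have x: "gen i \<in> carrier F" using i by simp
    have "(c \<otimes>\<^bsub>A\<^esub> sub m \<one>\<^bsub>F\<^esub> u) (gen i) = (sub m \<one>\<^bsub>F\<^esub> (c u) \<otimes>\<^bsub>A\<^esub> c) (gen i)"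
      unfolding A_apply[OF ca s(1) x] A_apply[OF s(2) ca x]
    proof -
      consider "i = m" | "i < m" | "i > m" by linarith
      then show "c (sub m \<one>\<^bsub>F\<^esub> u (gen i)) = sub m \<one>\<^bsub>F\<^esub> (c u) (c (gen i))"
      proof cases
        case 1
        then show ?thesis using m f cc(2)[of m] auto_mult[OF ca, of "gen m" u] by simp
      next
        case 2
        have "c (gen i) \<in> Fix m" using cV[of "gen i"] 2 sub_Fix by auto
        then show ?thesis using 2 m f i by simp
      next
        case 3
        then show ?thesis using m f i cc(2)[of i] by simp
      qed
    qed
    then show "\<exists>l. snd l = i \<and> (c \<otimes>\<^bsub>A\<^esub> sub m \<one>\<^bsub>F\<^esub> u) [l] = (sub m \<one>\<^bsub>F\<^esub> (c u) \<otimes>\<^bsub>A\<^esub> c) [l]"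
      by (intro exI[of _ "(True, i)"]) simp
  qed
qed

text \<open>The counterpart of the integer matrices of rank m + 1 whose last row is a unit vector: c
  supplies the block of rank m, and u the last column.\<close>

definition parab :: "nat \<Rightarrow> (nat word \<Rightarrow> nat word) set" where
  "parab m = {sub m \<one>\<^bsub>F\<^esub> u \<otimes>\<^bsub>A\<^esub> c |u c. u \<in> carrier (free_group {..<m}) \<and> c \<in> low m}"

lemma parab_subgroup:
  assumes m: "m < n"
  shows "subgroup (parab m) A"
proof -
  let ?V = "carrier (free_group {..<m})"
  have V_Fix: "?V \<subseteq> Fix m" using m by (intro free_group_carrier_mono) auto
  have sg: "subgroup ?V F" using m by (intro subgroup_free_group) auto
  note lsg = low_subgroup[OF less_imp_le[OF m]]
  have lst: "low m \<subseteq> stab m" using low_stab m by simp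
  have lc: "c \<in> auto F" if "c \<in> low m" for c using lst that unfolding stab_def by blast
  have sa: "sub m \<one>\<^bsub>F\<^esub> u \<in> auto F" if "u \<in> ?V" for u using that V_Fix m by auto
  have comp: "sub m \<one>\<^bsub>F\<^esub> u \<otimes>\<^bsub>A\<^esub> sub m \<one>\<^bsub>F\<^esub> v = sub m \<one>\<^bsub>F\<^esub> (u \<otimes>\<^bsub>F\<^esub> v)" if "u \<in> ?V" "v \<in> ?V" for u v
    using that V_Fix m by (subst sub_comp) auto
  show ?thesis
  proof (rule A.subgroupI)
    show "parab m \<subseteq> carrier A" unfolding parab_def carrier_A using sa lc A_closed(1) by blast
    have "\<one>\<^bsub>F\<^esub> \<in> ?V" "\<one>\<^bsub>A\<^esub> \<in> low m"
      using subgroup.one_closed[OF sg] subgroup.one_closed[OF lsg] by auto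
    then show "parab m \<noteq> {}" unfolding parab_def by blast
  next
    fix p assume "p \<in> parab m"
    then obtain u c where p: "p = sub m \<one>\<^bsub>F\<^esub> u \<otimes>\<^bsub>A\<^esub> c" and u: "u \<in> ?V" and c: "c \<in> low m" unfolding parab_def by blast
    have ic: "inv\<^bsub>A\<^esub> c \<in> low m" by (rule subgroup.m_inv_closed[OF lsg c])
    have iu: "inv\<^bsub>F\<^esub> u \<in> ?V" by (rule subgroup.m_inv_closed[OF sg u])
    have "inv\<^bsub>A\<^esub> p = inv\<^bsub>A\<^esub> c \<otimes>\<^bsub>A\<^esub> sub m \<one>\<^bsub>F\<^esub> (inv\<^bsub>F\<^esub> u)"
      unfolding p using A.inv_mult_group[of "sub m \<one>\<^bsub>F\<^esub> u" c] sa[OF u] lc[OF c] sub_inv[OF m, of "\<one>\<^bsub>F\<^esub>" u] u V_Fix by auto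
    also have "\<dots> = sub m \<one>\<^bsub>F\<^esub> ((inv\<^bsub>A\<^esub> c) (inv\<^bsub>F\<^esub> u)) \<otimes>\<^bsub>A\<^esub> inv\<^bsub>A\<^esub> c"
      using ic lst by (intro stab_sub(1)[OF m _ iu]) blast
    finally show "inv\<^bsub>A\<^esub> p \<in> parab m"
      unfolding parab_def using stab_sub(2)[OF m _ iu, of "inv\<^bsub>A\<^esub> c"] ic lst by blast
  next
    fix p q assume "p \<in> parab m" "q \<in> parab m"
    then obtain u c v d where p: "p = sub m \<one>\<^bsub>F\<^esub> u \<otimes>\<^bsub>A\<^esub> c" and u: "u \<in> ?V" and c: "c \<in> low m"
      and q: "q = sub m \<one>\<^bsub>F\<^esub> v \<otimes>\<^bsub>A\<^esub> d" and v: "v \<in> ?V" and d: "d \<in> low m" unfolding parab_def by blast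
    have cs: "c \<in> stab m" using c lst by blast
    have cv: "c v \<in> ?V" by (rule stab_sub(2)[OF m cs v])
    have car: "sub m \<one>\<^bsub>F\<^esub> u \<in> carrier A" "sub m \<one>\<^bsub>F\<^esub> v \<in> carrier A" "sub m \<one>\<^bsub>F\<^esub> (c v) \<in> carrier A" "c \<in> carrier A" "d \<in> carrier A"
      using sa u v cv lc c d by auto
    have "p \<otimes>\<^bsub>A\<^esub> q = sub m \<one>\<^bsub>F\<^esub> u \<otimes>\<^bsub>A\<^esub> (c \<otimes>\<^bsub>A\<^esub> sub m \<one>\<^bsub>F\<^esub> v) \<otimes>\<^bsub>A\<^esub> d"
      unfolding p q using car by (simp only: A.m_assoc A.m_closed)
    also have "\<dots> = (sub m \<one>\<^bsub>F\<^esub> u \<otimes>\<^bsub>A\<^esub> sub m \<one>\<^bsub>F\<^esub> (c v)) \<otimes>\<^bsub>A\<^esub> (c \<otimes>\<^bsub>A\<^esub> d)"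
      unfolding stab_sub(1)[OF m cs v] using car by (simp only: A.m_assoc A.m_closed)
    also have "\<dots> = sub m \<one>\<^bsub>F\<^esub> (u \<otimes>\<^bsub>F\<^esub> c v) \<otimes>\<^bsub>A\<^esub> (c \<otimes>\<^bsub>A\<^esub> d)" unfolding comp[OF u cv] ..
    finally show "p \<otimes>\<^bsub>A\<^esub> q \<in> parab m"
      unfolding parab_def using subgroup.m_closed[OF sg u cv] subgroup.m_closed[OF lsg c d] by blast
  qed
qed

end

section \<open>Steinberg relations modulo the torsion classes\<close>

context homological
begin

abbreviation Q :: "(nat word \<Rightarrow> nat word) set monoid" where "Q \<equiv> A Mod T"
abbreviation cl :: "(nat word \<Rightarrow> nat word) \<Rightarrow> (nat word \<Rightarrow> nat word) set" where "cl \<phi> \<equiv> T #>\<^bsub>A\<^esub> \<phi>"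

text \<open>In Aut(F_n) the two transvections multiply the same generator from the left and from the
  right, and together they conjugate it by m. That partial conjugation is in
  \<open>T\<close>.\<close>

lemma cl_transv_inv_left:
  assumes "snd l < n" "snd m < n" "snd l \<noteq> snd m"
  shows "cl (transv (inv_letter l) m) = inv\<^bsub>Q\<^esub> cl (transv l m)"
proof -
  have aut: "transv (inv_letter l) m \<in> auto F" "transv l m \<in> auto F" using assms by simp_all
  have f: "[m] \<in> Fix (snd l)" using assms by simp
  have "transv (inv_letter l) m \<otimes>\<^bsub>A\<^esub> transv l m = sub (snd l) (inv\<^bsub>F\<^esub> [m]) [m]"
  proof -
    have "fst (inv_letter l) \<longleftrightarrow> \<not> fst l" by (simp add: inv_letter_def)
    moreover have "inv\<^bsub>F\<^esub> [m] \<in> Fix (snd l)" using f by simp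
    ultimately show ?thesis using assms f by (cases "fst l") (simp_all add: transv_def sub_comp)
  qed
  also have "\<dots> = inv\<^bsub>A\<^esub> sub (snd l) [m] (inv\<^bsub>F\<^esub> [m])"
    using sub_inv[of "snd l" "[m]" "inv\<^bsub>F\<^esub> [m]"] assms f by simp
  also have "\<dots> \<in> T"
    using kappa_letter_T assms by (intro subgroup.m_inv_closed[OF T_subgroup]) simp
  finally have "cl (transv (inv_letter l) m) \<otimes>\<^bsub>Q\<^esub> cl (transv l m) = \<one>\<^bsub>Q\<^esub>"
    using A.coset_one_iff[OF T_normal, of "transv (inv_letter l) m \<otimes>\<^bsub>A\<^esub> transv l m"] aut by simp
  then show ?thesis
    using h.hom_closed[of "transv l m"] h.hom_closed[of "transv (inv_letter l) m"] aut
    by (intro h.H.inv_equality[symmetric]) simp_all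
qed

lemma cl_transv_inv_right:
  assumes "snd l < n" "snd m < n" "snd l \<noteq> snd m"
  shows "cl (transv l (inv_letter m)) = inv\<^bsub>Q\<^esub> cl (transv l m)"
  using transv_inv_right[OF assms] h.hom_inv[of "transv l m"] assms by simp

text \<open>The commutator of the two transvections multiplies the generator by a commutator of [m]
  and [q], on the right or on the left according to the sign of l, and such substitutions are in
  \<open>T\<close>.\<close>

lemma cl_transv_commute_same:
  assumes "snd l < n" "snd m < n" "snd q < n" "snd l \<noteq> snd m" "snd l \<noteq> snd q"
  shows "cl (transv l m) \<otimes>\<^bsub>Q\<^esub> cl (transv l q) = cl (transv l q) \<otimes>\<^bsub>Q\<^esub> cl (transv l m)"
proof -
  have aut: "transv l m \<in> auto F" "transv l q \<in> auto F" using assms by simp_all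
  have f: "[m] \<in> Fix (snd l)" "[q] \<in> Fix (snd l)" "inv\<^bsub>F\<^esub> [m] \<in> Fix (snd l)" "inv\<^bsub>F\<^esub> [q] \<in> Fix (snd l)"
    using assms by (simp_all del: letter_inverse)
  have one: "\<one>\<^bsub>F\<^esub> \<in> L 1" by (rule subgroup.one_closed[OF F.lower_central_subgroup])
  have i: "snd l < n" using assms by simp
  have "gcomm A (transv l m) (transv l q) \<in> T"
  proof (cases "fst l")
    case True
    then have "gcomm A (transv l m) (transv l q) = sub (snd l) \<one>\<^bsub>F\<^esub> (gcomm F [m] [q])"
      unfolding gcomm_def transv_def using f i by (simp add: sub_comp sub_inv)
    also have "\<dots> \<in> T"
      using f i gcomm_L1[of "[m]" "[q]"] assms one by (intro sub_commutator_in_T) (auto simp: gcomm_def)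
    finally show ?thesis .
  next
    case False
    then have "gcomm A (transv l m) (transv l q) =
        sub (snd l) ([q] \<otimes>\<^bsub>F\<^esub> ([m] \<otimes>\<^bsub>F\<^esub> (inv\<^bsub>F\<^esub> [q] \<otimes>\<^bsub>F\<^esub> inv\<^bsub>F\<^esub> [m]))) \<one>\<^bsub>F\<^esub>"
      unfolding gcomm_def transv_def using f i assms by (simp add: sub_comp sub_inv F.m_assoc)
    also have "[q] \<otimes>\<^bsub>F\<^esub> ([m] \<otimes>\<^bsub>F\<^esub> (inv\<^bsub>F\<^esub> [q] \<otimes>\<^bsub>F\<^esub> inv\<^bsub>F\<^esub> [m])) = gcomm F [q] [m]"
      using assms by (simp add: gcomm_def F.m_assoc)
    also have "sub (snd l) (gcomm F [q] [m]) \<one>\<^bsub>F\<^esub> \<in> T"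
      using f i gcomm_L1[of "[q]" "[m]"] assms one by (intro sub_commutator_in_T) (auto simp: gcomm_def)
    finally show ?thesis .
  qed
  then show ?thesis using aut by (intro A.coset_commute[OF T_normal]) simp_all
qed

lemma cl_transv_commute:
  assumes "snd l < n" "snd m < n" "snd p < n" "snd q < n"
    and "snd l \<noteq> snd m" "snd p \<noteq> snd q" "snd l \<noteq> snd q" "snd m \<noteq> snd p"
  shows "cl (transv l m) \<otimes>\<^bsub>Q\<^esub> cl (transv p q) = cl (transv p q) \<otimes>\<^bsub>Q\<^esub> cl (transv l m)"
proof -
  have aut: "transv l m \<in> carrier A" "transv p q \<in> carrier A" using assms by simp_all
  consider "snd l \<noteq> snd p" | "l = p" | "l = inv_letter p" using snd_letter_eq[of l p] by blast
  then show ?thesis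
  proof cases
    case 1
    then have "transv l m \<otimes>\<^bsub>A\<^esub> transv p q = transv p q \<otimes>\<^bsub>A\<^esub> transv l m" using assms by (intro transv_commute)
    then show ?thesis using h.hom_mult[OF aut] h.hom_mult[OF aut(2,1)] by simp
  next
    case 2
    then show ?thesis using cl_transv_commute_same[of l m q] assms by simp
  next
    case 3
    have c: "cl (transv p m) \<in> carrier Q" "cl (transv p q) \<in> carrier Q"
      using h.hom_closed[of "transv p m"] h.hom_closed[of "transv p q"] assms 3 by simp_all
    have "cl (transv l m) = inv\<^bsub>Q\<^esub> cl (transv p m)" using cl_transv_inv_left[of p m] 3 assms by simp
    moreover have comm: "cl (transv p m) \<otimes>\<^bsub>Q\<^esub> cl (transv p q) = cl (transv p q) \<otimes>\<^bsub>Q\<^esub> cl (transv p m)"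
      using cl_transv_commute_same[of p m q] assms 3 by simp
    have "inv\<^bsub>Q\<^esub> cl (transv p m) \<otimes>\<^bsub>Q\<^esub> cl (transv p q) = cl (transv p q) \<otimes>\<^bsub>Q\<^esub> inv\<^bsub>Q\<^esub> cl (transv p m)"
    proof -
      have "cl (transv p q) = inv\<^bsub>Q\<^esub> cl (transv p m) \<otimes>\<^bsub>Q\<^esub> (cl (transv p q) \<otimes>\<^bsub>Q\<^esub> cl (transv p m))"
        unfolding comm[symmetric] using c by simp
      then have "cl (transv p q) \<otimes>\<^bsub>Q\<^esub> inv\<^bsub>Q\<^esub> cl (transv p m) =
          inv\<^bsub>Q\<^esub> cl (transv p m) \<otimes>\<^bsub>Q\<^esub> (cl (transv p q) \<otimes>\<^bsub>Q\<^esub> cl (transv p m)) \<otimes>\<^bsub>Q\<^esub> inv\<^bsub>Q\<^esub> cl (transv p m)"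
        by metis
      then show ?thesis using c by (simp add: h.H.m_assoc)
    qed
    ultimately show ?thesis by simp
  qed
qed

text \<open>The triple product sends l to p^-1, but p to p l p^-1 instead of l. Composition with the
  partial conjugation l -> p^-1 l p, which is trivial modulo \<open>T\<close>, corrects this to a
  signed permutation.\<close>

lemma weyl:
  assumes m: "m < n" and l: "snd l \<le> m" "snd p \<le> m" "snd l \<noteq> snd p"
  shows "cl (transv l (inv_letter p)) \<otimes>\<^bsub>Q\<^esub> cl (transv p l) \<otimes>\<^bsub>Q\<^esub> cl (transv l (inv_letter p)) \<in> cl ` low_monomials (Suc m)"
proof -
  have n: "snd l < n" "snd p < n" using m l by simp_all
  have f: "[p] \<in> Fix (snd l)" "inv\<^bsub>F\<^esub> [p] \<in> Fix (snd l)" using l n by (simp_all del: letter_inverse)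
  let ?x = "transv l (inv_letter p)" and ?y = "transv p l"
  let ?\<kappa> = "sub (snd l) (inv\<^bsub>F\<^esub> [p]) [p]"
  let ?w = "?\<kappa> \<otimes>\<^bsub>A\<^esub> (?x \<otimes>\<^bsub>A\<^esub> ?y \<otimes>\<^bsub>A\<^esub> ?x)"
  have aut: "?x \<in> auto F" "?y \<in> auto F" "?\<kappa> \<in> auto F" using l n f by simp_all
  have xyx: "?x \<otimes>\<^bsub>A\<^esub> ?y \<otimes>\<^bsub>A\<^esub> ?x \<in> auto F" by (rule A_closed(1)[OF A_closed(1)[OF aut(1,2)] aut(1)])
  have wa: "?w \<in> auto F" by (rule A_closed(1)[OF aut(3) xyx])
  have ap: "?w z = ?\<kappa> (?x (?y (?x z)))" if "z \<in> carrier F" for z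
    using A_apply[OF aut(3) xyx that] A_apply[OF A_closed(1)[OF aut(1,2)] aut(1) that]
      A_apply[OF aut(1,2) auto_apply_closed[OF aut(1) that]] by simp
  have x: "?x [l] = [l] \<otimes>\<^bsub>F\<^esub> inv\<^bsub>F\<^esub> [p]" "?x [p] = [p]" and y: "?y [p] = [p] \<otimes>\<^bsub>F\<^esub> [l]" "?y [l] = [l]"
    using l n transv_letter[of l "inv_letter p"] by simp_all
  have c: "[l] \<in> carrier F" "[p] \<in> carrier F" using n by simp_all
  have \<kappa>: "?\<kappa> [p] = [p]" "?\<kappa> [l] = inv\<^bsub>F\<^esub> [p] \<otimes>\<^bsub>F\<^esub> [l] \<otimes>\<^bsub>F\<^esub> [p]"
  proof -
    show "?\<kappa> [p] = [p]" using f n l by simp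
    have g: "?\<kappa> (gen (snd l)) = inv\<^bsub>F\<^esub> [p] \<otimes>\<^bsub>F\<^esub> gen (snd l) \<otimes>\<^bsub>F\<^esub> [p]" using f n by simp
    consider "l = (True, snd l)" | "l = inv_letter (True, snd l)" using snd_letter_eq[of l "(True, snd l)"] by auto
    then show "?\<kappa> [l] = inv\<^bsub>F\<^esub> [p] \<otimes>\<^bsub>F\<^esub> [l] \<otimes>\<^bsub>F\<^esub> [p]"
    proof cases
      case 1
      then show ?thesis using g by metis
    next
      case 2
      then have "[l] = inv\<^bsub>F\<^esub> gen (snd l)" using letter_inverse[of "(True, snd l)"] n by simp
      then show ?thesis using g auto_inv[OF aut(3), of "gen (snd l)"] n c by (simp add: F.inv_mult_group F.m_assoc)
    qed
  qed
  have "?y (?x [l]) = inv\<^bsub>F\<^esub> [p]"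
    unfolding x using c y by (simp add: auto_mult[OF aut(2)] auto_inv[OF aut(2)] F.inv_mult_group)
  then have wl: "?w [l] = inv\<^bsub>F\<^esub> [p]"
    unfolding ap[OF c(1)] using c x \<kappa> by (simp add: auto_inv[OF aut(1)] auto_inv[OF aut(3)])
  have "?x (?y (?x [p])) = [p] \<otimes>\<^bsub>F\<^esub> [l] \<otimes>\<^bsub>F\<^esub> inv\<^bsub>F\<^esub> [p]"
    unfolding x y using c x by (simp add: auto_mult[OF aut(1)] F.m_assoc)
  then have wk: "?w [p] = [l]"
    unfolding ap[OF c(2)] using c \<kappa> by (simp add: auto_mult[OF aut(3)] auto_inv[OF aut(3)] F.m_assoc)
  have wo: "?w [z] = [z]" if z: "snd z < n" "snd z \<noteq> snd l" "snd z \<noteq> snd p" for z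
    unfolding ap[OF iffD2[OF letter_carrier, of z "{..<n}"]] using z l n f
    by (subst ap) simp_all
  have "\<exists>q. snd q < n \<and> ?w [z] = [q]" if z: "snd z < n" for z
  proof -
    consider "z = l" | "z = inv_letter l" | "z = p" | "z = inv_letter p" | "snd z \<noteq> snd l" "snd z \<noteq> snd p"
      using snd_letter_eq by metis
    then show ?thesis
    proof cases
      case 1
      then show ?thesis using wl n by (intro exI[of _ "inv_letter p"]) simp
    next
      case 2
      then show ?thesis using wl n c auto_inv[OF wa c(1)] by (intro exI[of _ p]) simp
    next
      case 3
      then show ?thesis using wk n by (intro exI[of _ l]) simp
    next
      case 4
      then show ?thesis using wk n c auto_inv[OF wa c(2)] by (intro exI[of _ "inv_letter l"]) simp
    next
      case 5
      then show ?thesis using wo z by (intro exI[of _ z]) simp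
    qed
  qed
  then have "?w \<in> monomials" unfolding monomials_def using wa by blast
  moreover have "?w (gen i) = gen i" if "Suc m \<le> i" "i < n" for i using wo[of "(True, i)"] l that by simp
  ultimately have w: "?w \<in> low_monomials (Suc m)" unfolding low_monomials_def by blast
  have "?\<kappa> = inv\<^bsub>A\<^esub> sub (snd l) [p] (inv\<^bsub>F\<^esub> [p])"
    using sub_inv[OF n(1) f] c by simp
  then have "?\<kappa> \<in> T"
    using subgroup.m_inv_closed[OF T_subgroup kappa_letter_T[OF n]] l by simp
  then have "cl ?\<kappa> = \<one>\<^bsub>Q\<^esub>" using A.coset_one_iff[OF T_normal, of ?\<kappa>] aut by simp
  then have "cl ?w = cl ?x \<otimes>\<^bsub>Q\<^esub> cl ?y \<otimes>\<^bsub>Q\<^esub> cl ?x"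
    using h.hom_mult[of ?\<kappa> "?x \<otimes>\<^bsub>A\<^esub> ?y \<otimes>\<^bsub>A\<^esub> ?x"] h.hom_mult[of "?x \<otimes>\<^bsub>A\<^esub> ?y" ?x] h.hom_mult[of ?x ?y]
      aut xyx h.hom_closed[of ?x] h.hom_closed[of ?y] by simp
  then show ?thesis using w by (metis image_eqI)
qed

text \<open>The descent needs the action and the rows as functions of classes modulo
  \<open>T\<close>. For \<open>row\<close> the choice is immaterial because elements of I preserve
  exponent sums; for signed permutations one fixed choice is enough.\<close>

definition rep :: "(nat word \<Rightarrow> nat word) set \<Rightarrow> (nat word \<Rightarrow> nat word) set \<Rightarrow> nat word \<Rightarrow> nat word" where
  "rep S C = (SOME \<phi>. \<phi> \<in> S \<and> cl \<phi> = C)"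

lemma rep:
  assumes "C \<in> cl ` S"
  shows "rep S C \<in> S" "cl (rep S C) = C"
proof -
  have "\<exists>\<phi>. \<phi> \<in> S \<and> cl \<phi> = C" using assms by blast
  from someI_ex[OF this] show "rep S C \<in> S" "cl (rep S C) = C" unfolding rep_def by auto
qed

definition row :: "nat \<Rightarrow> (nat word \<Rightarrow> nat word) set \<Rightarrow> bool \<times> nat \<Rightarrow> int" where
  "row m C l = (if snd l < n then exponent_sum m (rep (auto F) C [l]) else 0)"

lemma carrier_Q: "carrier Q = cl ` auto F"
  by (auto simp: FactGroup_def RCOSETS_def)

lemma row_cl:
  assumes \<phi>: "\<phi> \<in> auto F" and l: "snd l < n"
  shows "row m (cl \<phi>) l = exponent_sum m (\<phi> [l])"
proof -
  let ?r = "rep (auto F) (cl \<phi>)"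
  have r: "?r \<in> auto F" "cl ?r = cl \<phi>" using rep[of "cl \<phi>" "auto F"] \<phi> by auto
  have "?r \<otimes>\<^bsub>A\<^esub> inv\<^bsub>A\<^esub> \<phi> \<in> T" using r A.coset_eq_iff[OF T_normal, of ?r \<phi>] \<phi> by simp
  then have t: "?r \<otimes>\<^bsub>A\<^esub> inv\<^bsub>A\<^esub> \<phi> \<in> J (Suc 0)" using T_subset by blast
  have x: "[l] \<in> carrier F" "\<phi> [l] \<in> carrier F" using l auto_apply_closed[OF \<phi>] by auto
  have "(?r \<otimes>\<^bsub>A\<^esub> inv\<^bsub>A\<^esub> \<phi>) (\<phi> [l]) = ?r [l]"
    using A_apply[OF r(1) A_closed(2)[OF \<phi>] x(2)] A_inv_apply(1)[OF \<phi> x(1)] by simp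
  then have "exponent_sum m (?r [l]) = exponent_sum m (\<phi> [l])" using exponent_sum_J[OF t x(2), of m] by simp
  then show ?thesis using l by (simp add: row_def)
qed

text \<open>The descent is set up for the first m + 1 generators, with the last of them as
  distinguished coordinate and the classes of \<open>parab m\<close> as the expected
  stabilizer.\<close>

lemma steinberg_quotient:
  assumes m: "m < n"
  shows "steinberg_group Q {..m} m (\<lambda>l k. cl (transv l k)) (cl ` low_monomials (Suc m)) (cl ` parab m)
    (\<lambda>C. act (rep (low_monomials (Suc m)) C)) (row m)"
proof (intro steinberg_group.intro steinberg_group_axioms.intro h.H.group_axioms)
  let ?W = "low_monomials (Suc m)"
  note Wsub = low_monomials_subgroup[of "Suc m"]
  have Wa: "w \<in> auto F" if "w \<in> ?W" for w using low_monomials_monomials[OF that] by simp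
  have rW: "rep ?W C \<in> ?W" "cl (rep ?W C) = C" "rep ?W C \<in> monomials" "rep ?W C \<in> auto F" if "C \<in> cl ` ?W" for C
    using rep[OF that] low_monomials_monomials Wa by auto
  have lt: "i < n" if "i \<in> {..m}" for i using that m by simp
  have tr: "transv l k \<in> auto F" if "snd l \<in> {..m}" "snd k \<in> {..m}" "snd l \<noteq> snd k" for l k
    using that lt[OF that(1)] lt[OF that(2)] by simp
  show "finite {..m}" by simp
  show "m \<in> {..m}" by simp
  show "cl (transv l k) \<in> carrier Q" if "snd l \<in> {..m}" "snd k \<in> {..m}" "snd l \<noteq> snd k" for l k
    using h.hom_closed[of "transv l k"] tr[OF that] by simp
  show "cl (transv l (inv_letter k)) = inv\<^bsub>Q\<^esub> cl (transv l k)" if "snd l \<in> {..m}" "snd k \<in> {..m}" "snd l \<noteq> snd k" for l k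
    using cl_transv_inv_right[OF lt[OF that(1)] lt[OF that(2)] that(3)] .
  show "cl (transv (inv_letter l) k) = inv\<^bsub>Q\<^esub> cl (transv l k)" if "snd l \<in> {..m}" "snd k \<in> {..m}" "snd l \<noteq> snd k" for l k
    using cl_transv_inv_left[OF lt[OF that(1)] lt[OF that(2)] that(3)] .
  show "cl (transv l k) \<otimes>\<^bsub>Q\<^esub> cl (transv k' q) = cl (transv k' q) \<otimes>\<^bsub>Q\<^esub> cl (transv l k)"
    if "snd l \<in> {..m}" "snd k \<in> {..m}" "snd k' \<in> {..m}" "snd q \<in> {..m}"
      "snd l \<noteq> snd k" "snd k' \<noteq> snd q" "snd l \<noteq> snd q" "snd k \<noteq> snd k'" for l k k' q
    using cl_transv_commute[OF lt lt lt lt that(5-8)] that(1-4) by simp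
  show "cl (transv m' k) \<otimes>\<^bsub>Q\<^esub> cl (transv l m') = cl (transv l m') \<otimes>\<^bsub>Q\<^esub> cl (transv m' k) \<otimes>\<^bsub>Q\<^esub> cl (transv l k)"
    if "snd l \<in> {..m}" "snd m' \<in> {..m}" "snd k \<in> {..m}" "snd l \<noteq> snd m'" "snd k \<noteq> snd m'" "snd l \<noteq> snd k" for l m' k
  proof -
    have t: "transv m' k \<in> carrier A" "transv l m' \<in> carrier A" "transv l k \<in> carrier A"
      using tr that by simp_all
    have "transv m' k \<otimes>\<^bsub>A\<^esub> transv l m' = transv l m' \<otimes>\<^bsub>A\<^esub> transv m' k \<otimes>\<^bsub>A\<^esub> transv l k"
      using that lt by (intro transv_triple) auto
    then have "cl (transv m' k \<otimes>\<^bsub>A\<^esub> transv l m') = cl (transv l m' \<otimes>\<^bsub>A\<^esub> transv m' k \<otimes>\<^bsub>A\<^esub> transv l k)" by simp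
    then show ?thesis using t by (simp only: h.hom_mult A.m_closed)
  qed
  show "w \<in> carrier Q" if "w \<in> cl ` ?W" for w using that Wa unfolding carrier_Q by blast
  show "w \<otimes>\<^bsub>Q\<^esub> w' \<in> cl ` ?W" if "w \<in> cl ` ?W" "w' \<in> cl ` ?W" for w w'
    using subgroup.m_closed[OF h.subgroup_img_is_subgroup[OF Wsub] that] .
  show "\<one>\<^bsub>Q\<^esub> \<in> cl ` ?W" by (rule subgroup.one_closed[OF h.subgroup_img_is_subgroup[OF Wsub]])
  have act_low: "snd (act w l) \<le> m" if w: "w \<in> ?W" and l: "snd l \<le> m" for w l
  proof -
    have "w [l] \<in> carrier (free_group {..<Suc m})" using l m w by (intro low_monomials_low) auto
    then show ?thesis using act(1)[OF low_monomials_monomials[OF w], of l] l m by simp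
  qed
  show "snd (act (rep ?W w) l) \<in> {..m}" if "w \<in> cl ` ?W" "snd l \<in> {..m}" for w l
    using act_low[OF rW(1)[OF that(1)]] that by simp
  show "\<exists>k. snd k \<in> {..m} \<and> act (rep ?W w) k = l" if "w \<in> cl ` ?W" "snd l \<in> {..m}" for w l
  proof -
    let ?w = "rep ?W w"
    have w: "?w \<in> ?W" "?w \<in> monomials" using rW that by auto
    have iw: "inv\<^bsub>A\<^esub> ?w \<in> ?W" by (rule subgroup.m_inv_closed[OF Wsub w(1)])
    have ln: "snd l < n" using that m by simp
    let ?k = "act (inv\<^bsub>A\<^esub> ?w) l"
    have k: "snd ?k \<le> m" using act_low[OF iw] that by simp
    have "[act ?w ?k] = ?w [?k]" using act(1)[OF w(2), of ?k] k m by simp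
    also have "\<dots> = ?w ((inv\<^bsub>A\<^esub> ?w) [l])" using act(1)[OF low_monomials_monomials[OF iw] ln] by simp
    also have "\<dots> = [l]" using A_inv_apply(2)[of ?w "[l]"] ln w by simp
    finally show ?thesis using k by (intro exI[of _ ?k]) simp
  qed
  show "snd (act (rep ?W w) l) = snd (act (rep ?W w) k) \<longleftrightarrow> snd l = snd k"
    if "w \<in> cl ` ?W" "snd l \<in> {..m}" "snd k \<in> {..m}" for w l k
    using act_snd[OF rW(3)[OF that(1)] lt[OF that(2)] lt[OF that(3)]] .
  show "cl (transv (act (rep ?W w) l) (act (rep ?W w) k)) \<otimes>\<^bsub>Q\<^esub> w = w \<otimes>\<^bsub>Q\<^esub> cl (transv l k)"
    if "w \<in> cl ` ?W" "snd l \<in> {..m}" "snd k \<in> {..m}" "snd l \<noteq> snd k" for w l k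
  proof -
    let ?w = "rep ?W w"
    have w: "?w \<in> monomials" "?w \<in> carrier A" using rW(3,4)[OF that(1)] by simp_all
    have n: "snd l < n" "snd k < n" using that m by simp_all
    have "snd (act ?w l) \<noteq> snd (act ?w k)" using act_snd[OF w(1) n] that by simp
    then have t: "transv (act ?w l) (act ?w k) \<in> carrier A" "transv l k \<in> carrier A"
      using act(2)[OF w(1)] n that by simp_all
    have "cl (transv (act ?w l) (act ?w k) \<otimes>\<^bsub>A\<^esub> ?w) = cl (?w \<otimes>\<^bsub>A\<^esub> transv l k)"
      using transv_monomial[OF w(1) n that(4)] by simp
    then show ?thesis using t w(2) rW(2)[OF that(1)] by (simp only: h.hom_mult)
  qed
  show "cl (transv l (inv_letter k)) \<otimes>\<^bsub>Q\<^esub> cl (transv k l) \<otimes>\<^bsub>Q\<^esub> cl (transv l (inv_letter k)) \<in> cl ` ?W"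
    if "snd l \<in> {..m}" "snd k \<in> {..m}" "snd l \<noteq> snd k" for l k
    using weyl[OF m, of l k] that by simp
  show "row m g (inv_letter l) = - row m g l" if g: "g \<in> carrier Q" for g l
  proof (cases "snd l < n")
    case True
    obtain \<phi> where \<phi>: "\<phi> \<in> auto F" "g = cl \<phi>" using g carrier_Q by blast
    have x: "[l] \<in> carrier F" using True by simp
    have "row m g (inv_letter l) = exponent_sum m (\<phi> [inv_letter l])" using row_cl[OF \<phi>(1), of "inv_letter l" m] True \<phi> by simp
    also have "\<dots> = - exponent_sum m (\<phi> [l])"
      using exponent_sum_inv[OF auto_apply_closed[OF \<phi>(1) x]] auto_inv[OF \<phi>(1) x] True by simp
    finally show ?thesis using row_cl[OF \<phi>(1) True] \<phi> by simp
  next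
    case False
    then show ?thesis by (simp add: row_def)
  qed
  show "row m (g \<otimes>\<^bsub>Q\<^esub> cl (transv l k)) l = row m g l + row m g k"
    if g: "g \<in> carrier Q" and lk: "snd l \<in> {..m}" "snd k \<in> {..m}" "snd l \<noteq> snd k" for g l k
  proof -
    obtain \<phi> where \<phi>: "\<phi> \<in> auto F" "g = cl \<phi>" using g carrier_Q by blast
    have n: "snd l < n" "snd k < n" using lk m by simp_all
    have t: "transv l k \<in> auto F" by (rule tr[OF lk])
    have "g \<otimes>\<^bsub>Q\<^esub> cl (transv l k) = cl (\<phi> \<otimes>\<^bsub>A\<^esub> transv l k)" using \<phi> t by simp
    moreover have "(\<phi> \<otimes>\<^bsub>A\<^esub> transv l k) [l] = \<phi> [l] \<otimes>\<^bsub>F\<^esub> \<phi> [k]"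
      using A_apply[OF \<phi>(1) t, of "[l]"] n lk auto_mult[OF \<phi>(1), of "[l]" "[k]"] by simp
    ultimately show ?thesis
      using row_cl[OF A_closed(1)[OF \<phi>(1) t] n(1)] row_cl[OF \<phi>(1) n(1)] row_cl[OF \<phi>(1) n(2)] \<phi>(2) exponent_sum_mult by simp
  qed
  show "row m (g \<otimes>\<^bsub>Q\<^esub> cl (transv l k)) q = row m g q"
    if g: "g \<in> carrier Q" and lk: "snd l \<in> {..m}" "snd k \<in> {..m}" "snd l \<noteq> snd k" "snd q \<in> {..m}" "snd q \<noteq> snd l" for g l k q
  proof -
    obtain \<phi> where \<phi>: "\<phi> \<in> auto F" "g = cl \<phi>" using g carrier_Q by blast
    have n: "snd l < n" "snd k < n" "snd q < n" using lk m by simp_all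
    have t: "transv l k \<in> auto F" by (rule tr[OF lk(1-3)])
    have "g \<otimes>\<^bsub>Q\<^esub> cl (transv l k) = cl (\<phi> \<otimes>\<^bsub>A\<^esub> transv l k)" using \<phi> t by simp
    moreover have "(\<phi> \<otimes>\<^bsub>A\<^esub> transv l k) [q] = \<phi> [q]"
      using A_apply[OF \<phi>(1) t, of "[q]"] n lk by simp
    ultimately show ?thesis
      using row_cl[OF A_closed(1)[OF \<phi>(1) t] n(3)] row_cl[OF \<phi>(1) n(3)] \<phi>(2) by simp
  qed
  show "row m (g \<otimes>\<^bsub>Q\<^esub> w) l = row m g (act (rep ?W w) l)"
    if g: "g \<in> carrier Q" and w: "w \<in> cl ` ?W" and l: "snd l \<in> {..m}" for g w l
  proof -
    let ?w = "rep ?W w"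
    obtain \<phi> where \<phi>: "\<phi> \<in> auto F" "g = cl \<phi>" using g carrier_Q by blast
    have wm: "?w \<in> monomials" "?w \<in> auto F" "cl ?w = w" using rW[OF w] by simp_all
    have n: "snd l < n" using l m by simp
    have "g \<otimes>\<^bsub>Q\<^esub> w = cl (\<phi> \<otimes>\<^bsub>A\<^esub> ?w)" using h.hom_mult[of \<phi> ?w] \<phi> wm by simp
    moreover have "(\<phi> \<otimes>\<^bsub>A\<^esub> ?w) [l] = \<phi> [act ?w l]"
      using A_apply[OF \<phi>(1) wm(2), of "[l]"] n act(1)[OF wm(1) n] by simp
    ultimately show ?thesis
      using row_cl[OF A_closed(1)[OF \<phi>(1) wm(2)] n] row_cl[OF \<phi>(1) act(2)[OF wm(1) n]] \<phi>(2) by simp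
  qed
  show "subgroup (cl ` parab m) Q"
    by (rule h.subgroup_img_is_subgroup[OF parab_subgroup[OF m]])
  have V_Fix: "carrier (free_group {..<m}) \<subseteq> Fix m" using m by (intro free_group_carrier_mono) auto
  show "row m p l = (if snd l = m then if fst l then 1 else - 1 else 0)" if p: "p \<in> cl ` parab m" and l: "snd l \<in> {..m}" for p l
  proof -
    obtain u c where uc: "u \<in> carrier (free_group {..<m})" "c \<in> low m" "p = cl (sub m \<one>\<^bsub>F\<^esub> u \<otimes>\<^bsub>A\<^esub> c)"
      using p unfolding parab_def by blast
    have c: "c \<in> stab m" using low_stab[of m] uc m by auto
    have ca: "c \<in> auto F" "c (gen m) = gen m" using c m unfolding stab_def by auto
    have u: "u \<in> Fix m" using uc V_Fix by blast
    have s: "sub m \<one>\<^bsub>F\<^esub> u \<in> auto F" using m u by simp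
    have n: "snd l < n" using l m by simp
    have row: "row m p l = exponent_sum m (sub m \<one>\<^bsub>F\<^esub> u (c [l]))"
      using row_cl[OF A_closed(1)[OF s ca(1)] n, of m] A_apply[OF s ca(1), of "[l]"] n uc(3) by simp
    show ?thesis
    proof (cases "snd l = m")
      case True
      have e: "exponent_sum m (sub m \<one>\<^bsub>F\<^esub> u (c (gen m))) = 1"
        using ca u m exponent_sum_zero[OF uc(1), of m] by (simp add: exponent_sum_mult exponent_sum_letter)
      consider "l = (True, m)" | "l = inv_letter (True, m)" using snd_letter_eq[of l "(True, m)"] True by auto
      then show ?thesis
      proof cases
        case 1
        then show ?thesis using row e by simp
      next
        case 2
        have x: "gen m \<in> carrier F" using m by simp
        have "[l] = inv\<^bsub>F\<^esub> gen m" using 2 letter_inverse[of "(True, m)"] m by simp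
        then have "sub m \<one>\<^bsub>F\<^esub> u (c [l]) = inv\<^bsub>F\<^esub> (sub m \<one>\<^bsub>F\<^esub> u (c (gen m)))"
          using auto_inv[OF ca(1) x] auto_inv[OF s auto_apply_closed[OF ca(1) x]] by simp
        then have "row m p l = - 1"
          using row e exponent_sum_inv[OF auto_apply_closed[OF s auto_apply_closed[OF ca(1) x]]] by simp
        then show ?thesis using 2 by (simp add: inv_letter_def)
      qed
    next
      case False
      then have "[l] \<in> carrier (free_group {..<m})" using l by simp
      then have cl': "c [l] \<in> carrier (free_group {..<m})" using c unfolding stab_def by blast
      then have "sub m \<one>\<^bsub>F\<^esub> u (c [l]) = c [l]" using V_Fix m u by auto
      then show ?thesis using row exponent_sum_zero[OF cl', of m] False by simp
    qed
  qed
  have subP: "cl (sub m \<one>\<^bsub>F\<^esub> u) \<in> cl ` parab m" if u: "u \<in> carrier (free_group {..<m})" for u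
  proof -
    have "u \<in> Fix m" using u V_Fix by blast
    then have "sub m \<one>\<^bsub>F\<^esub> u = sub m \<one>\<^bsub>F\<^esub> u \<otimes>\<^bsub>A\<^esub> \<one>\<^bsub>A\<^esub>" using m A.r_one[of "sub m \<one>\<^bsub>F\<^esub> u"] by simp
    then have "sub m \<one>\<^bsub>F\<^esub> u \<in> parab m"
      unfolding parab_def using u subgroup.one_closed[OF low_subgroup[of m]] m by auto
    then show ?thesis by blast
  qed
  have lowP: "cl c \<in> cl ` parab m" if c: "c \<in> low m" for c
  proof -
    have ca: "c \<in> auto F" using low_stab[of m] c m unfolding stab_def by auto
    have "c = sub m \<one>\<^bsub>F\<^esub> \<one>\<^bsub>F\<^esub> \<otimes>\<^bsub>A\<^esub> c" using sub_one[OF m] A.l_one[of c] ca by simp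
    moreover have "\<one>\<^bsub>F\<^esub> \<in> carrier (free_group {..<m})"
      using subgroup.one_closed[OF subgroup_free_group[of "{..<m}" "{..<n}"]] m by auto
    ultimately have "c \<in> parab m" unfolding parab_def using c by blast
    then show ?thesis by blast
  qed
  show "cl (transv l k) \<in> cl ` parab m"
    if lk: "snd l \<in> {..m}" "snd k \<in> {..m}" "snd l \<noteq> snd k" "snd k \<noteq> m" for l k
  proof (cases "snd l = m")
    case False
    then have "snd l < m" "snd k < m" using lk by simp_all
    then have "transv l k \<in> low_gens m" unfolding low_gens_def using lk(3) by blast
    then have "transv l k \<in> low m" unfolding low_def by (rule generate.incl)
    then show ?thesis by (rule lowP)
  next
    case True
    have kV: "[k] \<in> carrier (free_group {..<m})" using lk by simp
    have t: "transv (True, m) k = sub m \<one>\<^bsub>F\<^esub> [k]" by (simp add: transv_def)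
    consider "l = (True, m)" | "l = inv_letter (True, m)" using snd_letter_eq[of l "(True, m)"] True by auto
    then show ?thesis
    proof cases
      case 1
      then show ?thesis using subP[OF kV] t by simp
    next
      case 2
      have "cl (transv l k) = inv\<^bsub>Q\<^esub> cl (transv (True, m) k)"
        using 2 cl_transv_inv_left[of "(True, m)" k] lk m by simp
      then show ?thesis
        using subgroup.m_inv_closed[OF h.subgroup_img_is_subgroup[OF parab_subgroup[OF m]] subP[OF kV]] t by simp
    qed
  qed
  show "w \<in> cl ` parab m" if w: "w \<in> cl ` ?W" and fix_m: "act (rep ?W w) (True, m) = (True, m)" for w
  proof -
    obtain w0 where w0: "w0 \<in> ?W" "w0 \<in> monomials" "cl w0 = w" "act w0 (True, m) = (True, m)"
      using rW[OF w] fix_m by blast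
    have "w0 (gen m) = gen m" using act(1)[OF w0(2), of "(True, m)"] w0(4) m by simp
    then have "w0 (gen i) = gen i" if "m \<le> i" "i < n" for i
      using w0(1) that unfolding low_monomials_def by (cases "i = m") auto
    then have "w0 \<in> low_monomials m" unfolding low_monomials_def using w0(2) by blast
    then have "w0 \<in> low m" unfolding low_def low_gens_def by (intro generate.incl UnI2)
    then show ?thesis using lowP[of w0] w0(3) by simp
  qed
qed

text \<open>An element of I has the identity matrix, so the descent gives \<phi> = t s c with t in
  \<open>T\<close>, s the substitution x_m -> x_m u and c in \<open>low m\<close>. Then s c is in I.
  As c fixes x_m, evaluation at x_m puts u into the commutator subgroup, so s is in \<open>T\<close>
  and c is in I, which allows the induction on m.\<close>

lemma low_torelli: "m \<le> n \<Longrightarrow> \<phi> \<in> low m \<Longrightarrow> \<phi> \<in> J (Suc 0) \<Longrightarrow> \<phi> \<in> T"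
proof (induction m arbitrary: \<phi>)
  case 0
  then show ?case using low_0 subgroup.one_closed[OF T_subgroup] by simp
next
  case (Suc m)
  have m: "m < n" using Suc.prems by simp
  interpret S: steinberg_group Q "{..m}" m "\<lambda>l k. cl (transv l k)" "cl ` low_monomials (Suc m)" "cl ` parab m"
    "\<lambda>C. act (rep (low_monomials (Suc m)) C)" "row m"
    by (rule steinberg_quotient[OF m])
  have \<phi>: "\<phi> \<in> auto F" using Suc.prems by simp
  have gens: "low_gens (Suc m) \<subseteq> carrier A" using low_gens_auto Suc.prems by simp
  have "cl \<phi> \<in> cl ` generate A (low_gens (Suc m))" using Suc.prems unfolding low_def by blast
  also have "\<dots> = generate Q (cl ` low_gens (Suc m))" by (rule h.generate_img[OF gens, symmetric])
  also have "cl ` low_gens (Suc m) = {cl (transv l k) |l k. snd l \<in> {..m} \<and> snd k \<in> {..m} \<and> snd l \<noteq> snd k} \<union> cl ` low_monomials (Suc m)"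
    unfolding low_gens_def image_Un less_Suc_eq_le atMost_iff by blast
  finally have g: "cl \<phi> \<in> generate Q ({cl (transv l k) |l k. snd l \<in> {..m} \<and> snd k \<in> {..m} \<and> snd l \<noteq> snd k} \<union> cl ` low_monomials (Suc m))" .
  have row: "row m (cl \<phi>) l = exponent_sum m [l]" if "snd l < n" for l
    using row_cl[OF \<phi> that] exponent_sum_J[OF Suc.prems(3), of "[l]" m] that by simp
  have "cl \<phi> \<in> cl ` parab m"
  proof (rule S.stabilizer_subset[OF g])
    show "inv\<^bsub>Q\<^esub> w \<in> cl ` low_monomials (Suc m)" if "w \<in> cl ` low_monomials (Suc m)" for w
      by (rule subgroup.m_inv_closed[OF h.subgroup_img_is_subgroup[OF low_monomials_subgroup] that])
    show "row m (cl \<phi>) (True, m) = 1" using row[of "(True, m)"] m by (simp add: exponent_sum_letter)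
    show "row m (cl \<phi>) l = 0" if "snd l \<in> {..m}" "snd l \<noteq> m" for l
      using row[of l] that m by (simp add: exponent_sum_letter)
  qed
  then obtain u c where uc: "u \<in> carrier (free_group {..<m})" "c \<in> low m" "cl \<phi> = cl (sub m \<one>\<^bsub>F\<^esub> u \<otimes>\<^bsub>A\<^esub> c)"
    unfolding parab_def by blast
  let ?s = "sub m \<one>\<^bsub>F\<^esub> u"
  have "carrier (free_group {..<m}) \<subseteq> Fix m" using m by (intro free_group_carrier_mono) auto
  then have u: "u \<in> Fix m" using uc by blast
  have s: "?s \<in> auto F" using m u by simp
  have c: "c \<in> auto F" "c (gen m) = gen m" using low_stab[of m] uc m unfolding stab_def by auto
  have sc: "?s \<otimes>\<^bsub>A\<^esub> c \<in> auto F" by (rule A_closed(1)[OF s c(1)])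
  have t: "\<phi> \<otimes>\<^bsub>A\<^esub> inv\<^bsub>A\<^esub> (?s \<otimes>\<^bsub>A\<^esub> c) \<in> T" using A.coset_eq_iff[OF T_normal, of \<phi> "?s \<otimes>\<^bsub>A\<^esub> c"] \<phi> sc uc(3) by simp
  have "?s \<otimes>\<^bsub>A\<^esub> c = inv\<^bsub>A\<^esub> (\<phi> \<otimes>\<^bsub>A\<^esub> inv\<^bsub>A\<^esub> (?s \<otimes>\<^bsub>A\<^esub> c)) \<otimes>\<^bsub>A\<^esub> \<phi>"
    using \<phi> sc by (simp add: A.inv_mult_group A.m_assoc del: carrier_A add: carrier_A[symmetric])
  then have scJ: "?s \<otimes>\<^bsub>A\<^esub> c \<in> J (Suc 0)"
    using subgroup.m_closed[OF johnson_subgroup subgroup.m_inv_closed[OF johnson_subgroup subsetD[OF T_subset t]] Suc.prems(3)] by simp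
  have x: "gen m \<in> carrier F" using m by simp
  have "(?s \<otimes>\<^bsub>A\<^esub> c) (gen m) \<otimes>\<^bsub>F\<^esub> inv\<^bsub>F\<^esub> gen m \<in> L 1" using johnsonD[OF scJ x] by simp
  then have "gen m \<otimes>\<^bsub>F\<^esub> u \<otimes>\<^bsub>F\<^esub> inv\<^bsub>F\<^esub> gen m \<in> L 1" using A_apply[OF s c(1) x] c(2) m u by simp
  then have "inv\<^bsub>F\<^esub> gen m \<otimes>\<^bsub>F\<^esub> (gen m \<otimes>\<^bsub>F\<^esub> u \<otimes>\<^bsub>F\<^esub> inv\<^bsub>F\<^esub> gen m) \<otimes>\<^bsub>F\<^esub> gen m \<in> L 1"
    using normal.inv_op_closed1[OF F.lower_central_normal x] by blast
  then have uL: "u \<in> L 1" using x u by (simp add: F.m_assoc)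
  have sT: "?s \<in> T"
    using m u uL subgroup.one_closed[OF F.lower_central_subgroup] by (intro sub_commutator_in_T) auto
  have "c = inv\<^bsub>A\<^esub> ?s \<otimes>\<^bsub>A\<^esub> (?s \<otimes>\<^bsub>A\<^esub> c)" using s c(1) by simp
  then have "c \<in> J (Suc 0)"
    using subgroup.m_closed[OF johnson_subgroup subgroup.m_inv_closed[OF johnson_subgroup subsetD[OF T_subset sT]] scJ] by simp
  then have cT: "c \<in> T" using Suc.IH uc(2) m by simp
  have "\<phi> = (\<phi> \<otimes>\<^bsub>A\<^esub> inv\<^bsub>A\<^esub> (?s \<otimes>\<^bsub>A\<^esub> c)) \<otimes>\<^bsub>A\<^esub> (?s \<otimes>\<^bsub>A\<^esub> c)"
    using \<phi> sc by (simp add: A.m_assoc)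
  then show ?case
    using subgroup.m_closed[OF T_subgroup t subgroup.m_closed[OF T_subgroup sT cT]] by simp
qed

section \<open>From torsion of the abelianization to finite index\<close>

lemma torelli_T: "J (Suc 0) = T"
proof (rule antisym[OF subsetI T_subset])
  fix \<phi> assume "\<phi> \<in> J (Suc 0)"
  then show "\<phi> \<in> T" using low_torelli[of n \<phi>] low_n by simp
qed

lemma torelli_torsion_mod_commutators:
  assumes "\<phi> \<in> J (Suc 0)"
  shows "\<exists>m>0::nat. \<phi> [^]\<^bsub>A\<^esub> m \<in> D"
proof -
  have "\<phi> \<in> T" using assms torelli_T by simp
  then show ?thesis unfolding T_def by blast
qed

text \<open>A nilpotent group with torsion abelianization is torsion.\<close>

lemma torelli_torsion_mod_M:
  assumes \<phi>: "\<phi> \<in> J (Suc 0)"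
  shows "\<exists>m>0::nat. \<phi> [^]\<^bsub>A\<^esub> m \<in> M"
proof -
  let ?G = "A\<lparr>carrier := J (Suc 0)\<rparr>"
  interpret G: group ?G by (rule subgroup.subgroup_is_group[OF johnson_subgroup A.is_group])
  interpret q: group_hom A "A Mod M" "\<lambda>\<phi>. M #>\<^bsub>A\<^esub> \<phi>" by (rule A.coset_group_hom[OF M_normal])
  let ?R = "(A Mod M)\<lparr>carrier := (\<lambda>\<phi>. M #>\<^bsub>A\<^esub> \<phi>) ` J (Suc 0)\<rparr>"
  have R: "subgroup ((\<lambda>\<phi>. M #>\<^bsub>A\<^esub> \<phi>) ` J (Suc 0)) (A Mod M)" by (rule q.subgroup_img_is_subgroup[OF johnson_subgroup])
  interpret R: group ?R by (rule subgroup.subgroup_is_group[OF R q.H.is_group])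
  interpret r: group_hom ?G ?R "\<lambda>\<phi>. M #>\<^bsub>A\<^esub> \<phi>"
    by (intro group_hom.intro group_hom_axioms.intro G.is_group R.is_group) (auto simp: hom_def)
  have im: "(\<lambda>\<phi>. M #>\<^bsub>A\<^esub> \<phi>) ` lower_central ?G i = lower_central ?R i" for i
    by (rule r.lower_central_image) simp
  have pJ: "\<phi> [^]\<^bsub>A\<^esub> (m::nat) \<in> J (Suc 0)" if "\<phi> \<in> J (Suc 0)" for \<phi> m
    using that subgroup.m_closed[OF johnson_subgroup] subgroup.one_closed[OF johnson_subgroup] by (induction m) auto
  have pow: "(M #>\<^bsub>A\<^esub> \<phi>) [^]\<^bsub>?R\<^esub> (m::nat) = M #>\<^bsub>A\<^esub> (\<phi> [^]\<^bsub>A\<^esub> m)" if "\<phi> \<in> J (Suc 0)" for \<phi> m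
    using that q.hom_nat_pow[of \<phi> m] by (simp add: q.H.nat_pow_consistent[symmetric])
  have D_L1: "M #>\<^bsub>A\<^esub> d \<in> lower_central ?R 1" if d: "d \<in> D" for d
  proof -
    let ?S = "M \<union> {gcomm A \<phi> \<psi> |\<phi> \<psi>. \<phi> \<in> J (Suc 0) \<and> \<psi> \<in> J (Suc 0)}"
    have SJ: "?S \<subseteq> J (Suc 0)"
      using M_subset subgroup.subset[OF johnson_subgroup] gcomm_johnson[of _ _ "Suc 0"] johnson_antimono[of "Suc 0" "Suc (Suc 0)"] by blast
    have Sc: "?S \<subseteq> carrier ?G" using SJ by simp
    have "D = generate ?G ?S" unfolding D_def using A.generate_consistent[OF SJ johnson_subgroup] by simp
    then have "M #>\<^bsub>A\<^esub> d \<in> generate ?R ((\<lambda>\<phi>. M #>\<^bsub>A\<^esub> \<phi>) ` ?S)"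
      using d r.generate_img[OF Sc] by blast
    also have "\<dots> \<subseteq> lower_central ?R 1"
    proof (rule R.generate_subgroup_incl[OF _ R.lower_central_subgroup], rule image_subsetI)
      fix s assume s: "s \<in> ?S"
      show "M #>\<^bsub>A\<^esub> s \<in> lower_central ?R 1"
      proof (cases "s \<in> M")
        case True
        then have "M #>\<^bsub>A\<^esub> s = \<one>\<^bsub>?R\<^esub>"
          using A.coset_one_iff[OF M_normal, of s] subgroup.mem_carrier[OF M_subgroup] by simp
        then show ?thesis using subgroup.one_closed[OF R.lower_central_subgroup] by metis
      next
        case False
        then obtain \<phi> \<psi> where s: "s = gcomm A \<phi> \<psi>" "\<phi> \<in> J (Suc 0)" "\<psi> \<in> J (Suc 0)" using s by blast
        have "gcomm ?G \<phi> \<psi> \<in> lower_central ?G 1" using G.gcomm_lower_central[of \<phi> \<psi> 0] s by simp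
        then have "gcomm A \<phi> \<psi> \<in> lower_central ?G 1" using gcomm_subgroup_eq[OF johnson_subgroup s(2,3)] by simp
        then show ?thesis using im[of 1] s(1) by blast
      qed
    qed
    finally show ?thesis .
  qed
  have tors: "\<exists>m>0::nat. \<exists>l>0::nat. gcomm ?R (a [^]\<^bsub>?R\<^esub> m) (b [^]\<^bsub>?R\<^esub> l) \<in> lower_central ?R (Suc (Suc i))"
    if ab: "a \<in> carrier ?R" "b \<in> lower_central ?R i" for a b i
  proof -
    obtain \<psi> where \<psi>: "\<psi> \<in> J (Suc 0)" "a = M #>\<^bsub>A\<^esub> \<psi>" using ab(1) by auto
    obtain m :: nat where m: "m > 0" "\<psi> [^]\<^bsub>A\<^esub> m \<in> D" using torelli_torsion_mod_commutators[OF \<psi>(1)] by blast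
    \<comment> \<open>A power of a falls into the commutator subgroup of \<open>?R\<close>, and
      commutators of it with level i fall into level i+2; no power of b is required, so l =
      1.\<close>
    have "a [^]\<^bsub>?R\<^esub> m \<in> lower_central ?R (Suc 0)" using D_L1[OF m(2)] pow[OF \<psi>(1)] \<psi>(2) by simp
    then have "gcomm ?R (a [^]\<^bsub>?R\<^esub> m) b \<in> lower_central ?R (Suc (Suc i))"
      using R.gcomm_commutator_lower_central ab(2) by blast
    moreover have "b [^]\<^bsub>?R\<^esub> (1::nat) = b" by (rule R.nat_pow_eone[OF R.lower_central_closed[OF ab(2)]])
    ultimately have "gcomm ?R (a [^]\<^bsub>?R\<^esub> m) (b [^]\<^bsub>?R\<^esub> (1::nat)) \<in> lower_central ?R (Suc (Suc i))" by simp
    then show ?thesis using m(1) zero_less_one by blast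
  qed
  have deep: "\<exists>m>0::nat. z [^]\<^bsub>?R\<^esub> m \<in> lower_central ?R i" if z: "z \<in> lower_central ?R 1" and i: "i \<ge> 1" for z i
    using i
  proof (induction i rule: dec_induct)
    case base
    have "z [^]\<^bsub>?R\<^esub> (1::nat) = z" by (rule R.nat_pow_eone[OF R.lower_central_closed[OF z]])
    then show ?case using z by (intro exI[of _ 1]) simp
  next
    case (step j)
    then obtain m :: nat where m: "m > 0" "z [^]\<^bsub>?R\<^esub> m \<in> lower_central ?R j" by blast
    obtain j' where j': "j = Suc j'" using step by (cases j) auto
    obtain l :: nat where l: "l > 0" "(z [^]\<^bsub>?R\<^esub> m) [^]\<^bsub>?R\<^esub> l \<in> lower_central ?R (Suc j)"
      using R.lower_central_torsion_step[OF tors m(2)[unfolded j']] unfolding j' by blast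
    then have "z [^]\<^bsub>?R\<^esub> (m * l) \<in> lower_central ?R (Suc j)"
      using R.nat_pow_pow[OF R.lower_central_closed[OF z]] by simp
    then show ?case using m l by (metis nat_0_less_mult_iff)
  qed
  obtain m :: nat where m: "m > 0" "\<phi> [^]\<^bsub>A\<^esub> m \<in> D" using torelli_torsion_mod_commutators[OF \<phi>] by blast
  obtain l :: nat where l: "l > 0" "(M #>\<^bsub>A\<^esub> (\<phi> [^]\<^bsub>A\<^esub> m)) [^]\<^bsub>?R\<^esub> l \<in> lower_central ?R k"
    using deep[OF D_L1[OF m(2)] k1] by blast
  have "M #>\<^bsub>A\<^esub> (\<phi> [^]\<^bsub>A\<^esub> (m * l)) \<in> (\<lambda>\<phi>. M #>\<^bsub>A\<^esub> \<phi>) ` lower_central ?G k"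
    using l(2) pow[OF pJ[OF \<phi>]] A.nat_pow_pow[of \<phi> m l] \<phi> im by simp
  \<comment> \<open>Here nilpotency enters: level k of I lies in \<open>J (Suc k)\<close>, hence in
    \<open>J k\<close>, which is trivial modulo \<open>M\<close>.\<close>
  moreover have "lower_central ?G k \<subseteq> J k"
    using lower_central_torelli[of k] johnson_antimono[of k "Suc k"] by auto
  ultimately obtain \<psi> where \<psi>: "\<psi> \<in> J k" "M #>\<^bsub>A\<^esub> (\<phi> [^]\<^bsub>A\<^esub> (m * l)) = M #>\<^bsub>A\<^esub> \<psi>" by blast
  have "\<psi> \<in> M" "\<psi> \<in> carrier A" using \<psi>(1) J_subset_M by auto
  then have "M #>\<^bsub>A\<^esub> (\<phi> [^]\<^bsub>A\<^esub> (m * l)) = \<one>\<^bsub>A Mod M\<^esub>" using A.coset_one_iff[OF M_normal, of \<psi>] \<psi>(2) by simp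
  moreover have "\<phi> [^]\<^bsub>A\<^esub> (m * l) \<in> carrier A" using A.nat_pow_closed[of \<phi>] \<phi> by simp
  ultimately have "\<phi> [^]\<^bsub>A\<^esub> (m * l) \<in> M" using A.coset_one_iff[OF M_normal] by blast
  moreover have "m * l > 0" using m l by simp
  ultimately show ?thesis by blast
qed

text \<open>In the decomposition of \<phi> as \<mu> z r the product of the first two factors is in
  \<open>M\<close>, so its image under rho is in rho(I_k), and the coset of rho(\<phi>) is that of
  rho(r) with r from a finite set.\<close>

theorem finite_index: "finite (rcosets\<^bsub>(GL_H1 FK)\<lparr>carrier := \<rho> ` torelli F\<rparr>\<^esub> (\<rho> ` J k))"
proof -
  let ?H = "\<rho> ` J k"
  have "finite_over M (J (Suc 0)) (J k)"
    by (rule finite_over_johnson[OF M_subgroup k1 torelli_torsion_mod_M])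
  then obtain R where R: "finite R" "R \<subseteq> auto F"
    "\<forall>h\<in>J (Suc 0). \<exists>\<mu>\<in>M. \<exists>z\<in>J k. \<exists>r\<in>R. h = \<mu> \<otimes>\<^bsub>A\<^esub> z \<otimes>\<^bsub>A\<^esub> r"
    unfolding finite_over_def by (elim exE conjE) (rule that)
  have "?H #>\<^bsub>GL_H1 FK\<^esub> \<rho> \<phi> \<in> (\<lambda>r. ?H #>\<^bsub>GL_H1 FK\<^esub> \<rho> r) ` R" if \<phi>: "\<phi> \<in> J (Suc 0)" for \<phi>
  proof -
    obtain \<mu> z r where d: "\<mu> \<in> M" "z \<in> J k" "r \<in> R" "\<phi> = \<mu> \<otimes>\<^bsub>A\<^esub> z \<otimes>\<^bsub>A\<^esub> r"
      using bspec[OF R(3) \<phi>] by (elim bexE) (rule that)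
    have c: "\<mu> \<in> carrier A" "z \<in> carrier A" "r \<in> carrier A"
      by (rule subgroup.mem_carrier[OF M_subgroup d(1)], rule subgroup.mem_carrier[OF johnson_subgroup d(2)],
        unfold carrier_A, rule subsetD[OF R(2) d(3)])
    have "\<mu> \<otimes>\<^bsub>A\<^esub> z \<in> M" using subgroup.m_closed[OF M_subgroup d(1)] d(2) J_subset_M by blast
    then have H: "\<rho> (\<mu> \<otimes>\<^bsub>A\<^esub> z) \<in> ?H" unfolding M_def by blast
    have "\<rho> \<phi> \<otimes>\<^bsub>GL_H1 FK\<^esub> inv\<^bsub>GL_H1 FK\<^esub> \<rho> r = \<rho> (\<mu> \<otimes>\<^bsub>A\<^esub> z)"
      using c \<rho>.hom_closed[of r] \<rho>.hom_closed[of \<mu>] \<rho>.hom_closed[of z] unfolding d(4) by (simp add: \<rho>.H.m_assoc del: carrier_A)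
    then have "\<rho> \<phi> \<in> ?H #>\<^bsub>GL_H1 FK\<^esub> \<rho> r"
      using subgroup.rcos_module[OF rho_J_subgroup \<rho>.H.is_group] H \<rho>.hom_closed[OF c(3)] \<rho>.hom_closed[of \<phi>] \<phi> by simp
    then have "?H #>\<^bsub>GL_H1 FK\<^esub> \<rho> r = ?H #>\<^bsub>GL_H1 FK\<^esub> \<rho> \<phi>"
      using \<rho>.H.repr_independence[OF _ \<rho>.hom_closed[OF c(3)] rho_J_subgroup] by blast
    then show ?thesis using d(3) by blast
  qed
  then have "rcosets\<^bsub>(GL_H1 FK)\<lparr>carrier := \<rho> ` torelli F\<rparr>\<^esub> ?H \<subseteq> (\<lambda>r. ?H #>\<^bsub>GL_H1 FK\<^esub> \<rho> r) ` R"
    unfolding torelli_def RCOSETS_def r_coset_def by auto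
  then show ?thesis using R(1) finite_subset by blast
qed

end

theorem theorem1p5:
  fixes n k :: nat and K :: "nat word set" and F :: "nat word monoid"
    and \<rho> :: "(nat word \<Rightarrow> nat word) \<Rightarrow> nat word set \<Rightarrow> nat word set"
  defines "F \<equiv> free_group_rank n"
  assumes "n \<ge> 3" and "k \<ge> 1"
    and "characteristic K F" and "finite (rcosets\<^bsub>F\<^esub> K)"
  defines "\<rho> \<equiv> homological_rep F K"
  shows "finite (rcosets\<^bsub>(GL_H1 (F\<lparr>carrier := K\<rparr>))\<lparr>carrier := \<rho> ` torelli F\<rparr>\<^esub> (\<rho> ` johnson F k))"
proof -
  interpret homological n K k
    using assms unfolding F_def by unfold_locales auto
  show ?thesis using finite_index unfolding F_def \<rho>_def .
qed

end
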